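(* Let $(G,\mathfrak h,V)$ be a Pfaffian group with associated map of representations $l:\mathfrak g\to V$, $\mathfrak h=\ker(l)$, and let $M$ be a manifold. A (full) principal $(G,\mathfrak h,V)$-bundle over $M$ is equivalent to the datum of a principal $G$-bundle $\pi:P\to M$ (action from the left) together with a $G$-equivariant vertical foliation $\mathcal F$ on $P$ and an isomorphism $\Phi:\nu_{\mathcal F}\xrightarrow{\ \cong\ }P\times V$ such that $$\Phi([\alpha^\dagger_p])=(p,l(\alpha)),\qquad \alpha\in\mathfrak g,\ p\in P.$$ Alternatively, a (full) principal $(G,\mathfrak h,V)$-bundle over $M$ is equivalent to the datum of a principal $G$-bundle $\pi:P\to M$ (action from the left) together with an equivariant, pointwise surjective 1-form $\theta\in\Omega^1(P,V)$ such that $\ker(\theta)$ is involutive, is vertical, and $$\theta(\alpha^\dagger_p)=l(\alpha),\qquad \alpha\in\mathfrak g,\ p\in P.$$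
   Context: **Pfaffian group.** A Pfaffian group $(G,\omega,V)$ is a Pfaffian groupoid over a point, i.e. a Lie group $G$ (with Lie algebra $\mathfrak g$ and unit $e$) with a representation $V$ and a form $\omega\in\Omega^1(G,V)$ that is multiplicative, $(m^*\omega)_{(g,h)}=(\mathrm{pr}_1^*\omega)_{(g,h)}+g\cdot(\mathrm{pr}_2^*\omega)_{(g,h)}$ ($m$ the multiplication), of constant rank, and with $\ker(\omega)$ involutive. It is encoded by the linear map $l=\omega_e:\mathfrak g\to V$, which is a morphism of representations from the adjoint representation to $V$, via $\omega(v_g)=l(dR_{g^{-1}}v_g)$. One writes $(G,\mathfrak h,V)$ with $\mathfrak h=\ker(l)\subset\mathfrak g$ (the map $l$ being part of the data). Pfaffian groups are not assumed to be full (i.e. $l$ need not be surjective). **Principal Pfaffian bundle.** A principal $(G,\mathfrak h,V)$-bundle over $M$ is a left principal $G$-bundle $\pi:P\to M$ together with a form $\theta\in\Omega^1(P,V)$ such that, with $m_P:G\times P\to P$ the action, $(m_P^*\theta)_{(g,p)}=(\mathrm{pr}_1^*\omega)_{(g,p)}+g\cdot(\mathrm{pr}_2^*\theta)_{(g,p)}$, and $\ker(\theta)\subset\ker(d\pi)$ (this is the general condition $\ker(d\mu)\cap\ker(\theta)=\ker(d\pi)\cap\ker(\theta)$, with $\mu$ the moment map, which here is the constant map $P\to\{\mathrm{pt}\}$). Standing assumption: such bundles are full, i.e. $\theta$ is pointwise surjective. **Notation.** $\alpha^\dagger_p=dm_P(\alpha_e,0_p)\in T_pP$ is the infinitesimal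 action of $\alpha\in\mathfrak g$ at $p$. A foliation (or distribution) on $P$ is vertical if it is tangent to the vertical bundle $\ker(d\pi)$. A foliation on $P$ is $G$-equivariant if its tangent distribution is preserved by the $G$-action. $\nu_{\mathcal F}=TP/T\mathcal F$ is the normal bundle of $\mathcal F$, and $P\times V$ is the trivial vector bundle over $P$; $\Phi$ is an isomorphism of vector bundles over $P$. A form $\theta\in\Omega^1(P,V)$ is equivariant if $\theta(g_*v)=g\cdot\theta(v)$ for all $g\in G$ and $v\in TP$.
   Formalization: The isomorphism Φ is additionally required to be G-equivariant (G acting on the normal bundle and diagonally on P×V); without this the first equivalence fails, e.g. for the oriented frame bundle of S² with l = 0, V = ℝ² trivial and F the vertical foliation. *)

theory Defs
  imports "HOL-Analysis.Analysis"
begin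

section \<open>Finite-dimensional model spaces and smooth maps between them\<close>

text \<open>
  Model spaces are arbitrary finite-dimensional normed spaces instead of types of class
  \<^class>\<open>euclidean_space\<close>, because the latter have dimension at least 1 and would exclude discrete
  groups, the zero representation, and a point as base. The norm is auxiliary: in finite
  dimension all norms are equivalent.
\<close>

class fin_dim_vector = real_normed_vector +
  assumes finite_spanning_set_aux: "\<exists>B. finite B \<and> (\<forall>x. \<exists>c. x = (\<Sum>b\<in>B. c b *\<^sub>R b))"

lemma finite_spanning_set: "\<exists>B :: 'a::fin_dim_vector set. finite B \<and> span B = UNIV"
proof -
  obtain B :: "'a set" where B: "finite B" "\<forall>x. \<exists>c. x = (\<Sum>b\<in>B. c b *\<^sub>R b)"
    using finite_spanning_set_aux by blast
  have "x \<in> span B" for x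
  proof -
    obtain c where "x = (\<Sum>b\<in>B. c b *\<^sub>R b)"
      using B by blast
    then show ?thesis
      by (simp add: span_sum span_scale span_base)
  qed
  then show ?thesis
    using B by blast
qed

lemma fin_dim_vectorI:
  assumes "finite B" "span B = (UNIV :: 'a::real_vector set)"
  shows "\<exists>B :: 'a set. finite B \<and> (\<forall>x. \<exists>c. x = (\<Sum>b\<in>B. c b *\<^sub>R b))"
proof (rule exI[of _ B], intro conjI allI)
  fix x :: 'a
  have "x \<in> range (\<lambda>c. \<Sum>b\<in>B. c b *\<^sub>R b)"
    using assms span_finite[of B] by simp
  then show "\<exists>c. x = (\<Sum>b\<in>B. c b *\<^sub>R b)"
    by blast
qed (rule assms)

instance euclidean_space \<subseteq> fin_dim_vector
  by standard (rule fin_dim_vectorI[OF finite_Basis span_Basis])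

instance prod :: (fin_dim_vector, fin_dim_vector) fin_dim_vector
proof
  obtain B :: "'a set" where B: "finite B" "span B = UNIV"
    using finite_spanning_set by blast
  obtain C :: "'b set" where C: "finite C" "span C = UNIV"
    using finite_spanning_set by blast
  let ?D = "(\<lambda>x. (x, 0)) ` B \<union> (\<lambda>y. (0, y)) ` C :: ('a \<times> 'b) set"
  have "(x, y) \<in> span ?D" for x y
  proof -
    have "linear (\<lambda>x :: 'a. (x, 0 :: 'b))" "linear (\<lambda>y :: 'b. (0 :: 'a, y))"
      by (auto simp: linear_iff)
    then have "span ((\<lambda>x. (x, 0 :: 'b)) ` B) = range (\<lambda>x. (x, 0))"
      "span ((\<lambda>y. (0 :: 'a, y)) ` C) = range (\<lambda>y. (0, y))"
      by (simp_all only: linear_span_image B C)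
    then have "(x, 0) \<in> span ((\<lambda>x. (x, 0 :: 'b)) ` B)" "(0, y) \<in> span ((\<lambda>y. (0 :: 'a, y)) ` C)"
      by simp_all
    then have "(x, 0) \<in> span ?D" "(0, y) \<in> span ?D"
      by (meson span_mono subsetD sup_ge1 sup_ge2)+
    then have "(x, 0) + (0, y) \<in> span ?D"
      by (rule span_add)
    then show ?thesis
      by simp
  qed
  then have "span ?D = UNIV"
    by auto
  moreover have "finite ?D"
    using B C by simp
  ultimately show "\<exists>A :: ('a \<times> 'b) set. finite A \<and> (\<forall>x. \<exists>c. x = (\<Sum>b\<in>A. c b *\<^sub>R b))"
    by (intro fin_dim_vectorI)
qed

fun C_on :: "nat \<Rightarrow> 'a set \<Rightarrow> ('a::real_normed_vector \<Rightarrow> 'b::real_normed_vector) \<Rightarrow> bool" where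
  "C_on 0 S f \<longleftrightarrow> continuous_on S f"
| "C_on (Suc n) S f \<longleftrightarrow>
    (\<forall>x\<in>S. f differentiable (at x)) \<and> (\<forall>v. C_on n S (\<lambda>x. frechet_derivative f (at x) v))"

text \<open>Only used for open \<open>S\<close> and finite-dimensional domains; there it is \<open>C\<^sup>\<infinity>\<close>.\<close>

definition smooth_on :: "'a set \<Rightarrow> ('a::real_normed_vector \<Rightarrow> 'b::real_normed_vector) \<Rightarrow> bool" where
  "smooth_on S f \<longleftrightarrow> (\<forall>n. C_on n S f)"

section \<open>Smooth manifolds\<close>

text \<open>
  A chart is a pair \<open>(U, \<phi>)\<close>; the values of \<open>\<phi>\<close> outside \<open>U\<close> are irrelevant. The underlying set of a
  manifold is its whole point type. A manifold is given by an atlas, together with a preferred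
  chart at every point. The tangent space \<open>T\<^sub>p\<close> is the model space \<open>'e\<close>, a tangent vector being
  represented by its coordinates in the preferred chart at its foot point \<open>p\<close>; the choice
  of preferred charts only affects this representation.
\<close>

type_synonym ('a, 'e) chart = "'a set \<times> ('a \<Rightarrow> 'e)"

record ('a, 'e) manifold =
  charts :: "('a, 'e) chart set"
  chart_at :: "'a \<Rightarrow> ('a, 'e) chart"

abbreviation chart_inv :: "('a, 'e) chart \<Rightarrow> 'e \<Rightarrow> 'a" where
  "chart_inv c \<equiv> inv_into (fst c) (snd c)"

definition smooth_manifold ::
  "('a::{t2_space, second_countable_topology}, 'e::fin_dim_vector) manifold \<Rightarrow> bool" where
  "smooth_manifold M \<longleftrightarrow>
     (\<forall>(U, \<phi>) \<in> charts M. open U \<and> open (\<phi> ` U) \<and> homeomorphism U (\<phi> ` U) \<phi> (inv_into U \<phi>)) \<and>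
     (\<forall>(U, \<phi>) \<in> charts M. \<forall>(W, \<psi>) \<in> charts M. smooth_on (\<phi> ` (U \<inter> W)) (\<psi> \<circ> inv_into U \<phi>)) \<and>
     (\<forall>p. chart_at M p \<in> charts M \<and> p \<in> fst (chart_at M p))"

definition vector_manifold :: "('e, 'e) manifold" where
  "vector_manifold = \<lparr>charts = {(UNIV, id)}, chart_at = (\<lambda>_. (UNIV, id))\<rparr>"

definition prod_chart :: "('a, 'e) chart \<Rightarrow> ('b, 'f) chart \<Rightarrow> ('a \<times> 'b, 'e \<times> 'f) chart" where
  "prod_chart c d = (fst c \<times> fst d, map_prod (snd c) (snd d))"

text \<open>With this choice \<open>T\<^sub>(\<^sub>p\<^sub>,\<^sub>q\<^sub>)(M \<times> N) = T\<^sub>pM \<times> T\<^sub>qN\<close> holds on the nose.\<close>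

definition prod_manifold ::
  "('a, 'e) manifold \<Rightarrow> ('b, 'f) manifold \<Rightarrow> ('a \<times> 'b, 'e \<times> 'f) manifold" where
  "prod_manifold M N =
     \<lparr>charts = (\<lambda>(c, d). prod_chart c d) ` (charts M \<times> charts N),
      chart_at = (\<lambda>(p, q). prod_chart (chart_at M p) (chart_at N q))\<rparr>"

definition smooth_map_on ::
  "('a::topological_space, 'e::real_normed_vector) manifold \<Rightarrow>
   ('b::topological_space, 'f::real_normed_vector) manifold \<Rightarrow> 'a set \<Rightarrow> ('a \<Rightarrow> 'b) \<Rightarrow> bool" where
  "smooth_map_on M N S f \<longleftrightarrow>
     continuous_on S f \<and>
     (\<forall>(U, \<phi>) \<in> charts M. \<forall>(W, \<psi>) \<in> charts N.
        smooth_on (\<phi> ` (U \<inter> S \<inter> f -` W)) (\<psi> \<circ> f \<circ> inv_into U \<phi>))"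

abbreviation smooth_map ::
  "('a::topological_space, 'e::real_normed_vector) manifold \<Rightarrow>
   ('b::topological_space, 'f::real_normed_vector) manifold \<Rightarrow> ('a \<Rightarrow> 'b) \<Rightarrow> bool" where
  "smooth_map M N f \<equiv> smooth_map_on M N UNIV f"

definition tangent_map ::
  "('a, 'e::real_normed_vector) manifold \<Rightarrow> ('b, 'f::real_normed_vector) manifold \<Rightarrow>
   ('a \<Rightarrow> 'b) \<Rightarrow> 'a \<Rightarrow> 'e \<Rightarrow> 'f" where
  "tangent_map M N f p =
     frechet_derivative (snd (chart_at N (f p)) \<circ> f \<circ> chart_inv (chart_at M p))
       (at (snd (chart_at M p) p))"

section \<open>One-forms, vector fields, distributions\<close>

text \<open>A \<open>V\<close>-valued one-form \<open>\<theta>\<close> on a manifold is a family of linear maps \<open>\<theta> p : T\<^sub>p \<rightarrow> V\<close>.\<close>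

definition pullback ::
  "('a, 'e::real_normed_vector) manifold \<Rightarrow> ('b, 'f::real_normed_vector) manifold \<Rightarrow>
   ('a \<Rightarrow> 'b) \<Rightarrow> ('b \<Rightarrow> 'f \<Rightarrow> 'v) \<Rightarrow> 'a \<Rightarrow> 'e \<Rightarrow> 'v" where
  "pullback M N f \<theta> p v = \<theta> (f p) (tangent_map M N f p v)"

definition smooth_one_form ::
  "('a, 'e::fin_dim_vector) manifold \<Rightarrow> ('a \<Rightarrow> 'e \<Rightarrow> 'v::fin_dim_vector) \<Rightarrow> bool" where
  "smooth_one_form M \<theta> \<longleftrightarrow>
     (\<forall>p. linear (\<theta> p)) \<and>
     (\<forall>(U, \<phi>) \<in> charts M. \<forall>v.
        smooth_on (\<phi> ` U) (\<lambda>x. pullback vector_manifold M (inv_into U \<phi>) \<theta> x v))"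

text \<open>The coordinate expression \<open>\<phi>\<^sub>*X\<close> of a vector field \<open>X\<close> in a chart \<open>(U, \<phi>)\<close>.\<close>

definition chart_rep ::
  "('a, 'e::real_normed_vector) manifold \<Rightarrow> ('a, 'e) chart \<Rightarrow> ('a \<Rightarrow> 'e) \<Rightarrow> 'e \<Rightarrow> 'e" where
  "chart_rep M c X x =
     tangent_map M vector_manifold (snd c) (chart_inv c x) (X (chart_inv c x))"

definition smooth_vector_field_on ::
  "('a, 'e::fin_dim_vector) manifold \<Rightarrow> 'a set \<Rightarrow> ('a \<Rightarrow> 'e) \<Rightarrow> bool" where
  "smooth_vector_field_on M W X \<longleftrightarrow>
     (\<forall>(U, \<phi>) \<in> charts M. smooth_on (\<phi> ` (U \<inter> W)) (chart_rep M (U, \<phi>) X))"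

text \<open>
  The bracket \<open>[X, Y]\<close> at \<open>p\<close>, by the coordinate formula \<open>D\<eta>(\<xi>) - D\<xi>(\<eta>)\<close> in the preferred chart at
  \<open>p\<close>, in which the coordinates of \<open>X p\<close> and \<open>Y p\<close> are \<open>X p\<close> and \<open>Y p\<close> themselves.
\<close>

definition lie_bracket ::
  "('a, 'e::real_normed_vector) manifold \<Rightarrow> ('a \<Rightarrow> 'e) \<Rightarrow> ('a \<Rightarrow> 'e) \<Rightarrow> 'a \<Rightarrow> 'e" where
  "lie_bracket M X Y p =
     (let c = chart_at M p; x = snd c p in
        frechet_derivative (chart_rep M c Y) (at x) (X p)
        - frechet_derivative (chart_rep M c X) (at x) (Y p))"

definition involutive :: "('a::topological_space, 'e::fin_dim_vector) manifold \<Rightarrow> ('a \<Rightarrow> 'e set) \<Rightarrow> bool"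
  where
  "involutive M F \<longleftrightarrow>
     (\<forall>W X Y. open W \<and> smooth_vector_field_on M W X \<and> smooth_vector_field_on M W Y \<and>
        (\<forall>p\<in>W. X p \<in> F p \<and> Y p \<in> F p) \<longrightarrow> (\<forall>p\<in>W. lie_bracket M X Y p \<in> F p))"

definition smooth_distribution ::
  "('a::topological_space, 'e::fin_dim_vector) manifold \<Rightarrow> ('a \<Rightarrow> 'e set) \<Rightarrow> bool" where
  "smooth_distribution M F \<longleftrightarrow>
     (\<forall>p. subspace (F p)) \<and>
     (\<exists>k. (\<forall>p. dim (F p) = k) \<and>
        (\<forall>p. \<exists>W X. open W \<and> p \<in> W \<and> (\<forall>i<k. smooth_vector_field_on M W (X i)) \<and>
           (\<forall>q\<in>W. span ((\<lambda>i. X i q) ` {..<k}) = F q)))"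

text \<open>
  A foliation is understood as an involutive subbundle of the tangent bundle, i.e. it is given by its
  tangent distribution.
\<close>

definition foliation ::
  "('a::topological_space, 'e::fin_dim_vector) manifold \<Rightarrow> ('a \<Rightarrow> 'e set) \<Rightarrow> bool" where
  "foliation M F \<longleftrightarrow> smooth_distribution M F \<and> involutive M F"

definition ker_form :: "('a \<Rightarrow> 'e \<Rightarrow> 'v::zero) \<Rightarrow> 'a \<Rightarrow> 'e set" where
  "ker_form \<theta> p = {v. \<theta> p v = 0}"

definition vertical ::
  "('a, 'e::real_normed_vector) manifold \<Rightarrow> ('b, 'f::real_normed_vector) manifold \<Rightarrow> ('a \<Rightarrow> 'b) \<Rightarrow>
   ('a \<Rightarrow> 'e set) \<Rightarrow> bool" where
  "vertical P M \<pi> F \<longleftrightarrow> (\<forall>p. F p \<subseteq> ker_form (tangent_map P M \<pi>) p)"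

section \<open>The normal bundle of a foliation\<close>

definition normal_class :: "('a \<Rightarrow> 'e::ab_group_add set) \<Rightarrow> 'a \<Rightarrow> 'e \<Rightarrow> 'e set" where
  "normal_class F p v = (\<lambda>w. v + w) ` F p"

definition normal_bundle :: "('a \<Rightarrow> 'e::ab_group_add set) \<Rightarrow> ('a \<times> 'e set) set" where
  "normal_bundle F = {(p, normal_class F p v) | p v. True}"

text \<open>The smooth sections of \<open>TP/TF\<close> are those which lift locally to smooth vector fields.\<close>

definition smooth_normal_section ::
  "('a::topological_space, 'e::fin_dim_vector) manifold \<Rightarrow> ('a \<Rightarrow> 'e set) \<Rightarrow> 'a set \<Rightarrow>
   ('a \<Rightarrow> 'e set) \<Rightarrow> bool" where
  "smooth_normal_section P F W s \<longleftrightarrow>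
     (\<forall>p\<in>W. \<exists>W' X. open W' \<and> p \<in> W' \<and> W' \<subseteq> W \<and> smooth_vector_field_on P W' X \<and>
        (\<forall>q\<in>W'. s q = normal_class F q (X q)))"

text \<open>
  Isomorphisms from the normal bundle to the trivial bundle \<open>P \<times> V\<close> over the identity of \<open>P\<close>:
  fibrewise linear bijections which are smooth together with their inverse, i.e. identify the smooth
  local sections. Extensionality makes \<open>\<Phi>\<close> a map defined on the normal bundle only.
\<close>

definition normal_bundle_iso ::
  "('a::topological_space, 'e::fin_dim_vector) manifold \<Rightarrow> ('a \<Rightarrow> 'e set) \<Rightarrow>
   ('a \<times> 'e set \<Rightarrow> 'a \<times> 'v::fin_dim_vector) \<Rightarrow> bool" where
  "normal_bundle_iso P F \<Phi> \<longleftrightarrow>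
     \<Phi> \<in> extensional (normal_bundle F) \<and>
     bij_betw \<Phi> (normal_bundle F) UNIV \<and>
     (\<forall>p v. fst (\<Phi> (p, normal_class F p v)) = p) \<and>
     (\<forall>p. linear (\<lambda>v. snd (\<Phi> (p, normal_class F p v)))) \<and>
     (\<forall>W s. open W \<and> (\<forall>p\<in>W. (p, s p) \<in> normal_bundle F) \<longrightarrow>
        (smooth_normal_section P F W s \<longleftrightarrow>
         smooth_map_on P vector_manifold W (\<lambda>p. snd (\<Phi> (p, s p)))))"

section \<open>Pfaffian groups\<close>

definition lie_group ::
  "('g::{t2_space, second_countable_topology}, 'l::fin_dim_vector) manifold \<Rightarrow>
   ('g \<Rightarrow> 'g \<Rightarrow> 'g) \<Rightarrow> 'g \<Rightarrow> ('g \<Rightarrow> 'g) \<Rightarrow> bool" where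
  "lie_group G mul one ginv \<longleftrightarrow>
     group mul one ginv \<and> smooth_manifold G \<and>
     smooth_map (prod_manifold G G) G (\<lambda>(g, h). mul g h) \<and> smooth_map G G ginv"

definition representation ::
  "('g::topological_space, 'l::fin_dim_vector) manifold \<Rightarrow> ('g \<Rightarrow> 'g \<Rightarrow> 'g) \<Rightarrow> 'g \<Rightarrow>
   ('g \<Rightarrow> 'v::fin_dim_vector \<Rightarrow> 'v) \<Rightarrow> bool" where
  "representation G mul one \<rho> \<longleftrightarrow>
     (\<forall>g. linear (\<rho> g)) \<and> (\<forall>v. \<rho> one v = v) \<and> (\<forall>g h v. \<rho> (mul g h) v = \<rho> g (\<rho> h v)) \<and>
     smooth_map (prod_manifold G vector_manifold) vector_manifold (\<lambda>(g, v). \<rho> g v)"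

text \<open>
  The condition \<open>(m\<^sup>*\<theta>)\<^sub>(\<^sub>g\<^sub>,\<^sub>p\<^sub>) = (pr\<^sub>1\<^sup>*\<omega>)\<^sub>(\<^sub>g\<^sub>,\<^sub>p\<^sub>) + g \<cdot> (pr\<^sub>2\<^sup>*\<theta>)\<^sub>(\<^sub>g\<^sub>,\<^sub>p\<^sub>)\<close> for an action \<open>m : G \<times> P \<rightarrow> P\<close>; taking
  for \<open>m\<close> the multiplication of \<open>G\<close> and \<open>\<theta> = \<omega>\<close>, it says that \<open>\<omega>\<close> is multiplicative.
\<close>

definition multiplicative_over ::
  "('g, 'l::fin_dim_vector) manifold \<Rightarrow> ('g \<Rightarrow> 'v::fin_dim_vector \<Rightarrow> 'v) \<Rightarrow> ('g \<Rightarrow> 'l \<Rightarrow> 'v) \<Rightarrow>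
   ('p, 'e::fin_dim_vector) manifold \<Rightarrow> ('g \<Rightarrow> 'p \<Rightarrow> 'p) \<Rightarrow> ('p \<Rightarrow> 'e \<Rightarrow> 'v) \<Rightarrow> bool" where
  "multiplicative_over G \<rho> \<omega> P act \<theta> \<longleftrightarrow>
     (\<forall>g p. \<forall>w :: 'l \<times> 'e.
        pullback (prod_manifold G P) P (\<lambda>(g, p). act g p) \<theta> (g, p) w =
        pullback (prod_manifold G P) G fst \<omega> (g, p) w
        + \<rho> g (pullback (prod_manifold G P) P snd \<theta> (g, p) w))"

definition pfaffian_group ::
  "('g::{t2_space, second_countable_topology}, 'l::fin_dim_vector) manifold \<Rightarrow>
   ('g \<Rightarrow> 'g \<Rightarrow> 'g) \<Rightarrow> 'g \<Rightarrow> ('g \<Rightarrow> 'g) \<Rightarrow> ('g \<Rightarrow> 'v::fin_dim_vector \<Rightarrow> 'v) \<Rightarrow>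
   ('g \<Rightarrow> 'l \<Rightarrow> 'v) \<Rightarrow> bool" where
  "pfaffian_group G mul one ginv \<rho> \<omega> \<longleftrightarrow>
     lie_group G mul one ginv \<and> representation G mul one \<rho> \<and> smooth_one_form G \<omega> \<and>
     multiplicative_over G \<rho> \<omega> G mul \<omega> \<and>
     (\<exists>k. \<forall>g. dim (range (\<omega> g)) = k) \<and> involutive G (ker_form \<omega>)"

section \<open>Principal bundles\<close>

definition principal_bundle ::
  "('g::{t2_space, second_countable_topology}, 'l::fin_dim_vector) manifold \<Rightarrow>
   ('g \<Rightarrow> 'g \<Rightarrow> 'g) \<Rightarrow> 'g \<Rightarrow>
   ('p::{t2_space, second_countable_topology}, 'e::fin_dim_vector) manifold \<Rightarrow>
   ('g \<Rightarrow> 'p \<Rightarrow> 'p) \<Rightarrow>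
   ('m::{t2_space, second_countable_topology}, 'f::fin_dim_vector) manifold \<Rightarrow> ('p \<Rightarrow> 'm) \<Rightarrow> bool"
  where
  "principal_bundle G mul one P act M \<pi> \<longleftrightarrow>
     smooth_manifold P \<and> smooth_manifold M \<and> smooth_map P M \<pi> \<and>
     smooth_map (prod_manifold G P) P (\<lambda>(g, p). act g p) \<and>
     (\<forall>p. act one p = p) \<and> (\<forall>g h p. act (mul g h) p = act g (act h p)) \<and>
     (\<forall>g p. \<pi> (act g p) = \<pi> p) \<and>
     (\<forall>x. \<exists>U \<tau> \<sigma>. open U \<and> x \<in> U \<and>
        smooth_map_on P (prod_manifold G M) (\<pi> -` U) \<tau> \<and>
        smooth_map_on (prod_manifold G M) P (UNIV \<times> U) \<sigma> \<and>
        (\<forall>p \<in> \<pi> -` U. \<tau> p \<in> UNIV \<times> U \<and> \<sigma> (\<tau> p) = p) \<and>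
        (\<forall>z \<in> UNIV \<times> U. \<sigma> z \<in> \<pi> -` U \<and> \<tau> (\<sigma> z) = z) \<and>
        (\<forall>p \<in> \<pi> -` U. snd (\<tau> p) = \<pi> p \<and> (\<forall>g. \<tau> (act g p) = (mul g (fst (\<tau> p)), \<pi> p))))"

text \<open>\<open>\<alpha>\<^sup>\<dagger>\<^sub>p = dm(\<alpha>\<^sub>e, 0\<^sub>p)\<close>\<close>

definition inf_action ::
  "('g, 'l::fin_dim_vector) manifold \<Rightarrow> 'g \<Rightarrow> ('p, 'e::fin_dim_vector) manifold \<Rightarrow>
   ('g \<Rightarrow> 'p \<Rightarrow> 'p) \<Rightarrow> 'l \<Rightarrow> 'p \<Rightarrow> 'e" where
  "inf_action G one P act \<alpha> p =
     tangent_map (prod_manifold G P) P (\<lambda>(g, p). act g p) (one, p) (\<alpha>, 0)"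

definition principal_pfaffian_bundle ::
  "('g::{t2_space, second_countable_topology}, 'l::fin_dim_vector) manifold \<Rightarrow>
   ('g \<Rightarrow> 'g \<Rightarrow> 'g) \<Rightarrow> 'g \<Rightarrow> ('g \<Rightarrow> 'v::fin_dim_vector \<Rightarrow> 'v) \<Rightarrow> ('g \<Rightarrow> 'l \<Rightarrow> 'v) \<Rightarrow>
   ('p::{t2_space, second_countable_topology}, 'e::fin_dim_vector) manifold \<Rightarrow>
   ('g \<Rightarrow> 'p \<Rightarrow> 'p) \<Rightarrow>
   ('m::{t2_space, second_countable_topology}, 'f::fin_dim_vector) manifold \<Rightarrow> ('p \<Rightarrow> 'm) \<Rightarrow>
   ('p \<Rightarrow> 'e \<Rightarrow> 'v) \<Rightarrow> bool" where
  "principal_pfaffian_bundle G mul one \<rho> \<omega> P act M \<pi> \<theta> \<longleftrightarrow>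
     principal_bundle G mul one P act M \<pi> \<and> smooth_one_form P \<theta> \<and>
     multiplicative_over G \<rho> \<omega> P act \<theta> \<and> vertical P M \<pi> (ker_form \<theta>) \<and> (\<forall>p. surj (\<theta> p))"

section \<open>The two alternative data\<close>

definition equivariant_distribution ::
  "('p, 'e::real_normed_vector) manifold \<Rightarrow> ('g \<Rightarrow> 'p \<Rightarrow> 'p) \<Rightarrow> ('p \<Rightarrow> 'e set) \<Rightarrow> bool" where
  "equivariant_distribution P act F \<longleftrightarrow>
     (\<forall>g p. tangent_map P P (act g) p ` F p = F (act g p))"

text \<open>
  Equivariance of \<open>\<Phi>\<close> for the action \<open>g \<cdot> (p, [v]) = (g \<cdot> p, [g\<^sub>*v])\<close> on the normal bundle of an
  equivariant foliation and the diagonal action on \<open>P \<times> V\<close>.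
\<close>

definition equivariant_normal_map ::
  "('p, 'e::real_normed_vector) manifold \<Rightarrow> ('g \<Rightarrow> 'p \<Rightarrow> 'p) \<Rightarrow> ('g \<Rightarrow> 'v \<Rightarrow> 'v) \<Rightarrow>
   ('p \<Rightarrow> 'e set) \<Rightarrow> ('p \<times> 'e set \<Rightarrow> 'p \<times> 'v) \<Rightarrow> bool" where
  "equivariant_normal_map P act \<rho> F \<Phi> \<longleftrightarrow>
     (\<forall>g p v. \<Phi> (act g p, normal_class F (act g p) (tangent_map P P (act g) p v)) =
        map_prod (act g) (\<rho> g) (\<Phi> (p, normal_class F p v)))"

text \<open>
  The isomorphism \<open>\<Phi>\<close> has to be one of \<open>G\<close>-equivariant vector bundles. The condition on \<open>[\<alpha>\<^sup>\<dagger>]\<close> implies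
  this on classes of vertical vectors only: if \<open>G\<close> acts trivially on \<open>V = \<real>\<^sup>n\<close>, \<open>\<omega> = 0\<close>,
  \<open>P = G \<times> \<real>\<^sup>n\<close> and \<open>F\<close> is the vertical bundle, then every trivialisation of the pullback of \<open>T\<real>\<^sup>n\<close> to
  \<open>P\<close> satisfies it, but only the \<open>G\<close>-invariant ones come from principal Pfaffian bundles.
\<close>

definition foliation_datum ::
  "('g::{t2_space, second_countable_topology}, 'l::fin_dim_vector) manifold \<Rightarrow>
   ('g \<Rightarrow> 'g \<Rightarrow> 'g) \<Rightarrow> 'g \<Rightarrow> ('g \<Rightarrow> 'v::fin_dim_vector \<Rightarrow> 'v) \<Rightarrow> ('l \<Rightarrow> 'v) \<Rightarrow>
   ('p::{t2_space, second_countable_topology}, 'e::fin_dim_vector) manifold \<Rightarrow>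
   ('g \<Rightarrow> 'p \<Rightarrow> 'p) \<Rightarrow>
   ('m::{t2_space, second_countable_topology}, 'f::fin_dim_vector) manifold \<Rightarrow> ('p \<Rightarrow> 'm) \<Rightarrow>
   ('p \<Rightarrow> 'e set) \<Rightarrow> ('p \<times> 'e set \<Rightarrow> 'p \<times> 'v) \<Rightarrow> bool" where
  "foliation_datum G mul one \<rho> l P act M \<pi> F \<Phi> \<longleftrightarrow>
     principal_bundle G mul one P act M \<pi> \<and>
     foliation P F \<and> equivariant_distribution P act F \<and> vertical P M \<pi> F \<and>
     normal_bundle_iso P F \<Phi> \<and> equivariant_normal_map P act \<rho> F \<Phi> \<and>
     (\<forall>\<alpha> p. \<Phi> (p, normal_class F p (inf_action G one P act \<alpha> p)) = (p, l \<alpha>))"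

definition equivariant_form ::
  "('p, 'e::real_normed_vector) manifold \<Rightarrow> ('g \<Rightarrow> 'p \<Rightarrow> 'p) \<Rightarrow> ('g \<Rightarrow> 'v \<Rightarrow> 'v) \<Rightarrow>
   ('p \<Rightarrow> 'e \<Rightarrow> 'v) \<Rightarrow> bool" where
  "equivariant_form P act \<rho> \<theta> \<longleftrightarrow>
     (\<forall>g p v. \<theta> (act g p) (tangent_map P P (act g) p v) = \<rho> g (\<theta> p v))"

definition form_datum ::
  "('g::{t2_space, second_countable_topology}, 'l::fin_dim_vector) manifold \<Rightarrow>
   ('g \<Rightarrow> 'g \<Rightarrow> 'g) \<Rightarrow> 'g \<Rightarrow> ('g \<Rightarrow> 'v::fin_dim_vector \<Rightarrow> 'v) \<Rightarrow> ('l \<Rightarrow> 'v) \<Rightarrow>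
   ('p::{t2_space, second_countable_topology}, 'e::fin_dim_vector) manifold \<Rightarrow>
   ('g \<Rightarrow> 'p \<Rightarrow> 'p) \<Rightarrow>
   ('m::{t2_space, second_countable_topology}, 'f::fin_dim_vector) manifold \<Rightarrow> ('p \<Rightarrow> 'm) \<Rightarrow>
   ('p \<Rightarrow> 'e \<Rightarrow> 'v) \<Rightarrow> bool" where
  "form_datum G mul one \<rho> l P act M \<pi> \<theta> \<longleftrightarrow>
     principal_bundle G mul one P act M \<pi> \<and>
     smooth_one_form P \<theta> \<and> equivariant_form P act \<rho> \<theta> \<and> (\<forall>p. surj (\<theta> p)) \<and>
     involutive P (ker_form \<theta>) \<and> vertical P M \<pi> (ker_form \<theta>) \<and>
     (\<forall>\<alpha> p. \<theta> p (inf_action G one P act \<alpha> p) = l \<alpha>)"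

text \<open>The map \<open>[v] \<mapsto> (p, \<theta>\<^sub>p(v))\<close> induced by \<open>\<theta>\<close> on the normal bundle of its kernel.\<close>

definition induced_normal_map ::
  "('p \<Rightarrow> 'e::ab_group_add \<Rightarrow> 'v::zero) \<Rightarrow> 'p \<times> 'e set \<Rightarrow> 'p \<times> 'v" where
  "induced_normal_map \<theta> =
     (\<lambda>(p, c) \<in> normal_bundle (ker_form \<theta>). (p, THE y. \<forall>v\<in>c. \<theta> p v = y))"

end

theory Submission
  imports Defs
begin

text \<open>
  Splitting \<open>T(G \<times> P)\<close>, multiplicativity of \<open>\<theta>\<close> over \<open>\<omega>\<close> says that \<open>\<theta>\<close> is equivariant and that every orbit
  map \<open>g \<mapsto> g \<cdot> p\<close> pulls \<open>\<theta>\<close> back to \<open>\<omega>\<close>; as both are determined by right translation to the unit, the latter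
  amounts to \<open>\<theta>(\<alpha>\<^sup>\<dagger>) = l(\<alpha>)\<close>. Involutivity of \<open>ker \<theta>\<close> is automatic: its sections are vertical, so on each fibre
  they are related along an orbit map to fields in \<open>ker \<omega>\<close>, and brackets of related fields are related.
  Moreover \<open>ker \<theta> = {\<alpha>\<^sup>\<dagger> | l(\<alpha>) = 0}\<close> has a global smooth frame. Finally, \<open>\<theta>\<close> and the trivialisation of the
  normal bundle determine each other by \<open>\<Phi>(p, [v]) = (p, \<theta>(v))\<close>; that smooth sections correspond uses local
  smooth right inverses of \<open>\<theta>\<close>.
\<close>

section \<open>Calculus on finite-dimensional model spaces\<close>

text \<open>Model spaces carry a norm but neither an inner product nor a preferred basis. A basis is
  therefore chosen once, and boundedness of linear maps, the chain rule in all orders and the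
  symmetry of second derivatives are obtained from real coordinates. The symmetry is what makes
  brackets of related fields related. Tangent bundles are never formed. Smoothness of a field is
  tested along maps from open sets of a model space (\<open>smooth_along\<close>), where pushing
  forward and applying one-forms compose well. The fields \<open>inf_action\<close>, the fields
  pulled back to \<open>G\<close> and the local lifts of normal sections are all treated in this
  way. Relating a field on \<open>P\<close> to one on \<open>G\<close> along an orbit map needs an
  inverse of that orbit map on the fibre. The group component of a local trivialisation provides it.
  The same component shows that the infinitesimal action is injective and reaches every vertical
  vector, which gives the kernel of \<open>\<theta>\<close> constant rank.\<close>

text \<open>Induction on the basis. The new vector \<open>b\<close> keeps a positive distance
  \<open>d\<close> from \<open>span B\<close>: vectors of \<open>span B\<close> converging to
  \<open>b\<close> would have Cauchy coordinates by the induction hypothesis, and the limits of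
  these coordinates would express \<open>b\<close> in \<open>span B\<close>.\<close>

lemma coordinates_bounded:
  fixes B :: "'a::real_normed_vector set"
  assumes "finite B" "independent B"
  shows "\<exists>C. \<forall>u. (\<Sum>b\<in>B. \<bar>u b\<bar>) \<le> C * norm (\<Sum>b\<in>B. u b *\<^sub>R b)"
  using assms
proof (induction rule: finite_induct)
  case empty
  then show ?case by simp
next
  case (insert b B)
  have ind: "independent B" and b: "b \<notin> span B"
    using insert.hyps insert.prems by (auto simp: independent_insert)
  obtain C0 where C0: "\<And>u. (\<Sum>b\<in>B. \<bar>u b\<bar>) \<le> C0 * norm (\<Sum>b\<in>B. u b *\<^sub>R b)"
    using insert.IH[OF ind] by blast
  \<comment> \<open>For empty \<open>B\<close> the constant \<open>C0\<close> could be negative, but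
    the estimates below multiply inequalities by it.\<close>
  define C where "C = max C0 0"
  have C: "(\<Sum>b\<in>B. \<bar>u b\<bar>) \<le> C * norm (\<Sum>b\<in>B. u b *\<^sub>R b)" for u
    by (rule order_trans[OF C0]) (simp add: C_def mult_right_mono)
  have C_nonneg: "C \<ge> 0"
    by (simp add: C_def)
  have "\<exists>d>0. \<forall>u. d \<le> norm (b - (\<Sum>c\<in>B. u c *\<^sub>R c))"
  proof (rule ccontr)
    assume "\<not> ?thesis"
    then have "\<exists>u. norm (b - (\<Sum>c\<in>B. u c *\<^sub>R c)) < inverse (real (Suc n))" for n
      by (meson inverse_positive_iff_positive not_le of_nat_0_less_iff zero_less_Suc)
    then obtain u where u: "\<And>n. norm (b - (\<Sum>c\<in>B. u n c *\<^sub>R c)) < inverse (real (Suc n))"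
      by metis
    define x where "x n = (\<Sum>c\<in>B. u n c *\<^sub>R c)" for n
    have "(\<lambda>n. b - x n) \<longlonglongrightarrow> 0"
      using u unfolding x_def
      by (intro Lim_null_comparison[OF _ LIMSEQ_inverse_real_of_nat]) (auto intro: always_eventually less_imp_le)
    then have x: "x \<longlonglongrightarrow> b"
      using tendsto_diff[OF tendsto_const[of b]] by fastforce
    have "Cauchy (\<lambda>n. u n c)" if c: "c \<in> B" for c
    proof (rule metric_CauchyI)
      fix e :: real assume e: "e > 0"
      \<comment> \<open>\<open>C\<close> may be 0, hence the divisor \<open>C + 1\<close>.\<close>
      then have "e / (C + 1) > 0"
        using C_nonneg by simp
      then obtain N where N: "\<And>m n. m \<ge> N \<Longrightarrow> n \<ge> N \<Longrightarrow> dist (x m) (x n) < e / (C + 1)"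
        using metric_CauchyD[OF LIMSEQ_imp_Cauchy[OF x]] by blast
      have "dist (u m c) (u n c) < e" if "m \<ge> N" "n \<ge> N" for m n
      proof -
        have "dist (u m c) (u n c) \<le> (\<Sum>c\<in>B. \<bar>u m c - u n c\<bar>)"
          unfolding dist_real_def by (rule member_le_sum[OF c]) (auto simp: insert.hyps)
        also have "\<dots> \<le> C * dist (x m) (x n)"
          using C[of "\<lambda>c. u m c - u n c"]
          by (simp add: x_def dist_norm scaleR_left_diff_distrib sum_subtractf)
        also have "\<dots> \<le> (C + 1) * dist (x m) (x n)"
          by (simp add: mult_right_mono)
        also have "\<dots> < e"
          using N[OF that] C_nonneg by (simp add: field_simps)
        finally show ?thesis .
      qed
      then show "\<exists>M. \<forall>m\<ge>M. \<forall>n\<ge>M. dist (u m c) (u n c) < e"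
        by blast
    qed
    then have "\<exists>l. (\<lambda>n. u n c) \<longlonglongrightarrow> l" if "c \<in> B" for c
      using that by (simp add: Cauchy_convergent_iff convergent_def)
    then obtain w where "\<And>c. c \<in> B \<Longrightarrow> (\<lambda>n. u n c) \<longlonglongrightarrow> w c"
      by metis
    then have "x \<longlonglongrightarrow> (\<Sum>c\<in>B. w c *\<^sub>R c)"
      unfolding x_def by (intro tendsto_intros)
    then have "b = (\<Sum>c\<in>B. w c *\<^sub>R c)"
      using x LIMSEQ_unique by blast
    then have "b \<in> span B"
      by (simp add: span_sum span_scale span_base)
    with b show False by contradiction
  qed
  then obtain d where d: "d > 0" "\<And>u. d \<le> norm (b - (\<Sum>c\<in>B. u c *\<^sub>R c))"
    by blast
  \<comment> \<open>Let \<open>N\<close> be the norm of the whole combination and \<open>y\<close>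
    its part in \<open>span B\<close>. Dividing by \<open>u b\<close> and using the distance
    \<open>d\<close> gives \<open>\<bar>u b\<bar> \<le> N / d\<close>; then
    \<open>norm y \<le> N + N / d * norm b\<close>, and \<open>C\<close> bounds the other
    coordinates.\<close>
  have "(\<Sum>c\<in>insert b B. \<bar>u c\<bar>) \<le> (1 / d + C * (1 + norm b / d)) * norm (\<Sum>c\<in>insert b B. u c *\<^sub>R c)" for u
  proof -
    define y where "y = (\<Sum>c\<in>B. u c *\<^sub>R c)"
    define N where "N = norm (u b *\<^sub>R b + y)"
    have "\<bar>u b\<bar> * d \<le> N"
    proof (cases "u b = 0")
      case False
      have "d \<le> norm (b - (\<Sum>c\<in>B. (- u c / u b) *\<^sub>R c))"
        by (rule d)
      also have "(\<Sum>c\<in>B. (- u c / u b) *\<^sub>R c) = - (y /\<^sub>R u b)"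
        by (simp add: y_def scaleR_sum_right sum_negf divide_inverse mult.commute)
      finally have "\<bar>u b\<bar> * d \<le> \<bar>u b\<bar> * norm (b + y /\<^sub>R u b)"
        by (simp add: mult_left_mono)
      also have "\<dots> = norm (u b *\<^sub>R (b + y /\<^sub>R u b))"
        by simp
      also have "u b *\<^sub>R (b + y /\<^sub>R u b) = u b *\<^sub>R b + y"
        using False by (simp add: scaleR_right_distrib)
      finally show ?thesis
        by (simp add: N_def)
    qed (simp add: N_def)
    then have ub: "\<bar>u b\<bar> \<le> N / d"
      using d(1) by (simp add: field_simps)
    have "norm y \<le> N + \<bar>u b\<bar> * norm b"
      using norm_triangle_ineq4[of "u b *\<^sub>R b + y" "u b *\<^sub>R b"] by (simp add: N_def)
    also have "\<dots> \<le> N + N / d * norm b"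
      using mult_right_mono[OF ub norm_ge_zero[of b]] by simp
    finally have "C * norm y \<le> C * (N + N / d * norm b)"
      using C_nonneg by (rule mult_left_mono)
    then have "\<bar>u b\<bar> + (\<Sum>c\<in>B. \<bar>u c\<bar>) \<le> N / d + C * (N + N / d * norm b)"
      using ub C[of u] by (simp add: y_def)
    then show ?thesis
      using insert.hyps by (simp add: N_def y_def algebra_simps)
  qed
  then show ?case by blast
qed

definition model_basis :: "'a::fin_dim_vector set" where
  "model_basis = (SOME B. finite B \<and> independent B \<and> span B = UNIV)"

text \<open>The unqualified name \<open>representation\<close> denotes a group representation here,
  hence the qualified constant.\<close>

definition coord :: "'a::fin_dim_vector \<Rightarrow> 'a \<Rightarrow> real" where
  "coord b x = Real_Vector_Spaces.representation model_basis x b"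

lemma model_basis:
  "finite (model_basis :: 'a::fin_dim_vector set)" "independent (model_basis :: 'a set)"
  "span (model_basis :: 'a set) = UNIV"
proof -
  obtain A :: "'a set" where A: "finite A" "span A = UNIV"
    using finite_spanning_set by blast
  obtain B where "B \<subseteq> A" "independent B" "A \<subseteq> span B"
    by (rule maximal_independent_subset)
  then have "finite B \<and> independent B \<and> span B = UNIV"
    using A by (metis finite_subset span_mono span_span top.extremum_uniqueI)
  then have "finite (model_basis :: 'a set) \<and> independent (model_basis :: 'a set)
      \<and> span (model_basis :: 'a set) = UNIV"
    unfolding model_basis_def by (rule someI)
  then show "finite (model_basis :: 'a::fin_dim_vector set)" "independent (model_basis :: 'a set)"
    "span (model_basis :: 'a set) = UNIV"
    by auto
qed

lemma linear_coord: "linear (coord b)"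
  by (rule linearI)
    (simp_all add: coord_def representation_add representation_scale model_basis)

lemma sum_coord: "(\<Sum>b\<in>model_basis. coord b x *\<^sub>R b) = x"
  unfolding coord_def by (rule real_vector.sum_representation_eq) (auto simp: model_basis)

lemma coord_basis: "c \<in> model_basis \<Longrightarrow> coord b c = (if c = b then 1 else 0)"
  by (auto simp: coord_def representation_basis model_basis)

lemma coord_eqI: "(\<And>b. b \<in> model_basis \<Longrightarrow> coord b x = coord b y) \<Longrightarrow> x = y"
  by (metis (no_types, lifting) sum_coord sum.cong)

lemma linear_sum_coord:
  assumes "linear f"
  shows "f x = (\<Sum>b\<in>model_basis. coord b x *\<^sub>R f b)"
  by (metis (no_types, lifting) assms linear_scale linear_sum sum.cong sum_coord)

lemma linear_imp_bounded_linear: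
  fixes f :: "'a::fin_dim_vector \<Rightarrow> 'b::real_normed_vector"
  assumes f: "linear f"
  shows "bounded_linear f"
proof -
  obtain C where C: "\<And>u. (\<Sum>b\<in>model_basis. \<bar>u b\<bar>) \<le> C * norm (\<Sum>b\<in>model_basis. u b *\<^sub>R (b::'a))"
    using coordinates_bounded[OF model_basis(1,2)] by blast
  define K where "K = (\<Sum>b\<in>model_basis. norm (f b))"
  have K: "norm (f b) \<le> K" if "b \<in> model_basis" for b
    unfolding K_def using model_basis(1) that by (intro member_le_sum) auto
  have "norm (f x) \<le> norm x * (C * K)" for x
  proof -
    have "norm (f x) \<le> (\<Sum>b\<in>model_basis. norm (coord b x *\<^sub>R f b))"
      by (subst linear_sum_coord[OF f]) (rule norm_sum)
    also have "\<dots> \<le> (\<Sum>b\<in>model_basis. \<bar>coord b x\<bar> * K)"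
      by (intro sum_mono) (simp add: K mult_left_mono)
    also have "\<dots> = (\<Sum>b\<in>model_basis. \<bar>coord b x\<bar>) * K"
      by (simp add: sum_distrib_right)
    also have "\<dots> \<le> (C * norm x) * K"
      using C[of "\<lambda>b. coord b x"] by (intro mult_right_mono) (simp_all add: sum_coord K_def sum_nonneg)
    finally show ?thesis
      by (simp add: mult_ac)
  qed
  then show ?thesis
    using f by (intro bounded_linear_intro) (auto simp: linear_add linear_scale)
qed

section \<open>Closure properties of C^n and smooth maps\<close>

lemma C_on_cong:
  assumes "open S" "\<And>x. x \<in> S \<Longrightarrow> f x = g x"
  shows "C_on n S f \<longleftrightarrow> C_on n S g"
  using assms(2)
proof (induction n arbitrary: f g)
  case 0
  then show ?case
    by (simp cong: continuous_on_cong)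
next
  case (Suc n)
  \<comment> \<open>\<open>frechet_derivative\<close> is a choice operator; equivalence for every
    \<open>D\<close> makes the choices for \<open>f\<close> and \<open>g\<close> coincide.\<close>
  have der: "(f has_derivative D) (at x) \<longleftrightarrow> (g has_derivative D) (at x)" if "x \<in> S" for D x
    using Suc.prems has_derivative_transform_within_open[OF _ assms(1) that, of f D UNIV g]
      has_derivative_transform_within_open[OF _ assms(1) that, of g D UNIV f]
    by auto
  have "C_on n S (\<lambda>x. frechet_derivative f (at x) v) \<longleftrightarrow> C_on n S (\<lambda>x. frechet_derivative g (at x) v)" for v
    by (rule Suc.IH) (simp add: frechet_derivative_def der)
  then show ?case
    using der by (simp add: differentiable_def)
qed

lemma C_on_subset: "C_on n S f \<Longrightarrow> T \<subseteq> S \<Longrightarrow> C_on n T f"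
  by (induction n arbitrary: f) (auto intro: continuous_on_subset)

lemma C_on_local:
  assumes "\<And>x. x \<in> S \<Longrightarrow> \<exists>T. open T \<and> x \<in> T \<and> C_on n T f"
  shows "C_on n S f"
  using assms
proof (induction n arbitrary: f)
  case 0
  then have "continuous (at x) f" if "x \<in> S" for x
    using that by (metis C_on.simps(1) continuous_on_eq_continuous_at)
  then show ?case
    by (simp add: continuous_at_imp_continuous_on)
next
  case (Suc n)
  have "f differentiable (at x)" if "x \<in> S" for x
    using Suc.prems[OF that] by auto
  moreover have "C_on n S (\<lambda>x. frechet_derivative f (at x) v)" for v
    using Suc.prems by (intro Suc.IH) fastforce
  ultimately show ?case by simp
qed

lemma C_on_Suc_imp: "C_on (Suc n) S f \<Longrightarrow> C_on n S f"
proof (induction n arbitrary: f)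
  case 0
  then show ?case
    by (auto intro!: continuous_at_imp_continuous_on differentiable_imp_continuous_within)
next
  case (Suc n)
  then show ?case
    by (metis C_on.simps(2))
qed

text \<open>Lets the inductions below exhibit the derivative as an explicit formula
  \<open>D\<close>, to whose terms the induction hypothesis applies.\<close>

lemma C_on_SucI:
  assumes "open S" "\<And>x. x \<in> S \<Longrightarrow> (f has_derivative D x) (at x)" "\<And>v. C_on n S (\<lambda>x. D x v)"
  shows "C_on (Suc n) S f"
proof -
  have "C_on n S (\<lambda>x. frechet_derivative f (at x) v) \<longleftrightarrow> C_on n S (\<lambda>x. D x v)" for v
    by (intro C_on_cong assms(1)) (simp add: frechet_derivative_at[OF assms(2), symmetric])
  then show ?thesis
    using assms(2,3) by (auto intro: differentiableI)
qed

lemma C_on_has_derivative: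
  "C_on (Suc n) S f \<Longrightarrow> x \<in> S \<Longrightarrow> (f has_derivative frechet_derivative f (at x)) (at x)"
  by (simp flip: frechet_derivative_works)

lemma C_on_frechet_derivative: "C_on (Suc n) S f \<Longrightarrow> C_on n S (\<lambda>x. frechet_derivative f (at x) v)"
  by simp

lemma C_on_const: "C_on n S (\<lambda>x. c)"
  by (induction n arbitrary: c) auto

lemma C_on_bounded_linear_compose:
  assumes "open S" "bounded_linear L" "C_on n S f"
  shows "C_on n S (\<lambda>x. L (f x))"
  using assms(3)
proof (induction n arbitrary: f)
  case 0
  then show ?case
    using assms by (simp add: bounded_linear.continuous_on)
next
  case (Suc n)
  show ?case
    by (rule C_on_SucI[OF assms(1) bounded_linear.has_derivative[OF assms(2)]])
      (rule C_on_has_derivative[OF Suc.prems] Suc.IH C_on_frechet_derivative[OF Suc.prems]; assumption?)+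
qed

lemma C_on_linear:
  fixes L :: "'a::fin_dim_vector \<Rightarrow> 'b::real_normed_vector"
  assumes "linear L"
  shows "C_on n S L"
proof (cases n)
  case 0
  then show ?thesis
    using assms linear_continuous_on linear_imp_bounded_linear by auto
next
  case (Suc m)
  have "(L has_derivative L) (at x)" for x
    using assms bounded_linear_imp_has_derivative linear_imp_bounded_linear by blast
  then have "C_on (Suc m) UNIV L"
    by (intro C_on_SucI[of _ _ "\<lambda>_. L"] C_on_const) auto
  then show ?thesis
    unfolding Suc by (rule C_on_subset) simp
qed

lemma C_on_add:
  assumes "open S" "C_on n S f" "C_on n S g"
  shows "C_on n S (\<lambda>x. f x + g x)"
  using assms(2,3)
proof (induction n arbitrary: f g)
  case 0
  then show ?case by (simp add: continuous_on_add)
next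
  case (Suc n)
  show ?case
    by (rule C_on_SucI[OF assms(1) has_derivative_add[OF Suc.prems[THEN C_on_has_derivative]]])
      (auto intro!: Suc.IH Suc.prems[THEN C_on_frechet_derivative] simp del: C_on.simps)
qed

lemma C_on_sum:
  assumes "open S" "\<And>i. i \<in> I \<Longrightarrow> C_on n S (f i)"
  shows "C_on n S (\<lambda>x. \<Sum>i\<in>I. f i x)"
  using assms(2)
  by (induction I rule: infinite_finite_induct) (auto intro!: C_on_add assms(1) C_on_const simp del: C_on.simps)

lemma C_on_scaleR:
  assumes "open S" "C_on n S (f :: _ \<Rightarrow> real)" "C_on n S g"
  shows "C_on n S (\<lambda>x. f x *\<^sub>R g x)"
  using assms(2,3)
proof (induction n arbitrary: f g)
  case 0
  then show ?case by (simp add: continuous_on_scaleR)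
next
  case (Suc n)
  show ?case
    by (rule C_on_SucI[OF assms(1) has_derivative_scaleR[OF Suc.prems[THEN C_on_has_derivative]]])
      (auto intro!: Suc.IH C_on_add assms(1) Suc.prems[THEN C_on_frechet_derivative]
        Suc.prems[THEN C_on_Suc_imp] simp del: C_on.simps)
qed

text \<open>The derivative \<open>g'(f x)(f'(x) v)\<close> is not itself of the form to which the
  induction hypothesis applies. Expanding \<open>f'(x) v\<close> in the basis turns it into a sum of
  products of a coordinate of a derivative of \<open>f\<close> and a directional derivative of
  \<open>g\<close> composed with \<open>f\<close>; the latter is covered because the induction
  generalises over \<open>g\<close>.\<close>

lemma C_on_compose:
  fixes f :: "'a::fin_dim_vector \<Rightarrow> 'b::fin_dim_vector" and g :: "'b \<Rightarrow> 'c::real_normed_vector"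
  assumes "open S" "open T" "f ` S \<subseteq> T" "C_on n S f" "C_on n T g"
  shows "C_on n S (\<lambda>x. g (f x))"
  using assms(4,5)
proof (induction n arbitrary: g)
  case 0
  then show ?case
    using assms(3) by (auto intro: continuous_on_compose2)
next
  case (Suc n)
  have fx: "f x \<in> T" if "x \<in> S" for x
    using that assms(3) by auto
  have D: "((\<lambda>x. g (f x)) has_derivative
      (\<lambda>v. \<Sum>b\<in>model_basis. coord b (frechet_derivative f (at x) v) *\<^sub>R
            frechet_derivative g (at (f x)) b)) (at x)" if "x \<in> S" for x
  proof -
    have g: "(g has_derivative frechet_derivative g (at (f x))) (at (f x))"
      by (rule C_on_has_derivative[OF Suc.prems(2) fx[OF that]])
    have "((\<lambda>x. g (f x)) has_derivative
      (\<lambda>v. frechet_derivative g (at (f x)) (frechet_derivative f (at x) v))) (at x)"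
      by (rule has_derivative_compose[OF C_on_has_derivative[OF Suc.prems(1) that] g])
    then show ?thesis
      by (subst (asm) linear_sum_coord[OF has_derivative_linear[OF g]])
  qed
  show ?case
    by (rule C_on_SucI[OF assms(1) D])
      (auto intro!: Suc.IH C_on_sum C_on_scaleR assms(1) linear_imp_bounded_linear linear_coord
        C_on_bounded_linear_compose[of S "coord _"] Suc.prems[THEN C_on_frechet_derivative]
        Suc.prems[THEN C_on_Suc_imp] simp del: C_on.simps)
qed

text \<open>The derivative is again a product of inverses, so the product rule closes the
  induction.\<close>

lemma C_on_inverse: "C_on n (- {0}) (inverse :: real \<Rightarrow> real)"
proof (induction n)
  case 0
  then show ?case by (auto intro!: continuous_intros)
next
  case (Suc n)
  have "((inverse :: real \<Rightarrow> real) has_derivative (\<lambda>v. inverse x *\<^sub>R (inverse x *\<^sub>R (- v)))) (at x)"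
    if "x \<in> - {0}" for x
    using that has_derivative_inverse'[of x UNIV] by (simp add: mult_ac)
  moreover have "C_on n (- {0}) (\<lambda>x::real. inverse x *\<^sub>R (inverse x *\<^sub>R (- v)))" for v :: real
    by (intro C_on_scaleR Suc C_on_const open_Compl closed_singleton)
  ultimately show ?case
    by (intro C_on_SucI[of _ _ "\<lambda>x v. inverse x *\<^sub>R (inverse x *\<^sub>R (- v))"] open_Compl closed_singleton)
qed

lemma smooth_on_cong:
  "open S \<Longrightarrow> (\<And>x. x \<in> S \<Longrightarrow> f x = g x) \<Longrightarrow> smooth_on S f \<longleftrightarrow> smooth_on S g"
  by (simp add: smooth_on_def C_on_cong[of S f g])

lemma smooth_on_subset: "smooth_on S f \<Longrightarrow> T \<subseteq> S \<Longrightarrow> smooth_on T f"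
  by (simp add: smooth_on_def C_on_subset[of _ S f])

lemma smooth_on_local:
  assumes "\<And>x. x \<in> S \<Longrightarrow> \<exists>T. open T \<and> x \<in> T \<and> smooth_on T f"
  shows "smooth_on S f"
  unfolding smooth_on_def
proof (intro allI C_on_local)
  show "\<exists>T. open T \<and> x \<in> T \<and> C_on n T f" if "x \<in> S" for n x
    using assms[OF that] unfolding smooth_on_def by blast
qed

lemma smooth_on_const: "smooth_on S (\<lambda>x. c)"
  by (simp add: smooth_on_def C_on_const)

lemma smooth_on_linear:
  fixes L :: "'a::fin_dim_vector \<Rightarrow> 'b::real_normed_vector"
  shows "linear L \<Longrightarrow> smooth_on S L"
  by (simp add: C_on_linear smooth_on_def)

lemma smooth_on_add:
  "open S \<Longrightarrow> smooth_on S f \<Longrightarrow> smooth_on S g \<Longrightarrow> smooth_on S (\<lambda>x. f x + g x)"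
  by (simp add: C_on_add smooth_on_def)

lemma smooth_on_sum:
  "open S \<Longrightarrow> (\<And>i. i \<in> I \<Longrightarrow> smooth_on S (f i)) \<Longrightarrow> smooth_on S (\<lambda>x. \<Sum>i\<in>I. f i x)"
  by (simp add: C_on_sum smooth_on_def)

lemma smooth_on_scaleR:
  "open S \<Longrightarrow> smooth_on S (f :: _ \<Rightarrow> real) \<Longrightarrow> smooth_on S g \<Longrightarrow> smooth_on S (\<lambda>x. f x *\<^sub>R g x)"
  by (simp add: C_on_scaleR smooth_on_def)

lemma smooth_on_compose:
  fixes f :: "'a::fin_dim_vector \<Rightarrow> 'b::fin_dim_vector" and g :: "'b \<Rightarrow> 'c::real_normed_vector"
  shows "open S \<Longrightarrow> open T \<Longrightarrow> f ` S \<subseteq> T \<Longrightarrow> smooth_on S f \<Longrightarrow> smooth_on T g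
    \<Longrightarrow> smooth_on S (\<lambda>x. g (f x))"
  by (simp add: smooth_on_def C_on_compose[of S T f _ g])

lemma smooth_on_linear_compose:
  fixes L :: "'b::fin_dim_vector \<Rightarrow> 'c::real_normed_vector"
  shows "open S \<Longrightarrow> linear L \<Longrightarrow> smooth_on S f \<Longrightarrow> smooth_on S (\<lambda>x. L (f x))"
  by (simp add: smooth_on_def C_on_bounded_linear_compose linear_imp_bounded_linear)

lemma smooth_on_uminus:
  "open S \<Longrightarrow> smooth_on S f \<Longrightarrow> smooth_on S (\<lambda>x. - f x)"
  by (simp add: smooth_on_def C_on_bounded_linear_compose bounded_linear_minus bounded_linear_ident)

lemma smooth_on_diff:
  "open S \<Longrightarrow> smooth_on S f \<Longrightarrow> smooth_on S g \<Longrightarrow> smooth_on S (\<lambda>x. f x - g x)"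
  using smooth_on_add[of S f "\<lambda>x. - g x", OF _ _ smooth_on_uminus] by simp

lemma smooth_on_inverse:
  fixes f :: "'a::fin_dim_vector \<Rightarrow> real"
  assumes "open S" "smooth_on S f" "\<And>x. x \<in> S \<Longrightarrow> f x \<noteq> 0"
  shows "smooth_on S (\<lambda>x. inverse (f x))"
proof -
  have "smooth_on (- {0}) (inverse :: real \<Rightarrow> real)"
    by (simp add: smooth_on_def C_on_inverse)
  moreover have "f ` S \<subseteq> - {0}"
    using assms(3) by auto
  ultimately show ?thesis
    using smooth_on_compose[OF assms(1) _ _ assms(2), of "- {0}" inverse] by blast
qed

lemma smooth_on_Pair:
  fixes f :: "'a::fin_dim_vector \<Rightarrow> 'b::fin_dim_vector" and g :: "'a \<Rightarrow> 'c::fin_dim_vector"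
  assumes "open S" "smooth_on S f" "smooth_on S g"
  shows "smooth_on S (\<lambda>x. (f x, g x))"
proof -
  have l: "linear (\<lambda>x. (x, 0) :: 'b \<times> 'c)" and r: "linear (\<lambda>x. (0, x) :: 'b \<times> 'c)"
    by (auto simp: linear_iff)
  have "smooth_on S (\<lambda>x. (f x, 0 :: 'c) + (0 :: 'b, g x))"
    by (rule smooth_on_add[OF assms(1) smooth_on_linear_compose[OF assms(1) l assms(2)]
        smooth_on_linear_compose[OF assms(1) r assms(3)]])
  then show ?thesis by simp
qed

lemma smooth_on_differentiable: "smooth_on S f \<Longrightarrow> x \<in> S \<Longrightarrow> f differentiable (at x)"
  unfolding smooth_on_def by (drule spec[of _ "Suc 0"]) simp

lemma smooth_on_has_derivative:
  "smooth_on S f \<Longrightarrow> x \<in> S \<Longrightarrow> (f has_derivative frechet_derivative f (at x)) (at x)"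
  using frechet_derivative_works smooth_on_differentiable by blast

lemma smooth_on_continuous: "smooth_on S f \<Longrightarrow> continuous_on S f"
  unfolding smooth_on_def by (drule spec[of _ 0]) simp

lemma smooth_on_frechet_derivative:
  "smooth_on S f \<Longrightarrow> smooth_on S (\<lambda>x. frechet_derivative f (at x) v)"
  unfolding smooth_on_def by (rule allI, drule spec, rule C_on_frechet_derivative)

text \<open>Expanding the argument in the basis reduces to fixed vectors. This allows one-forms and
  derivatives to be applied to varying vectors without a norm on spaces of operators.\<close>

lemma smooth_on_family_apply:
  fixes A :: "'a::real_normed_vector \<Rightarrow> 'b::fin_dim_vector \<Rightarrow> 'c::real_normed_vector"
  assumes "open S" "\<And>x. x \<in> S \<Longrightarrow> linear (A x)" "\<And>v. smooth_on S (\<lambda>x. A x v)" "smooth_on S f"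
  shows "smooth_on S (\<lambda>x. A x (f x))"
proof -
  have "smooth_on S (\<lambda>x. \<Sum>b\<in>model_basis. coord b (f x) *\<^sub>R A x b)"
    by (intro smooth_on_sum smooth_on_scaleR assms(1,3)
        smooth_on_linear_compose[OF assms(1) linear_coord assms(4)])
  then show ?thesis
    by (subst smooth_on_cong[OF assms(1) linear_sum_coord[OF assms(2)]])
qed

text \<open>The product rule for evaluation, again by expansion in the basis; in the second term the
  vector is frozen at \<open>f x\<close>.\<close>

lemma has_derivative_family_apply:
  fixes A :: "'a::real_normed_vector \<Rightarrow> 'b::fin_dim_vector \<Rightarrow> 'c::real_normed_vector"
  assumes "open S" "x \<in> S" "\<And>y. y \<in> S \<Longrightarrow> linear (A y)" "\<And>v. smooth_on S (\<lambda>y. A y v)"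
    and f: "(f has_derivative f') (at x)"
  shows "((\<lambda>y. A y (f y)) has_derivative
    (\<lambda>h. A x (f' h) + frechet_derivative (\<lambda>y. A y (f x)) (at x) h)) (at x)"
proof -
  let ?D = "\<lambda>b. frechet_derivative (\<lambda>y. A y b) (at x)"
  have A: "((\<lambda>y. A y b) has_derivative ?D b) (at x)" for b
    using assms by (intro smooth_on_has_derivative)
  have c: "((\<lambda>y. coord b (f y)) has_derivative (\<lambda>h. coord b (f' h))) (at x)" for b
    by (rule bounded_linear.has_derivative[OF linear_imp_bounded_linear[OF linear_coord] f])
  have "((\<lambda>y. \<Sum>b\<in>model_basis. coord b (f y) *\<^sub>R A y b) has_derivative
      (\<lambda>h. \<Sum>b\<in>model_basis. coord b (f x) *\<^sub>R ?D b h + coord b (f' h) *\<^sub>R A x b)) (at x)"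
    by (intro has_derivative_sum has_derivative_scaleR A c)
  then have 1: "((\<lambda>y. A y (f y)) has_derivative
      (\<lambda>h. \<Sum>b\<in>model_basis. coord b (f x) *\<^sub>R ?D b h + coord b (f' h) *\<^sub>R A x b)) (at x)"
    by (rule has_derivative_transform_within_open[OF _ assms(1,2)])
      (simp add: linear_sum_coord[OF assms(3), symmetric])
  have "((\<lambda>y. \<Sum>b\<in>model_basis. coord b (f x) *\<^sub>R A y b) has_derivative
      (\<lambda>h. \<Sum>b\<in>model_basis. coord b (f x) *\<^sub>R ?D b h)) (at x)"
    by (intro has_derivative_sum has_derivative_scaleR_right A)
  then have "((\<lambda>y. A y (f x)) has_derivative (\<lambda>h. \<Sum>b\<in>model_basis. coord b (f x) *\<^sub>R ?D b h)) (at x)"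
    by (rule has_derivative_transform_within_open[OF _ assms(1,2)])
      (simp add: linear_sum_coord[OF assms(3), symmetric])
  then have 2: "?D (f x) = (\<lambda>h. \<Sum>b\<in>model_basis. coord b (f x) *\<^sub>R ?D b h)"
    by (rule frechet_derivative_at[symmetric])
  have 3: "A x (f' h) = (\<Sum>b\<in>model_basis. coord b (f' h) *\<^sub>R A x b)" for h
    by (rule linear_sum_coord[OF assms(3)[OF assms(2)]])
  show ?thesis
    using 1 by (simp add: 2 3 sum.distrib add.commute)
qed

section \<open>Symmetry of second derivatives and brackets of related fields\<close>

lemma has_real_derivative_along_line:
  fixes f :: "'a::real_normed_vector \<Rightarrow> real"
  assumes "(f has_derivative D) (at (y + s *\<^sub>R u))"
  shows "((\<lambda>s. f (y + s *\<^sub>R u)) has_real_derivative D u) (at s)"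
proof -
  have "((\<lambda>s. y + s *\<^sub>R u) has_derivative (\<lambda>h. h *\<^sub>R u)) (at s)"
    by (auto intro!: derivative_eq_intros)
  then have "((\<lambda>s. f (y + s *\<^sub>R u)) has_derivative (\<lambda>h. D (h *\<^sub>R u))) (at s)"
    using assms by (rule has_derivative_compose)
  then show ?thesis
    by (simp add: has_field_derivative_def linear_scale[OF has_derivative_linear[OF assms]] mult_commute_abs)
qed

text \<open>The second difference is symmetric in \<open>u\<close> and \<open>v\<close>; applying the mean value theorem twice expresses
  it by a mixed second derivative.\<close>

lemma second_difference_mean_value:
  fixes f :: "'a::fin_dim_vector \<Rightarrow> real"
  assumes "smooth_on S f" "h > 0"
    and S: "\<And>s t. 0 \<le> s \<Longrightarrow> s \<le> h \<Longrightarrow> 0 \<le> t \<Longrightarrow> t \<le> h \<Longrightarrow> x + s *\<^sub>R u + t *\<^sub>R v \<in> S"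
  shows "\<exists>s t. 0 \<le> s \<and> s \<le> h \<and> 0 \<le> t \<and> t \<le> h \<and>
    f (x + h *\<^sub>R u + h *\<^sub>R v) - f (x + h *\<^sub>R u) - f (x + h *\<^sub>R v) + f x =
    h\<^sup>2 * frechet_derivative (\<lambda>y. frechet_derivative f (at y) u) (at (x + s *\<^sub>R u + t *\<^sub>R v)) v"
proof -
  let ?D = "\<lambda>y. frechet_derivative f (at y) u"
  have *: "((\<lambda>s. f (x + t *\<^sub>R v + s *\<^sub>R u)) has_real_derivative ?D (x + t *\<^sub>R v + s *\<^sub>R u)) (at s)"
    if "0 \<le> s" "s \<le> h" "0 \<le> t" "t \<le> h" for s t
    using S[OF that]
    by (intro has_real_derivative_along_line smooth_on_has_derivative[OF assms(1)]) (simp add: add_ac)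
  have "((\<lambda>s. f (x + h *\<^sub>R v + s *\<^sub>R u) - f (x + 0 *\<^sub>R v + s *\<^sub>R u)) has_real_derivative
      ?D (x + h *\<^sub>R v + s *\<^sub>R u) - ?D (x + 0 *\<^sub>R v + s *\<^sub>R u)) (at s)" if "0 \<le> s" "s \<le> h" for s
    using that \<open>h > 0\<close> by (intro DERIV_diff *) auto
  from MVT2[OF \<open>h > 0\<close> this] obtain s where s: "0 < s" "s < h" and
    s_eq: "f (x + h *\<^sub>R v + h *\<^sub>R u) - f (x + h *\<^sub>R u) - (f (x + h *\<^sub>R v) - f x) =
      h * (?D (x + h *\<^sub>R v + s *\<^sub>R u) - ?D (x + s *\<^sub>R u))"
    by auto
  have "((\<lambda>t. ?D (x + s *\<^sub>R u + t *\<^sub>R v)) has_real_derivative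
      frechet_derivative ?D (at (x + s *\<^sub>R u + t *\<^sub>R v)) v) (at t)" if "0 \<le> t" "t \<le> h" for t
    using S[of s t] that s
    by (intro has_real_derivative_along_line smooth_on_has_derivative[OF smooth_on_frechet_derivative[OF assms(1)]])
      auto
  from MVT2[OF \<open>h > 0\<close> this] obtain t where t: "0 < t" "t < h" and
    "?D (x + s *\<^sub>R u + h *\<^sub>R v) - ?D (x + s *\<^sub>R u) =
      h * frechet_derivative ?D (at (x + s *\<^sub>R u + t *\<^sub>R v)) v"
    by auto
  with s_eq have "f (x + h *\<^sub>R u + h *\<^sub>R v) - f (x + h *\<^sub>R u) - f (x + h *\<^sub>R v) + f x =
      h\<^sup>2 * frechet_derivative ?D (at (x + s *\<^sub>R u + t *\<^sub>R v)) v"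
    by (simp add: power2_eq_square add_ac)
  then show ?thesis
    using s t by (intro exI[of _ s] exI[of _ t]) auto
qed

text \<open>Both mixed derivatives, each at some point of a small parallelogram at \<open>x\<close>,
  equal the second difference divided by the square of its side parameter \<open>h\<close>.
  Continuity at \<open>x\<close> then compares the values at \<open>x\<close>.\<close>

lemma second_derivative_symmetric_real:
  fixes f :: "'a::fin_dim_vector \<Rightarrow> real"
  assumes "open S" "smooth_on S f" "x \<in> S"
  shows "frechet_derivative (\<lambda>y. frechet_derivative f (at y) v) (at x) u =
    frechet_derivative (\<lambda>y. frechet_derivative f (at y) u) (at x) v" (is "?L x = ?R x")
proof (rule ccontr)
  \<comment> \<open>Half the supposed gap: two errors below \<open>e\<close> cannot add up to
    it.\<close>
  define e where "e = \<bar>?L x - ?R x\<bar> / 2"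
  assume "\<not> ?thesis"
  then have "e > 0"
    by (simp add: e_def)
  have "isCont ?L x" "isCont ?R x"
    using assms by (auto intro!: continuous_on_interior[OF smooth_on_continuous]
        smooth_on_frechet_derivative simp: interior_open)
  then have "\<exists>d>0. \<forall>y. dist y x < d \<longrightarrow> dist (?L y) (?L x) < e"
    "\<exists>d>0. \<forall>y. dist y x < d \<longrightarrow> dist (?R y) (?R x) < e"
    using \<open>e > 0\<close> unfolding continuous_at_eps_delta by auto
  then obtain d1 d2 where d: "d1 > 0" "\<And>y. dist y x < d1 \<Longrightarrow> dist (?L y) (?L x) < e"
    "d2 > 0" "\<And>y. dist y x < d2 \<Longrightarrow> dist (?R y) (?R x) < e"
    by blast
  obtain r where r: "r > 0" "ball x r \<subseteq> S"
    using assms openE by blast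
  define d0 where "d0 = min r (min d1 d2)"
  \<comment> \<open>The summand 1 keeps \<open>c\<close> positive even if \<open>u\<close> and
    \<open>v\<close> vanish. With \<open>h = d0 / c / 2\<close> the whole parallelogram lies within
    \<open>d0 / 2\<close> of \<open>x\<close>.\<close>
  define c where "c = norm u + norm v + 1"
  define h where "h = d0 / c / 2"
  have d0: "d0 > 0"
    using d r by (simp add: d0_def)
  have nuv: "c > 0"
    by (simp add: c_def add_nonneg_pos)
  have h: "h > 0"
    using d0 nuv by (simp add: h_def)
  have near: "dist (x + s *\<^sub>R u + t *\<^sub>R v) x < d0" if "0 \<le> s" "s \<le> h" "0 \<le> t" "t \<le> h" for s t
  proof -
    have "dist (x + s *\<^sub>R u + t *\<^sub>R v) x \<le> s * norm u + t * norm v"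
      using norm_triangle_ineq[of "s *\<^sub>R u" "t *\<^sub>R v"] that by (simp add: dist_norm)
    also have "\<dots> \<le> h * norm u + h * norm v"
      using that by (intro add_mono mult_right_mono) auto
    also have "\<dots> \<le> h * c"
      using h by (simp add: c_def algebra_simps)
    also have "\<dots> = d0 / 2"
      using nuv by (simp add: h_def)
    finally show ?thesis
      using d0 by simp
  qed
  have inS: "x + s *\<^sub>R u + t *\<^sub>R v \<in> S" if "0 \<le> s" "s \<le> h" "0 \<le> t" "t \<le> h" for s t
    using near[OF that] r by (auto simp: d0_def dist_commute subset_eq)
  obtain s t where st: "0 \<le> s" "s \<le> h" "0 \<le> t" "t \<le> h" and
    1: "f (x + h *\<^sub>R u + h *\<^sub>R v) - f (x + h *\<^sub>R u) - f (x + h *\<^sub>R v) + f x = h\<^sup>2 * ?R (x + s *\<^sub>R u + t *\<^sub>R v)"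
    using second_difference_mean_value[OF assms(2) h inS] by blast
  have "x + s *\<^sub>R v + t *\<^sub>R u \<in> S" if "0 \<le> s" "s \<le> h" "0 \<le> t" "t \<le> h" for s t
    using inS[of t s] that by (simp add: add_ac)
  then obtain s' t' where st': "0 \<le> s'" "s' \<le> h" "0 \<le> t'" "t' \<le> h" and
    2: "f (x + h *\<^sub>R v + h *\<^sub>R u) - f (x + h *\<^sub>R v) - f (x + h *\<^sub>R u) + f x = h\<^sup>2 * ?L (x + s' *\<^sub>R v + t' *\<^sub>R u)"
    using second_difference_mean_value[OF assms(2) h, of x v u] by blast
  have "h\<^sup>2 * ?R (x + s *\<^sub>R u + t *\<^sub>R v) = h\<^sup>2 * ?L (x + s' *\<^sub>R v + t' *\<^sub>R u)"
    unfolding 1[symmetric] 2[symmetric] by (simp add: add_ac)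
  then have "?R (x + s *\<^sub>R u + t *\<^sub>R v) = ?L (x + t' *\<^sub>R u + s' *\<^sub>R v)"
    using h by (simp add: add_ac)
  moreover have "dist (?R (x + s *\<^sub>R u + t *\<^sub>R v)) (?R x) < e"
    using near[OF st] by (intro d) (simp add: d0_def)
  moreover have "dist (?L (x + t' *\<^sub>R u + s' *\<^sub>R v)) (?L x) < e"
    using near[OF st'(3,4,1,2)] by (intro d) (simp add: d0_def)
  ultimately have "\<bar>?L x - ?R x\<bar> < 2 * e"
    by (simp add: dist_real_def)
  then show False
    by (simp add: e_def)
qed

lemma second_derivative_symmetric:
  fixes f :: "'a::fin_dim_vector \<Rightarrow> 'b::fin_dim_vector"
  assumes "open S" "smooth_on S f" "x \<in> S"
  shows "frechet_derivative (\<lambda>y. frechet_derivative f (at y) v) (at x) u =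
    frechet_derivative (\<lambda>y. frechet_derivative f (at y) u) (at x) v"
proof (rule coord_eqI)
  fix b :: 'b
  have bl: "bounded_linear (coord b)"
    by (intro linear_imp_bounded_linear linear_coord)
  have 1: "frechet_derivative (\<lambda>z. coord b (f z)) (at y) w = coord b (frechet_derivative f (at y) w)"
    if "y \<in> S" for y w
    by (rule fun_cong[OF frechet_derivative_at[symmetric]])
      (rule bounded_linear.has_derivative[OF bl smooth_on_has_derivative[OF assms(2) that]])
  have 2: "frechet_derivative (\<lambda>y. frechet_derivative (\<lambda>z. coord b (f z)) (at y) w) (at x) w' =
      coord b (frechet_derivative (\<lambda>y. frechet_derivative f (at y) w) (at x) w')" for w w'
  proof -
    have "((\<lambda>y. coord b (frechet_derivative f (at y) w)) has_derivative
        (\<lambda>w'. coord b (frechet_derivative (\<lambda>y. frechet_derivative f (at y) w) (at x) w'))) (at x)"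
      by (rule bounded_linear.has_derivative[OF bl
          smooth_on_has_derivative[OF smooth_on_frechet_derivative[OF assms(2)] assms(3)]])
    then have "((\<lambda>y. frechet_derivative (\<lambda>z. coord b (f z)) (at y) w) has_derivative
        (\<lambda>w'. coord b (frechet_derivative (\<lambda>y. frechet_derivative f (at y) w) (at x) w'))) (at x)"
      by (rule has_derivative_transform_within_open[OF _ assms(1,3)]) (simp add: 1)
    then show ?thesis
      by (rule fun_cong[OF frechet_derivative_at[symmetric]])
  qed
  have "smooth_on S (\<lambda>z. coord b (f z))"
    by (rule smooth_on_linear_compose[OF assms(1) linear_coord assms(2)])
  from second_derivative_symmetric_real[OF assms(1) this assms(3), of v u]
  show "coord b (frechet_derivative (\<lambda>y. frechet_derivative f (at y) v) (at x) u) =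
    coord b (frechet_derivative (\<lambda>y. frechet_derivative f (at y) u) (at x) v)"
    by (simp add: 2)
qed

text \<open>Differentiating \<open>\<eta> (f y) = f'(y) (\<xi> y)\<close> in a direction
  \<open>h\<close> yields the expected term and the second derivative of \<open>f\<close> at
  \<open>(\<xi>, h)\<close>. Taking \<open>h = \<xi>'\<close> and subtracting the expression with
  the fields exchanged cancels the second derivatives by symmetry.\<close>

lemma bracket_of_related_fields:
  fixes f :: "'a::fin_dim_vector \<Rightarrow> 'b::fin_dim_vector"
  assumes S: "open S" "x \<in> S" and f: "smooth_on S f"
    and \<xi>: "\<xi> differentiable (at x)" "\<xi>' differentiable (at x)"
    and \<eta>: "\<eta> differentiable (at (f x))" "\<eta>' differentiable (at (f x))"
    and rel: "\<And>y. y \<in> S \<Longrightarrow> \<eta> (f y) = frechet_derivative f (at y) (\<xi> y)"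
      "\<And>y. y \<in> S \<Longrightarrow> \<eta>' (f y) = frechet_derivative f (at y) (\<xi>' y)"
  shows "frechet_derivative \<eta>' (at (f x)) (\<eta> (f x)) - frechet_derivative \<eta> (at (f x)) (\<eta>' (f x)) =
    frechet_derivative f (at x) (frechet_derivative \<xi>' (at x) (\<xi> x) - frechet_derivative \<xi> (at x) (\<xi>' x))"
proof -
  let ?D = "frechet_derivative f (at x)"
  have D: "(f has_derivative ?D) (at x)"
    by (rule smooth_on_has_derivative[OF f S(2)])
  \<comment> \<open>The relation between one pair of fields is differentiated in two ways, by the
    chain rule and by the product rule.\<close>
  have *: "frechet_derivative \<zeta> (at (f x)) (?D h) =
      ?D (frechet_derivative \<kappa> (at x) h) + frechet_derivative (\<lambda>y. frechet_derivative f (at y) (\<kappa> x)) (at x) h"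
    if "\<zeta> differentiable (at (f x))" "\<kappa> differentiable (at x)"
      "\<And>y. y \<in> S \<Longrightarrow> \<zeta> (f y) = frechet_derivative f (at y) (\<kappa> y)" for \<zeta> \<kappa> h
  proof -
    have "((\<lambda>y. \<zeta> (f y)) has_derivative (\<lambda>h. frechet_derivative \<zeta> (at (f x)) (?D h))) (at x)"
      using that(1) by (intro has_derivative_compose[OF D]) (simp flip: frechet_derivative_works)
    moreover have "((\<lambda>y. frechet_derivative f (at y) (\<kappa> y)) has_derivative
        (\<lambda>h. ?D (frechet_derivative \<kappa> (at x) h)
          + frechet_derivative (\<lambda>y. frechet_derivative f (at y) (\<kappa> x)) (at x) h)) (at x)"
      using that(2)
      by (intro has_derivative_family_apply[OF S linear_frechet_derivative[OF smooth_on_differentiable[OF f]]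
            smooth_on_frechet_derivative[OF f]])
        (simp_all flip: frechet_derivative_works)
    then have "((\<lambda>y. \<zeta> (f y)) has_derivative
        (\<lambda>h. ?D (frechet_derivative \<kappa> (at x) h)
          + frechet_derivative (\<lambda>y. frechet_derivative f (at y) (\<kappa> x)) (at x) h)) (at x)"
      by (rule has_derivative_transform_within_open[OF _ S]) (simp add: that(3))
    ultimately show ?thesis
      by (rule fun_cong[OF has_derivative_unique])
  qed
  have "frechet_derivative \<eta> (at (f x)) (?D h) = ?D (frechet_derivative \<xi> (at x) h) +
      frechet_derivative (\<lambda>y. frechet_derivative f (at y) (\<xi> x)) (at x) h" for h
    using \<eta>(1) \<xi>(1) rel(1) by (rule *)
  moreover have "frechet_derivative \<eta>' (at (f x)) (?D h) = ?D (frechet_derivative \<xi>' (at x) h) +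
      frechet_derivative (\<lambda>y. frechet_derivative f (at y) (\<xi>' x)) (at x) h" for h
    using \<eta>(2) \<xi>(2) rel(2) by (rule *)
  ultimately show ?thesis
    using second_derivative_symmetric[OF S(1) f S(2), of "\<xi>' x" "\<xi> x"]
    by (simp add: rel[OF S(2)] linear_diff[OF has_derivative_linear[OF D]])
qed

section \<open>Smooth maps between manifolds\<close>

text \<open>The conditions of \<^const>\<open>smooth_manifold\<close> without the separation and countability axioms, which are
  not available for an arbitrary model space.\<close>

definition smooth_atlas :: "('a::topological_space, 'e::fin_dim_vector) manifold \<Rightarrow> bool" where
  "smooth_atlas M \<longleftrightarrow>
     (\<forall>(U, \<phi>) \<in> charts M. open U \<and> open (\<phi> ` U) \<and> homeomorphism U (\<phi> ` U) \<phi> (inv_into U \<phi>)) \<and>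
     (\<forall>(U, \<phi>) \<in> charts M. \<forall>(W, \<psi>) \<in> charts M. smooth_on (\<phi> ` (U \<inter> W)) (\<psi> \<circ> inv_into U \<phi>)) \<and>
     (\<forall>p. chart_at M p \<in> charts M \<and> p \<in> fst (chart_at M p))"

lemma smooth_manifold_imp_atlas: "smooth_manifold M \<Longrightarrow> smooth_atlas M"
  by (simp add: smooth_manifold_def smooth_atlas_def)

lemma smooth_atlas_vector_manifold: "smooth_atlas (vector_manifold :: ('e::fin_dim_vector, 'e) manifold)"
proof -
  have "smooth_on UNIV (\<lambda>x::'e. x)"
    by (rule smooth_on_linear) (simp add: linear_iff)
  then show ?thesis
    by (simp add: smooth_atlas_def vector_manifold_def homeomorphism_def o_def id_def inv_id[unfolded id_def])
qed

section \<open>Charts, local criteria and composition\<close>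

locale atlas =
  fixes M :: "('a::topological_space, 'e::fin_dim_vector) manifold"
  assumes smooth_atlas: "smooth_atlas M"
begin

lemma chart_at: "chart_at M p \<in> charts M" "p \<in> fst (chart_at M p)"
  using smooth_atlas by (auto simp: smooth_atlas_def)

context
  fixes c assumes c: "c \<in> charts M"
begin

lemma chart_open: "open (fst c)" "open (snd c ` fst c)"
  using smooth_atlas c by (auto simp: smooth_atlas_def case_prod_beta)

lemma chart_homeo: "homeomorphism (fst c) (snd c ` fst c) (snd c) (chart_inv c)"
  using smooth_atlas c by (auto simp: smooth_atlas_def case_prod_beta)

lemma chart_inv_chart [simp]: "p \<in> fst c \<Longrightarrow> chart_inv c (snd c p) = p"
  using chart_homeo by (simp add: homeomorphism_def)

lemma chart_chart_inv [simp]: "x \<in> snd c ` fst c \<Longrightarrow> snd c (chart_inv c x) = x"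
  by (rule f_inv_into_f)

lemma chart_continuous: "continuous_on (fst c) (snd c)"
  "continuous_on (snd c ` fst c) (chart_inv c)"
  using chart_homeo by (simp_all add: homeomorphism_def)

lemma chart_image_eq: "T \<subseteq> fst c \<Longrightarrow> snd c ` T = snd c ` fst c \<inter> chart_inv c -` T"
  by force

lemma chart_image_open: "open T \<Longrightarrow> T \<subseteq> fst c \<Longrightarrow> open (snd c ` T)"
  unfolding chart_image_eq
  by (rule continuous_open_preimage[OF chart_continuous(2) chart_open(2)])

lemma chart_transition:
  "d \<in> charts M \<Longrightarrow> smooth_on (snd c ` (fst c \<inter> fst d)) (\<lambda>x. snd d (chart_inv c x))"
  using smooth_atlas c by (fastforce simp: smooth_atlas_def o_def case_prod_beta)

end

end

lemma smooth_map_onD: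
  "smooth_map_on M N S f \<Longrightarrow> c \<in> charts M \<Longrightarrow> d \<in> charts N \<Longrightarrow>
    smooth_on (snd c ` (fst c \<inter> S \<inter> f -` fst d)) (\<lambda>x. snd d (f (chart_inv c x)))"
  by (fastforce simp: smooth_map_on_def o_def case_prod_beta)

lemma smooth_map_on_continuous: "smooth_map_on M N S f \<Longrightarrow> continuous_on S f"
  by (simp add: smooth_map_on_def)

lemma smooth_map_on_subset:
  assumes "smooth_map_on M N S f" "T \<subseteq> S"
  shows "smooth_map_on M N T f"
proof -
  have "smooth_on (snd c ` (fst c \<inter> T \<inter> f -` fst d)) (\<lambda>x. snd d (f (chart_inv c x)))"
    if "c \<in> charts M" "d \<in> charts N" for c d
    by (rule smooth_on_subset[OF smooth_map_onD[OF assms(1) that]]) (use assms(2) in auto)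
  then show ?thesis
    using continuous_on_subset[OF smooth_map_on_continuous[OF assms(1)] assms(2)]
    by (fastforce simp: smooth_map_on_def o_def case_prod_beta)
qed

text \<open>The definition ranges over all pairs of charts. One pair around each point suffices,
  since the coordinate expression in any other pair arises from it by transition maps on a smaller
  neighbourhood.\<close>

lemma smooth_map_onI:
  assumes "smooth_atlas M" "smooth_atlas N" "open S"
    and loc: "\<And>p. p \<in> S \<Longrightarrow> \<exists>T c d. open T \<and> p \<in> T \<and> c \<in> charts M \<and> d \<in> charts N \<and>
      T \<subseteq> fst c \<and> f ` T \<subseteq> fst d \<and> smooth_on (snd c ` T) (\<lambda>x. snd d (f (chart_inv c x)))"
  shows "smooth_map_on M N S f"
proof -
  interpret M: atlas M by standard (rule assms)
  interpret N: atlas N by standard (rule assms)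
  have "\<exists>T. open T \<and> p \<in> T \<and> continuous_on T f" if p: "p \<in> S" for p
  proof -
    obtain T c d where T: "open T" "p \<in> T" and c: "c \<in> charts M" and d: "d \<in> charts N"
      and sub: "T \<subseteq> fst c" "f ` T \<subseteq> fst d" and sm: "smooth_on (snd c ` T) (\<lambda>x. snd d (f (chart_inv c x)))"
      using loc[OF p] by blast
    have "continuous_on T (\<lambda>q. chart_inv d (snd d (f (chart_inv c (snd c q)))))"
      using sub M.chart_inv_chart[OF c]
      by (intro continuous_on_compose2[OF N.chart_continuous(2)[OF d]]
          continuous_on_compose2[OF smooth_on_continuous[OF sm]]
          continuous_on_subset[OF M.chart_continuous(1)[OF c]]) force+
    moreover have "chart_inv d (snd d (f (chart_inv c (snd c q)))) = f q" if "q \<in> T" for q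
      using that sub by (auto simp: M.chart_inv_chart[OF c] N.chart_inv_chart[OF d] subset_eq)
    ultimately have "continuous_on T f"
      by (simp cong: continuous_on_cong)
    then show ?thesis
      using T by blast
  qed
  then obtain A where A: "\<And>p. p \<in> S \<Longrightarrow> open (A p) \<and> p \<in> A p \<and> continuous_on (A p) f"
    by metis
  then have "continuous_on (\<Union>(A ` S)) f"
    by (intro continuous_on_open_Union) auto
  then have cont: "continuous_on S f"
    by (rule continuous_on_subset) (use A in auto)
  have "smooth_on (snd c' ` (fst c' \<inter> S \<inter> f -` fst d')) (\<lambda>x. snd d' (f (chart_inv c' x)))"
    if c': "c' \<in> charts M" and d': "d' \<in> charts N" for c' d'
  proof (rule smooth_on_local)
    fix x assume "x \<in> snd c' ` (fst c' \<inter> S \<inter> f -` fst d')"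
    then obtain p where p: "p \<in> fst c'" "p \<in> S" "f p \<in> fst d'" and x: "x = snd c' p"
      by auto
    obtain T c d where T: "open T" "p \<in> T" and c: "c \<in> charts M" and d: "d \<in> charts N"
      and sub: "T \<subseteq> fst c" "f ` T \<subseteq> fst d" and sm: "smooth_on (snd c ` T) (\<lambda>x. snd d (f (chart_inv c x)))"
      using loc[OF p(2)] by blast
    \<comment> \<open>The last factor is open by the continuity of \<open>f\<close> on
      \<open>S\<close> just established; on \<open>T0\<close> all four charts are available at
      once.\<close>
    define T0 where "T0 = T \<inter> fst c' \<inter> (S \<inter> f -` fst d')"
    have T0: "open T0" "p \<in> T0" "T0 \<subseteq> T" "T0 \<subseteq> fst c'" "T0 \<subseteq> fst c"
      using T p sub by (auto simp: T0_def intro!: open_Int M.chart_open[OF c']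
          continuous_open_preimage[OF cont assms(3)] N.chart_open[OF d'])
    have fT0: "f ` T0 \<subseteq> fst d \<inter> fst d'"
      using sub by (auto simp: T0_def)
    have 1: "smooth_on (snd c' ` T0) (\<lambda>x. snd c (chart_inv c' x))"
      by (rule smooth_on_subset[OF M.chart_transition[OF c' c]]) (use T0 in auto)
    have 2: "smooth_on (snd c ` T0) (\<lambda>x. snd d (f (chart_inv c x)))"
      by (rule smooth_on_subset[OF sm]) (use T0 in auto)
    have 3: "smooth_on (snd d ` (fst d \<inter> fst d')) (\<lambda>x. snd d' (chart_inv d x))"
      by (rule N.chart_transition[OF d d'])
    have inv: "chart_inv c' (snd c' q) = q" "chart_inv c (snd c q) = q" if "q \<in> T0" for q
      using that T0 by (auto simp: M.chart_inv_chart[OF c] M.chart_inv_chart[OF c'] subset_eq)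
    have 4: "smooth_on (snd c' ` T0) (\<lambda>x. snd d (f (chart_inv c (snd c (chart_inv c' x)))))"
      by (rule smooth_on_compose[OF M.chart_image_open[OF c' T0(1) T0(4)] M.chart_image_open[OF c T0(1) T0(5)] _ 1 2])
        (auto simp: inv)
    have "(\<lambda>x. snd d (f (chart_inv c (snd c (chart_inv c' x))))) ` (snd c' ` T0) \<subseteq> snd d ` (fst d \<inter> fst d')"
      using fT0 by (auto simp: inv intro!: imageI)
    then have "smooth_on (snd c' ` T0)
        (\<lambda>x. snd d' (chart_inv d (snd d (f (chart_inv c (snd c (chart_inv c' x)))))))"
      by (rule smooth_on_compose[OF M.chart_image_open[OF c' T0(1) T0(4)]
            N.chart_image_open[OF d open_Int[OF N.chart_open(1)[OF d] N.chart_open(1)[OF d']]] _ 4 3, rotated]) simp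
    then have "smooth_on (snd c' ` T0) (\<lambda>x. snd d' (f (chart_inv c' x)))"
    proof (subst smooth_on_cong[OF M.chart_image_open[OF c' T0(1,4)]])
      fix x assume "x \<in> snd c' ` T0"
      then obtain q where q: "q \<in> T0" "x = snd c' q" by auto
      have "chart_inv c' x = q" "q \<in> fst c" "f q \<in> fst d"
        using q T0 fT0 by (auto simp: inv)
      then show "snd d' (f (chart_inv c' x)) = snd d' (chart_inv d (snd d (f (chart_inv c (snd c (chart_inv c' x))))))"
        using M.chart_inv_chart[OF c] N.chart_inv_chart[OF d] by simp
    qed
    then show "\<exists>T. open T \<and> x \<in> T \<and> smooth_on T (\<lambda>x. snd d' (f (chart_inv c' x)))"
      using T0 x M.chart_image_open[OF c' T0(1,4)] by blast
  qed
  with cont show ?thesis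
    by (fastforce simp: smooth_map_on_def o_def case_prod_beta)
qed

text \<open>Continuity makes the domain of the coordinate expression open, so that it can be
  differentiated there.\<close>

lemma smooth_map_on_charts:
  assumes "smooth_atlas M" "smooth_atlas N" "open S" "smooth_map_on M N S f" "p \<in> S"
    and c: "c \<in> charts M" "p \<in> fst c" and d: "d \<in> charts N" "f p \<in> fst d"
  obtains T where "open T" "p \<in> T" "T \<subseteq> S" "T \<subseteq> fst c" "f ` T \<subseteq> fst d" "open (snd c ` T)"
    "smooth_on (snd c ` T) (\<lambda>x. snd d (f (chart_inv c x)))"
proof -
  interpret M: atlas M by standard (rule assms)
  interpret N: atlas N by standard (rule assms)
  let ?T = "fst c \<inter> (S \<inter> f -` fst d)"
  have "open (S \<inter> f -` fst d)"
    by (rule continuous_open_preimage[OF smooth_map_on_continuous[OF assms(4)] assms(3) N.chart_open(1)[OF d(1)]])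
  then have "open ?T"
    using M.chart_open(1)[OF c(1)] by blast
  then show ?thesis
    using assms smooth_map_onD[OF assms(4) c(1) d(1)] M.chart_image_open[OF c(1), of ?T]
    by (intro that[of ?T]) (auto simp: Int_assoc)
qed

lemma smooth_map_on_local:
  assumes "smooth_atlas M" "smooth_atlas N" "open S"
    and "\<And>p. p \<in> S \<Longrightarrow> \<exists>T. open T \<and> p \<in> T \<and> smooth_map_on M N T f"
  shows "smooth_map_on M N S f"
proof (rule smooth_map_onI[OF assms(1-3)])
  interpret M: atlas M by standard (rule assms)
  interpret N: atlas N by standard (rule assms)
  fix p assume "p \<in> S"
  then obtain T where T: "open T" "p \<in> T" "smooth_map_on M N T f"
    using assms(4) by blast
  obtain T' where "open T'" "p \<in> T'" "T' \<subseteq> T" "T' \<subseteq> fst (chart_at M p)" "f ` T' \<subseteq> fst (chart_at N (f p))"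
    "open (snd (chart_at M p) ` T')" "smooth_on (snd (chart_at M p) ` T') (\<lambda>x. snd (chart_at N (f p)) (f (chart_inv (chart_at M p) x)))"
    by (rule smooth_map_on_charts[OF assms(1,2) T(1,3,2) M.chart_at N.chart_at])
  then show "\<exists>T c d. open T \<and> p \<in> T \<and> c \<in> charts M \<and> d \<in> charts N \<and>
      T \<subseteq> fst c \<and> f ` T \<subseteq> fst d \<and> smooth_on (snd c ` T) (\<lambda>x. snd d (f (chart_inv c x)))"
    using M.chart_at(1) N.chart_at(1) by blast
qed

lemma smooth_map_on_cong:
  assumes "smooth_atlas M" "smooth_atlas N" "open S" "smooth_map_on M N S f"
    and eq: "\<And>p. p \<in> S \<Longrightarrow> g p = f p"
  shows "smooth_map_on M N S g"
proof (rule smooth_map_onI[OF assms(1-3)])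
  interpret M: atlas M by standard (rule assms)
  interpret N: atlas N by standard (rule assms)
  fix p assume p: "p \<in> S"
  obtain T where T: "open T" "p \<in> T" "T \<subseteq> S" "T \<subseteq> fst (chart_at M p)" "f ` T \<subseteq> fst (chart_at N (f p))"
    "open (snd (chart_at M p) ` T)"
    "smooth_on (snd (chart_at M p) ` T) (\<lambda>x. snd (chart_at N (f p)) (f (chart_inv (chart_at M p) x)))"
    by (rule smooth_map_on_charts[OF assms(1-4) p M.chart_at N.chart_at])
  have "smooth_on (snd (chart_at M p) ` T) (\<lambda>x. snd (chart_at N (f p)) (g (chart_inv (chart_at M p) x)))"
    using T(7)
  proof (subst smooth_on_cong[OF T(6)])
    fix x assume "x \<in> snd (chart_at M p) ` T"
    then have "chart_inv (chart_at M p) x \<in> S"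
      using T(3,4) by (auto simp: M.chart_inv_chart[OF M.chart_at(1)] subset_eq)
    then show "snd (chart_at N (f p)) (g (chart_inv (chart_at M p) x)) =
        snd (chart_at N (f p)) (f (chart_inv (chart_at M p) x))"
      by (simp add: eq)
  qed
  moreover have "g ` T \<subseteq> fst (chart_at N (f p))"
    using T(3,5) by (auto simp: eq subset_eq)
  ultimately show "\<exists>T c d. open T \<and> p \<in> T \<and> c \<in> charts M \<and> d \<in> charts N \<and>
      T \<subseteq> fst c \<and> g ` T \<subseteq> fst d \<and> smooth_on (snd c ` T) (\<lambda>x. snd d (g (chart_inv c x)))"
    using T(1,2,4) M.chart_at(1) N.chart_at(1) by blast
qed

lemma smooth_map_on_compose:
  assumes "smooth_atlas M" "smooth_atlas N" "smooth_atlas K" "open S" "open T"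
    and f: "smooth_map_on M N S f" and g: "smooth_map_on N K T g" and sub: "f ` S \<subseteq> T"
  shows "smooth_map_on M K S (\<lambda>p. g (f p))"
proof (rule smooth_map_onI[OF assms(1,3,4)])
  interpret M: atlas M by standard (rule assms)
  interpret N: atlas N by standard (rule assms)
  interpret K: atlas K by standard (rule assms)
  fix p assume p: "p \<in> S"
  define c where "c = chart_at M p"
  define d where "d = chart_at N (f p)"
  define e where "e = chart_at K (g (f p))"
  have c: "c \<in> charts M" "p \<in> fst c" and d: "d \<in> charts N" "f p \<in> fst d"
    and e: "e \<in> charts K" "g (f p) \<in> fst e"
    by (simp_all add: c_def d_def e_def M.chart_at N.chart_at K.chart_at)
  have fp: "f p \<in> T"
    using p sub by auto
  obtain A where A: "open A" "p \<in> A" "A \<subseteq> S" "A \<subseteq> fst c" "f ` A \<subseteq> fst d" "open (snd c ` A)"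
    "smooth_on (snd c ` A) (\<lambda>x. snd d (f (chart_inv c x)))"
    by (rule smooth_map_on_charts[OF assms(1,2,4) f p c d])
  obtain B where B: "open B" "f p \<in> B" "B \<subseteq> T" "B \<subseteq> fst d" "g ` B \<subseteq> fst e" "open (snd d ` B)"
    "smooth_on (snd d ` B) (\<lambda>x. snd e (g (chart_inv d x)))"
    by (rule smooth_map_on_charts[OF assms(2,3,5) g fp d e])
  define A' where "A' = A \<inter> f -` B"
  have A': "open A'" "p \<in> A'" "A' \<subseteq> fst c" "A' \<subseteq> A"
    using A(2,4) B(2) continuous_open_preimage[OF continuous_on_subset[OF smooth_map_on_continuous[OF f] A(3)] A(1) B(1)]
    by (auto simp: A'_def)
  have "smooth_on (snd c ` A') (\<lambda>x. snd e (g (chart_inv d (snd d (f (chart_inv c x))))))"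
    by (rule smooth_on_compose[OF M.chart_image_open[OF c(1) A'(1,3)] B(6) _
          smooth_on_subset[OF A(7) image_mono[OF A'(4)]] B(7)])
      (use A'(3) in \<open>auto simp: A'_def M.chart_inv_chart[OF c(1)] subset_eq\<close>)
  then have "smooth_on (snd c ` A') (\<lambda>x. snd e (g (f (chart_inv c x))))"
  proof (subst smooth_on_cong[OF M.chart_image_open[OF c(1) A'(1,3)]])
    fix x assume "x \<in> snd c ` A'"
    then have "f (chart_inv c x) \<in> fst d"
      using A' A by (auto simp: M.chart_inv_chart[OF c(1)] subset_eq)
    then show "snd e (g (f (chart_inv c x))) = snd e (g (chart_inv d (snd d (f (chart_inv c x)))))"
      using N.chart_inv_chart[OF d(1)] by simp
  qed
  moreover have "(\<lambda>p. g (f p)) ` A' \<subseteq> fst e"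
    using B(5) by (auto simp: A'_def)
  ultimately show "\<exists>T c d. open T \<and> p \<in> T \<and> c \<in> charts M \<and> d \<in> charts K \<and>
      T \<subseteq> fst c \<and> (\<lambda>p. g (f p)) ` T \<subseteq> fst d \<and> smooth_on (snd c ` T) (\<lambda>x. snd d (g (f (chart_inv c x))))"
    using A'(1-3) c(1) e(1) by blast
qed

section \<open>Model spaces, constants, the identity and charts as smooth maps\<close>

lemma charts_vector_manifold [simp]: "charts vector_manifold = {(UNIV, id)}"
  by (simp add: vector_manifold_def)

lemma chart_at_vector_manifold [simp]: "chart_at vector_manifold p = (UNIV, id)"
  by (simp add: vector_manifold_def)

lemma smooth_map_on_vector_manifold:
  fixes f :: "'a::fin_dim_vector \<Rightarrow> 'b::fin_dim_vector"
  shows "open S \<Longrightarrow> smooth_map_on vector_manifold vector_manifold S f \<longleftrightarrow> smooth_on S f"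
  by (auto simp: smooth_map_on_def o_def id_def inv_id[unfolded id_def] smooth_on_continuous)

lemma smooth_map_on_const:
  assumes "smooth_atlas M" "smooth_atlas N" "open S"
  shows "smooth_map_on M N S (\<lambda>_. q)"
proof (rule smooth_map_onI[OF assms])
  interpret M: atlas M by standard (rule assms)
  interpret N: atlas N by standard (rule assms)
  fix p assume "p \<in> S"
  then show "\<exists>T c d. open T \<and> p \<in> T \<and> c \<in> charts M \<and> d \<in> charts N \<and>
      T \<subseteq> fst c \<and> (\<lambda>_. q) ` T \<subseteq> fst d \<and> smooth_on (snd c ` T) (\<lambda>x. snd d q)"
    using N.chart_at[of q]
    by (intro exI[of _ "fst (chart_at M p)"] exI[of _ "chart_at M p"] exI[of _ "chart_at N q"])
      (auto simp: M.chart_at M.chart_open smooth_on_const)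
qed

lemma smooth_map_on_id:
  assumes "smooth_atlas M" "open S"
  shows "smooth_map_on M M S (\<lambda>p. p)"
proof (rule smooth_map_onI[OF assms(1,1,2)])
  interpret M: atlas M by standard (rule assms)
  fix p
  let ?c = "chart_at M p"
  show "\<exists>T c d. open T \<and> p \<in> T \<and> c \<in> charts M \<and> d \<in> charts M \<and>
      T \<subseteq> fst c \<and> (\<lambda>p. p) ` T \<subseteq> fst d \<and> smooth_on (snd c ` T) (\<lambda>x. snd d (chart_inv c x))"
    using M.chart_transition[of ?c ?c]
    by (intro exI[of _ "fst ?c"] exI[of _ ?c]) (auto simp: M.chart_at M.chart_open)
qed

lemma smooth_map_on_chart:
  assumes "smooth_atlas M" "c \<in> charts M"
  shows "smooth_map_on M vector_manifold (fst c) (snd c)"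
proof -
  interpret M: atlas M by standard (rule assms)
  show ?thesis
  proof (rule smooth_map_onI[OF assms(1) smooth_atlas_vector_manifold M.chart_open(1)[OF assms(2)]])
    fix p assume "p \<in> fst c"
    then show "\<exists>T c' d. open T \<and> p \<in> T \<and> c' \<in> charts M \<and> d \<in> charts vector_manifold \<and>
      T \<subseteq> fst c' \<and> snd c ` T \<subseteq> fst d \<and> smooth_on (snd c' ` T) (\<lambda>x. snd d (snd c (chart_inv c' x)))"
      using M.chart_transition[OF assms(2,2)] assms(2)
      by (intro exI[of _ "fst c"] exI[of _ c] exI[of _ "(UNIV, id)"]) (auto simp: M.chart_open)
  qed
qed

lemma smooth_map_on_chart_inv:
  assumes "smooth_atlas M" "c \<in> charts M"
  shows "smooth_map_on vector_manifold M (snd c ` fst c) (chart_inv c)"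
proof -
  interpret M: atlas M by standard (rule assms)
  show ?thesis
  proof (rule smooth_map_onI[OF smooth_atlas_vector_manifold assms(1) M.chart_open(2)[OF assms(2)]])
    fix x assume x: "x \<in> snd c ` fst c"
    have "smooth_on (snd c ` fst c) (\<lambda>x. snd c (chart_inv c x))"
      using M.chart_transition[OF assms(2,2)] by simp
    then show "\<exists>T c' d. open T \<and> x \<in> T \<and> c' \<in> charts vector_manifold \<and> d \<in> charts M \<and>
      T \<subseteq> fst c' \<and> chart_inv c ` T \<subseteq> fst d \<and> smooth_on (snd c' ` T) (\<lambda>x. snd d (chart_inv c (chart_inv c' x)))"
      using x assms(2)
      by (intro exI[of _ "snd c ` fst c"] exI[of _ "(UNIV, id)"] exI[of _ c])
        (auto simp: M.chart_open inv_id inv_into_into)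
  qed
qed

section \<open>Products of manifolds\<close>

lemma chart_inv_prod_chart:
  assumes "smooth_atlas M" "smooth_atlas N" "c \<in> charts M" "d \<in> charts N"
    and "x \<in> snd c ` fst c" "y \<in> snd d ` fst d"
  shows "chart_inv (prod_chart c d) (x, y) = (chart_inv c x, chart_inv d y)"
proof (rule inv_into_f_eq)
  interpret M: atlas M by standard (rule assms)
  interpret N: atlas N by standard (rule assms)
  have "inj_on (snd c) (fst c)" "inj_on (snd d) (fst d)"
    by (metis M.chart_inv_chart N.chart_inv_chart assms(3,4) inj_on_inverseI)+
  then show "inj_on (snd (prod_chart c d)) (fst (prod_chart c d))"
    by (auto simp: prod_chart_def inj_on_def)
qed (use assms(5,6) in \<open>auto simp: prod_chart_def inv_into_into f_inv_into_f\<close>)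

lemma prod_chart_image: "snd (prod_chart c d) ` (A \<times> B) = (snd c ` A) \<times> (snd d ` B)"
  by (auto simp: prod_chart_def)

lemma smooth_atlas_prod:
  assumes "smooth_atlas M" "smooth_atlas N"
  shows "smooth_atlas (prod_manifold M N)"
proof -
  interpret M: atlas M by standard (rule assms)
  interpret N: atlas N by standard (rule assms)
  have homeo: "open (fst (prod_chart c d)) \<and> open (snd (prod_chart c d) ` fst (prod_chart c d)) \<and>
      homeomorphism (fst (prod_chart c d)) (snd (prod_chart c d) ` fst (prod_chart c d))
        (snd (prod_chart c d)) (chart_inv (prod_chart c d))"
    if c: "c \<in> charts M" and d: "d \<in> charts N" for c d
  proof -
    let ?e = "prod_chart c d"
    have f: "fst ?e = fst c \<times> fst d" and im: "snd ?e ` fst ?e = (snd c ` fst c) \<times> (snd d ` fst d)"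
      by (auto simp: prod_chart_def)
    have inv: "chart_inv ?e z = (chart_inv c (fst z), chart_inv d (snd z))" if "z \<in> snd ?e ` fst ?e" for z
      using that chart_inv_prod_chart[OF assms c d, of "fst z" "snd z"] unfolding im by auto
    have "continuous_on (snd ?e ` fst ?e) (\<lambda>z. (chart_inv c (fst z), chart_inv d (snd z)))"
      unfolding im
      by (intro continuous_on_Pair continuous_on_compose2[OF M.chart_continuous(2)[OF c]]
          continuous_on_compose2[OF N.chart_continuous(2)[OF d]] continuous_intros) auto
    then have "continuous_on (snd ?e ` fst ?e) (chart_inv ?e)"
      by (subst continuous_on_cong[OF refl inv])
    moreover have "continuous_on (fst ?e) (\<lambda>z. (snd c (fst z), snd d (snd z)))"
      unfolding f
      by (intro continuous_on_Pair continuous_on_compose2[OF M.chart_continuous(1)[OF c]]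
          continuous_on_compose2[OF N.chart_continuous(1)[OF d]] continuous_intros) auto
    then have "continuous_on (fst ?e) (snd ?e)"
      by (simp add: prod_chart_def map_prod_def case_prod_beta')
    moreover have "open (fst ?e)" "open (snd ?e ` fst ?e)"
      unfolding im unfolding f
      by (simp_all add: open_Times M.chart_open[OF c] N.chart_open[OF d])
    moreover have "chart_inv ?e (snd ?e z) = z" if "z \<in> fst ?e" for z
      using that inv[of "snd ?e z"] M.chart_inv_chart[OF c] N.chart_inv_chart[OF d]
      by (auto simp: prod_chart_def)
    ultimately show ?thesis
      by (force simp: homeomorphism_def f_inv_into_f image_iff)
  qed
  have trans: "smooth_on (snd (prod_chart c d) ` (fst (prod_chart c d) \<inter> fst (prod_chart c' d')))
      (snd (prod_chart c' d') \<circ> chart_inv (prod_chart c d))"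
    if c: "c \<in> charts M" "c' \<in> charts M" and d: "d \<in> charts N" "d' \<in> charts N" for c c' d d'
  proof -
    define A where "A = snd c ` (fst c \<inter> fst c')"
    define B where "B = snd d ` (fst d \<inter> fst d')"
    have op: "open A" "open B"
      unfolding A_def B_def
      by (intro M.chart_image_open N.chart_image_open c d open_Int M.chart_open(1) N.chart_open(1) Int_lower1)+
    have im: "snd (prod_chart c d) ` (fst (prod_chart c d) \<inter> fst (prod_chart c' d')) = A \<times> B"
      unfolding A_def B_def by (force simp: prod_chart_def)
    have "smooth_on (A \<times> B) (\<lambda>z. (snd c' (chart_inv c (fst z)), snd d' (chart_inv d (snd z))))"
    proof (rule smooth_on_Pair)
      show "smooth_on (A \<times> B) (\<lambda>z. snd c' (chart_inv c (fst z)))"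
        by (rule smooth_on_compose[OF open_Times[OF op] op(1) _ smooth_on_linear[OF linear_fst]
              M.chart_transition[OF c, folded A_def]]) auto
      show "smooth_on (A \<times> B) (\<lambda>z. snd d' (chart_inv d (snd z)))"
        by (rule smooth_on_compose[OF open_Times[OF op] op(2) _ smooth_on_linear[OF linear_snd]
              N.chart_transition[OF d, folded B_def]]) auto
    qed (simp add: op open_Times)
    then show ?thesis
      unfolding im
    proof (subst smooth_on_cong[OF open_Times[OF op]])
      fix z assume "z \<in> A \<times> B"
      then have "fst z \<in> snd c ` fst c" "snd z \<in> snd d ` fst d"
        by (auto simp: A_def B_def)
      then show "(snd (prod_chart c' d') \<circ> chart_inv (prod_chart c d)) z =
          (snd c' (chart_inv c (fst z)), snd d' (chart_inv d (snd z)))"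
        using chart_inv_prod_chart[OF assms c(1) d(1), of "fst z" "snd z"] by (simp add: prod_chart_def)
    qed
  qed
  show ?thesis
    unfolding smooth_atlas_def
    using homeo trans M.chart_at N.chart_at
    by (auto simp: prod_manifold_def prod_chart_def)
qed

lemma chart_at_prod [simp]: "chart_at (prod_manifold M N) z = prod_chart (chart_at M (fst z)) (chart_at N (snd z))"
  by (simp add: prod_manifold_def case_prod_beta)

lemma prod_chart_in: "c \<in> charts M \<Longrightarrow> d \<in> charts N \<Longrightarrow> prod_chart c d \<in> charts (prod_manifold M N)"
  by (auto simp: prod_manifold_def)

lemma prod_chart_simps [simp]: "fst (prod_chart c d) = fst c \<times> fst d"
  "snd (prod_chart c d) z = (snd c (fst z), snd d (snd z))"
  by (simp_all add: prod_chart_def map_prod_def case_prod_beta)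

lemma smooth_map_on_fst:
  assumes "smooth_atlas M" "smooth_atlas N" "open S"
  shows "smooth_map_on (prod_manifold M N) M S fst"
proof (rule smooth_map_onI[OF smooth_atlas_prod[OF assms(1,2)] assms(1,3)])
  interpret M: atlas M by standard (rule assms)
  interpret N: atlas N by standard (rule assms)
  fix z
  let ?c = "chart_at M (fst z)" and ?d = "chart_at N (snd z)"
  have op: "open (snd ?c ` fst ?c \<times> snd ?d ` fst ?d)"
    by (simp add: open_Times M.chart_open M.chart_at N.chart_open N.chart_at)
  have "smooth_on (snd ?c ` fst ?c \<times> snd ?d ` fst ?d) (\<lambda>x. snd ?c (fst (chart_inv (prod_chart ?c ?d) x)))"
    by (subst smooth_on_cong[OF op, of _ fst])
      (auto simp: chart_inv_prod_chart[OF assms(1,2) M.chart_at(1) N.chart_at(1)] M.chart_inv_chart[OF M.chart_at(1)]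
        linear_fst simp del: prod_chart_simps(1) intro!: smooth_on_linear)
  then show "\<exists>T c d. open T \<and> z \<in> T \<and> c \<in> charts (prod_manifold M N) \<and> d \<in> charts M \<and>
      T \<subseteq> fst c \<and> fst ` T \<subseteq> fst d \<and> smooth_on (snd c ` T) (\<lambda>x. snd d (fst (chart_inv c x)))"
    by (intro exI[of _ "fst ?c \<times> fst ?d"] exI[of _ "prod_chart ?c ?d"] exI[of _ ?c])
      (auto simp: M.chart_at N.chart_at M.chart_open N.chart_open open_Times prod_chart_in prod_chart_image mem_Times_iff
        simp del: prod_chart_simps(2))
qed

lemma smooth_map_on_snd:
  assumes "smooth_atlas M" "smooth_atlas N" "open S"
  shows "smooth_map_on (prod_manifold M N) N S snd"
proof (rule smooth_map_onI[OF smooth_atlas_prod[OF assms(1,2)] assms(2,3)])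
  interpret M: atlas M by standard (rule assms)
  interpret N: atlas N by standard (rule assms)
  fix z
  let ?c = "chart_at M (fst z)" and ?d = "chart_at N (snd z)"
  have op: "open (snd ?c ` fst ?c \<times> snd ?d ` fst ?d)"
    by (simp add: open_Times M.chart_open M.chart_at N.chart_open N.chart_at)
  have "smooth_on (snd ?c ` fst ?c \<times> snd ?d ` fst ?d) (\<lambda>x. snd ?d (snd (chart_inv (prod_chart ?c ?d) x)))"
    by (subst smooth_on_cong[OF op, of _ snd])
      (auto simp: chart_inv_prod_chart[OF assms(1,2) M.chart_at(1) N.chart_at(1)] N.chart_inv_chart[OF N.chart_at(1)]
        linear_snd simp del: prod_chart_simps(1) intro!: smooth_on_linear)
  then show "\<exists>T c d. open T \<and> z \<in> T \<and> c \<in> charts (prod_manifold M N) \<and> d \<in> charts N \<and>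
      T \<subseteq> fst c \<and> snd ` T \<subseteq> fst d \<and> smooth_on (snd c ` T) (\<lambda>x. snd d (snd (chart_inv c x)))"
    by (intro exI[of _ "fst ?c \<times> fst ?d"] exI[of _ "prod_chart ?c ?d"] exI[of _ ?d])
      (auto simp: M.chart_at N.chart_at M.chart_open N.chart_open open_Times prod_chart_in prod_chart_image mem_Times_iff
        simp del: prod_chart_simps(2))
qed

lemma smooth_map_on_Pair:
  assumes "smooth_atlas K" "smooth_atlas M" "smooth_atlas N" "open S"
    and f: "smooth_map_on K M S f" and g: "smooth_map_on K N S g"
  shows "smooth_map_on K (prod_manifold M N) S (\<lambda>p. (f p, g p))"
proof (rule smooth_map_onI[OF assms(1) smooth_atlas_prod[OF assms(2,3)] assms(4)])
  interpret K: atlas K by standard (rule assms)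
  interpret M: atlas M by standard (rule assms)
  interpret N: atlas N by standard (rule assms)
  fix p assume p: "p \<in> S"
  let ?c = "chart_at K p" and ?d = "chart_at M (f p)" and ?e = "chart_at N (g p)"
  obtain A where A: "open A" "p \<in> A" "A \<subseteq> S" "A \<subseteq> fst ?c" "f ` A \<subseteq> fst ?d" "open (snd ?c ` A)"
    "smooth_on (snd ?c ` A) (\<lambda>x. snd ?d (f (chart_inv ?c x)))"
    by (rule smooth_map_on_charts[OF assms(1,2,4) f p K.chart_at M.chart_at])
  obtain B where B: "open B" "p \<in> B" "B \<subseteq> S" "B \<subseteq> fst ?c" "g ` B \<subseteq> fst ?e" "open (snd ?c ` B)"
    "smooth_on (snd ?c ` B) (\<lambda>x. snd ?e (g (chart_inv ?c x)))"
    by (rule smooth_map_on_charts[OF assms(1,3,4) g p K.chart_at N.chart_at])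
  have "open (snd ?c ` (A \<inter> B))"
    using A B by (intro K.chart_image_open K.chart_at) auto
  then have "smooth_on (snd ?c ` (A \<inter> B)) (\<lambda>x. (snd ?d (f (chart_inv ?c x)), snd ?e (g (chart_inv ?c x))))"
    by (rule smooth_on_Pair[OF _ smooth_on_subset[OF A(7)] smooth_on_subset[OF B(7)]]) auto
  then show "\<exists>T c d. open T \<and> p \<in> T \<and> c \<in> charts K \<and> d \<in> charts (prod_manifold M N) \<and>
      T \<subseteq> fst c \<and> (\<lambda>p. (f p, g p)) ` T \<subseteq> fst d \<and> smooth_on (snd c ` T) (\<lambda>x. snd d (f (chart_inv c x), g (chart_inv c x)))"
    using A B by (intro exI[of _ "A \<inter> B"] exI[of _ ?c] exI[of _ "prod_chart ?d ?e"])
      (auto simp: K.chart_at M.chart_at N.chart_at prod_chart_in)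
qed

section \<open>Tangent maps\<close>

text \<open>Tangent maps are computed from any expression \<open>f'\<close> that describes
  \<open>f\<close> in the preferred charts near \<open>p\<close>, so that \<open>chart_inv\<close>
  need not occur in it.\<close>

lemma tangent_map_eqI:
  assumes "(f' has_derivative D) (at (snd (chart_at M p) p))"
    and "smooth_atlas M" "open S" "p \<in> S"
    and eq: "\<And>q. q \<in> S \<Longrightarrow> q \<in> fst (chart_at M p) \<Longrightarrow> snd (chart_at N (f p)) (f q) = f' (snd (chart_at M p) q)"
  shows "tangent_map M N f p = D"
proof -
  interpret M: atlas M by standard (rule assms)
  let ?c = "chart_at M p"
  have op: "open (snd ?c ` (S \<inter> fst ?c))"
    using assms by (intro M.chart_image_open M.chart_at open_Int M.chart_open) auto
  have "(snd (chart_at N (f p)) \<circ> f \<circ> chart_inv ?c has_derivative D) (at (snd ?c p))"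
    by (rule has_derivative_transform_within_open[OF assms(1) op])
      (auto simp: assms(4) M.chart_at M.chart_inv_chart[OF M.chart_at(1)] eq)
  then show ?thesis
    unfolding tangent_map_def by (rule frechet_derivative_at[symmetric])
qed

lemma smooth_map_on_has_derivative:
  assumes "smooth_atlas M" "smooth_atlas N" "open S" "smooth_map_on M N S f" "p \<in> S"
  shows "((\<lambda>x. snd (chart_at N (f p)) (f (chart_inv (chart_at M p) x))) has_derivative tangent_map M N f p)
    (at (snd (chart_at M p) p))"
proof -
  interpret M: atlas M by standard (rule assms)
  interpret N: atlas N by standard (rule assms)
  let ?c = "chart_at M p" and ?d = "chart_at N (f p)"
  obtain A where A: "open A" "p \<in> A" "A \<subseteq> S" "A \<subseteq> fst ?c" "f ` A \<subseteq> fst ?d" "open (snd ?c ` A)"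
    "smooth_on (snd ?c ` A) (\<lambda>x. snd ?d (f (chart_inv ?c x)))"
    by (rule smooth_map_on_charts[OF assms M.chart_at N.chart_at])
  show ?thesis
    using smooth_on_has_derivative[OF A(7) imageI[OF A(2)]] by (simp add: tangent_map_def o_def)
qed

lemma linear_tangent_map:
  "smooth_atlas M \<Longrightarrow> smooth_atlas N \<Longrightarrow> open S \<Longrightarrow> smooth_map_on M N S f \<Longrightarrow> p \<in> S \<Longrightarrow>
    linear (tangent_map M N f p)"
  by (rule has_derivative_linear[OF smooth_map_on_has_derivative])

lemma tangent_map_compose:
  assumes "smooth_atlas M" "smooth_atlas N" "smooth_atlas K" "open S" "open T"
    and f: "smooth_map_on M N S f" and g: "smooth_map_on N K T g" and p: "p \<in> S" "f p \<in> T"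
  shows "tangent_map M K (\<lambda>p. g (f p)) p v = tangent_map N K g (f p) (tangent_map M N f p v)"
proof -
  interpret M: atlas M by standard (rule assms)
  interpret N: atlas N by standard (rule assms)
  let ?c = "chart_at M p" and ?d = "chart_at N (f p)" and ?e = "chart_at K (g (f p))"
  let ?f = "\<lambda>x. snd ?d (f (chart_inv ?c x))" and ?g = "\<lambda>y. snd ?e (g (chart_inv ?d y))"
  have "?f (snd ?c p) = snd ?d (f p)"
    by (simp add: M.chart_inv_chart M.chart_at)
  then have "((\<lambda>x. ?g (?f x)) has_derivative (\<lambda>v. tangent_map N K g (f p) (tangent_map M N f p v))) (at (snd ?c p))"
    using smooth_map_on_has_derivative[OF assms(2,3,5) g p(2)]
    by (intro has_derivative_compose[OF smooth_map_on_has_derivative[OF assms(1,2,4) f p(1)]]) simp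
  \<comment> \<open>The intermediate chart cancels only where \<open>f\<close> lands in its domain,
    so the comparison is made on this open set.\<close>
  moreover have "open (S \<inter> f -` fst ?d)"
    by (rule continuous_open_preimage[OF smooth_map_on_continuous[OF f] assms(4) N.chart_open(1)[OF N.chart_at(1)]])
  ultimately have "tangent_map M K (\<lambda>p. g (f p)) p = (\<lambda>v. tangent_map N K g (f p) (tangent_map M N f p v))"
    by (rule tangent_map_eqI[OF _ assms(1), of _ _ _ "S \<inter> f -` fst ?d"])
      (auto simp: p N.chart_at N.chart_inv_chart[OF N.chart_at(1)] M.chart_inv_chart[OF M.chart_at(1)])
  then show ?thesis
    by simp
qed

lemma tangent_map_cong:
  assumes "smooth_atlas M" "smooth_atlas N" "open S" "smooth_map_on M N S f" "p \<in> S"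
    and eq: "\<And>q. q \<in> S \<Longrightarrow> g q = f q"
  shows "tangent_map M N g p = tangent_map M N f p"
proof -
  interpret M: atlas M by standard (rule assms)
  show ?thesis
    by (rule tangent_map_eqI[OF smooth_map_on_has_derivative[OF assms(1-5)] assms(1,3,5)])
      (simp add: eq assms(5) M.chart_inv_chart[OF M.chart_at(1)])
qed

lemma tangent_map_id:
  assumes "smooth_atlas M"
  shows "tangent_map M M (\<lambda>p. p) p v = v"
  by (subst tangent_map_eqI[OF has_derivative_ident assms open_UNIV]) auto

lemma tangent_map_const:
  assumes "smooth_atlas M"
  shows "tangent_map M N (\<lambda>_. q) p v = 0"
  by (subst tangent_map_eqI[OF has_derivative_const assms open_UNIV, where f = "\<lambda>_. q"]) auto

lemma tangent_map_fst:
  assumes "smooth_atlas M" "smooth_atlas N"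
  shows "tangent_map (prod_manifold M N) M fst z v = fst v"
  by (subst tangent_map_eqI[OF has_derivative_fst[OF has_derivative_ident] smooth_atlas_prod[OF assms] open_UNIV]) auto

lemma tangent_map_snd:
  assumes "smooth_atlas M" "smooth_atlas N"
  shows "tangent_map (prod_manifold M N) N snd z v = snd v"
  by (subst tangent_map_eqI[OF has_derivative_snd[OF has_derivative_ident] smooth_atlas_prod[OF assms] open_UNIV]) auto

lemma tangent_map_Pair:
  assumes "smooth_atlas K" "smooth_atlas M" "smooth_atlas N" "open S"
    and f: "smooth_map_on K M S f" and g: "smooth_map_on K N S g" and p: "p \<in> S"
  shows "tangent_map K (prod_manifold M N) (\<lambda>p. (f p, g p)) p v = (tangent_map K M f p v, tangent_map K N g p v)"
proof -
  interpret K: atlas K by standard (rule assms)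
  show ?thesis
    by (subst tangent_map_eqI[OF has_derivative_Pair[OF smooth_map_on_has_derivative[OF assms(1,2,4) f p]
          smooth_map_on_has_derivative[OF assms(1,3,4) g p]] assms(1) open_UNIV])
      (simp_all add: K.chart_inv_chart[OF K.chart_at(1)])
qed

section \<open>Tangent maps of charts and changes of coordinates\<close>

lemma tangent_map_vector_manifold:
  "tangent_map vector_manifold vector_manifold f x = frechet_derivative f (at x)"
  by (simp add: tangent_map_def o_def id_def inv_id[unfolded id_def])

lemma tangent_map_chart:
  assumes "smooth_atlas M" "c \<in> charts M" "p \<in> fst c"
  shows "tangent_map vector_manifold M (chart_inv c) (snd c p) (tangent_map M vector_manifold (snd c) p v) = v"
    and "tangent_map M vector_manifold (snd c) p (tangent_map vector_manifold M (chart_inv c) (snd c p) v) = v"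
proof -
  interpret M: atlas M by standard (rule assms)
  note vm = smooth_atlas_vector_manifold
  note op = M.chart_open[OF assms(2)]
  note sm = smooth_map_on_chart[OF assms(1,2)] smooth_map_on_chart_inv[OF assms(1,2)]
  have x: "snd c p \<in> snd c ` fst c"
    using assms by simp
  have "tangent_map M M (\<lambda>q. chart_inv c (snd c q)) p = tangent_map M M (\<lambda>q. q) p"
    by (rule tangent_map_cong[OF assms(1,1) op(1) smooth_map_on_id[OF assms(1) op(1)] assms(3)])
      (simp add: M.chart_inv_chart[OF assms(2)])
  then show "tangent_map vector_manifold M (chart_inv c) (snd c p) (tangent_map M vector_manifold (snd c) p v) = v"
    using tangent_map_compose[OF assms(1) vm assms(1) op sm assms(3) x, of v]
    by (simp add: tangent_map_id[OF assms(1)])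
  have "tangent_map vector_manifold vector_manifold (\<lambda>x. snd c (chart_inv c x)) (snd c p)
      = tangent_map vector_manifold vector_manifold (\<lambda>q. q) (snd c p)"
    by (rule tangent_map_cong[OF vm vm op(2) smooth_map_on_id[OF vm op(2)] x])
      (rule M.chart_chart_inv[OF assms(2)])
  then show "tangent_map M vector_manifold (snd c) p (tangent_map vector_manifold M (chart_inv c) (snd c p) v) = v"
    using tangent_map_compose[OF vm assms(1) vm op(2,1) sm(2,1) x, of v] assms(3)
    by (simp add: tangent_map_id[OF vm] M.chart_inv_chart[OF assms(2)])
qed

text \<open>Tangent vectors at \<open>p\<close> are represented by their coordinates in exactly this
  chart.\<close>

lemma tangent_map_chart_at:
  assumes "smooth_atlas M"
  shows "tangent_map M vector_manifold (snd (chart_at M p)) p v = v"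
  by (subst tangent_map_eqI[OF has_derivative_ident assms open_UNIV]) auto

text \<open>\<open>tangent_map\<close> is tied to the preferred charts, which vary with the point.
  The tangent map of a chart \<open>c\<close> translates to coordinates in \<open>c\<close>, where
  one chart serves a whole neighbourhood and smooth dependence on the point can be
  expressed.\<close>

lemma tangent_map_in_charts:
  assumes "smooth_atlas M" "smooth_atlas N" "open S" and f: "smooth_map_on M N S f" and p: "p \<in> S"
    and c: "c \<in> charts M" "p \<in> fst c" and d: "d \<in> charts N" "f p \<in> fst d"
  shows "tangent_map N vector_manifold (snd d) (f p) (tangent_map M N f p v) =
    frechet_derivative (\<lambda>x. snd d (f (chart_inv c x))) (at (snd c p)) (tangent_map M vector_manifold (snd c) p v)"
proof -
  interpret M: atlas M by standard (rule assms)
  interpret N: atlas N by standard (rule assms)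
  note vm = smooth_atlas_vector_manifold
  obtain T where T: "open T" "p \<in> T" "T \<subseteq> S" "T \<subseteq> fst c" "f ` T \<subseteq> fst d" "open (snd c ` T)"
    "smooth_on (snd c ` T) (\<lambda>x. snd d (f (chart_inv c x)))"
    by (rule smooth_map_on_charts[OF assms])
  let ?\<psi> = "\<lambda>x. snd d (f (chart_inv c x))"
  have c_sm: "smooth_map_on M vector_manifold T (snd c)"
    by (rule smooth_map_on_subset[OF smooth_map_on_chart[OF assms(1) c(1)] T(4)])
  have \<psi>_sm: "smooth_map_on vector_manifold vector_manifold (snd c ` T) ?\<psi>"
    using T by (simp add: smooth_map_on_vector_manifold)
  have "tangent_map N vector_manifold (snd d) (f p) (tangent_map M N f p v) =
      tangent_map M vector_manifold (\<lambda>q. snd d (f q)) p v"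
    by (rule tangent_map_compose[OF assms(1,2) vm assms(3) N.chart_open(1)[OF d(1)] f
          smooth_map_on_chart[OF assms(2) d(1)] p d(2), symmetric])
  also have "tangent_map M vector_manifold (\<lambda>q. snd d (f q)) p = tangent_map M vector_manifold (\<lambda>q. ?\<psi> (snd c q)) p"
    by (rule tangent_map_cong[OF assms(1) vm T(1) _ T(2)])
      (auto intro!: smooth_map_on_compose[OF assms(1) vm vm T(1) T(6) c_sm \<psi>_sm]
        simp: M.chart_inv_chart[OF c(1)] subsetD[OF T(4)])
  also have "\<dots> v = frechet_derivative ?\<psi> (at (snd c p)) (tangent_map M vector_manifold (snd c) p v)"
    using tangent_map_compose[OF assms(1) vm vm T(1) T(6) c_sm \<psi>_sm T(2) imageI[OF T(2)], of v]
    by (simp add: tangent_map_vector_manifold)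
  finally show ?thesis .
qed

lemma prod_vector_manifold: "prod_manifold vector_manifold vector_manifold = vector_manifold"
  by (simp add: prod_manifold_def vector_manifold_def prod_chart_def map_prod_def id_def fun_eq_iff)

lemma tangent_map_prod_chart:
  assumes "smooth_atlas M" "smooth_atlas N"
    and c: "c \<in> charts M" "p \<in> fst c" and d: "d \<in> charts N" "q \<in> fst d"
  shows "tangent_map (prod_manifold M N) vector_manifold (snd (prod_chart c d)) (p, q) (v, w) =
    (tangent_map M vector_manifold (snd c) p v, tangent_map N vector_manifold (snd d) q w)"
proof -
  interpret M: atlas M by standard (rule assms)
  interpret N: atlas N by standard (rule assms)
  note vm = smooth_atlas_vector_manifold and pr = smooth_atlas_prod[OF assms(1,2)]
  note op = M.chart_open(1)[OF c(1)] N.chart_open(1)[OF d(1)]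
  note op' = open_Times[OF op]
  note c_sm = smooth_map_on_chart[OF assms(1) c(1)] and d_sm = smooth_map_on_chart[OF assms(2) d(1)]
  note pq = SigmaI[OF c(2) d(2)]
  have 1: "smooth_map_on (prod_manifold M N) vector_manifold (fst c \<times> fst d) (\<lambda>z. snd c (fst z))"
    by (rule smooth_map_on_compose[OF pr assms(1) vm op' op(1) smooth_map_on_fst[OF assms(1,2) op'] c_sm]) auto
  have 2: "smooth_map_on (prod_manifold M N) vector_manifold (fst c \<times> fst d) (\<lambda>z. snd d (snd z))"
    by (rule smooth_map_on_compose[OF pr assms(2) vm op' op(2) smooth_map_on_snd[OF assms(1,2) op'] d_sm]) auto
  have "snd (prod_chart c d) = (\<lambda>z. (snd c (fst z), snd d (snd z)))"
    by auto
  then show ?thesis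
    using tangent_map_Pair[OF pr vm vm op' 1 2 pq, of "(v, w)"] c(2) d(2)
      tangent_map_compose[OF pr assms(1) vm op' op(1) smooth_map_on_fst[OF assms(1,2) op'] c_sm pq]
      tangent_map_compose[OF pr assms(2) vm op' op(2) smooth_map_on_snd[OF assms(1,2) op'] d_sm pq]
    by (simp add: prod_vector_manifold tangent_map_fst[OF assms(1,2)] tangent_map_snd[OF assms(1,2)])
qed

section \<open>Smooth vector fields along maps\<close>

text \<open>Stands for smoothness of \<open>x \<mapsto> (s x, \<zeta> x)\<close> as a map into the
  tangent bundle. Since its domain lies in a model space, ordinary calculus applies in every
  chart.\<close>

definition smooth_along ::
  "('a::topological_space, 'e::fin_dim_vector) manifold \<Rightarrow> 'x set \<Rightarrow> ('x::fin_dim_vector \<Rightarrow> 'a) \<Rightarrow> ('x \<Rightarrow> 'e) \<Rightarrow> bool" where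
  "smooth_along M A s \<zeta> \<longleftrightarrow> smooth_map_on vector_manifold M A s \<and>
     (\<forall>c\<in>charts M. smooth_on (A \<inter> s -` fst c) (\<lambda>x. tangent_map M vector_manifold (snd c) (s x) (\<zeta> x)))"

text \<open>One chart near each \<open>x\<close> suffices: a change of chart multiplies the
  coordinates of \<open>\<zeta>\<close> by the derivative of the transition map, a smooth family of
  linear maps.\<close>

lemma smooth_alongI:
  assumes "smooth_atlas M" "open A" and s: "smooth_map_on vector_manifold M A s"
    and loc: "\<And>x. x \<in> A \<Longrightarrow> \<exists>T c. open T \<and> x \<in> T \<and> T \<subseteq> A \<and> c \<in> charts M \<and> s ` T \<subseteq> fst c \<and>
      smooth_on T (\<lambda>x. tangent_map M vector_manifold (snd c) (s x) (\<zeta> x))"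
  shows "smooth_along M A s \<zeta>"
  unfolding smooth_along_def
proof (intro conjI s ballI smooth_on_local)
  interpret M: atlas M by standard (rule assms)
  note vm = smooth_atlas_vector_manifold
  fix c' x assume c': "c' \<in> charts M" and x: "x \<in> A \<inter> s -` fst c'"
  then obtain T c where T: "open T" "x \<in> T" "T \<subseteq> A" and c: "c \<in> charts M" and sT: "s ` T \<subseteq> fst c"
    and sm: "smooth_on T (\<lambda>x. tangent_map M vector_manifold (snd c) (s x) (\<zeta> x))"
    using loc by blast
  let ?\<psi> = "\<lambda>y. snd c' (chart_inv c y)"
  let ?B = "snd c ` (fst c \<inter> fst c')"
  define T' where "T' = T \<inter> s -` fst c'"
  have op: "open T'"
    unfolding T'_def using T
    by (intro continuous_open_preimage continuous_on_subset[OF smooth_map_on_continuous[OF s]] M.chart_open(1) c')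
  have opB: "open ?B"
    by (intro M.chart_image_open c open_Int M.chart_open(1) c' Int_lower1)
  have cs: "smooth_on T' (\<lambda>x. snd c (s x))"
  proof -
    have sub: "T' \<subseteq> A" and im: "s ` T' \<subseteq> fst c"
      using T sT by (auto simp: T'_def)
    show ?thesis
      using smooth_map_on_compose[OF vm assms(1) vm op M.chart_open(1)[OF c] smooth_map_on_subset[OF s sub]
          smooth_map_on_chart[OF assms(1) c] im] op
      by (simp add: smooth_map_on_vector_manifold)
  qed
  have 1: "smooth_on T' (\<lambda>x. frechet_derivative ?\<psi> (at (snd c (s x))) v)" for v
    by (rule smooth_on_compose[OF op opB _ cs smooth_on_frechet_derivative[OF M.chart_transition[OF c c']]])
      (use sT in \<open>auto simp: T'_def\<close>)
  have 2: "linear (frechet_derivative ?\<psi> (at (snd c (s x))))" if "x \<in> T'" for x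
    by (rule linear_frechet_derivative[OF smooth_on_differentiable[OF M.chart_transition[OF c c']]])
      (use that sT in \<open>auto simp: T'_def\<close>)
  have "smooth_on T' (\<lambda>x. frechet_derivative ?\<psi> (at (snd c (s x)))
      (tangent_map M vector_manifold (snd c) (s x) (\<zeta> x)))"
    by (rule smooth_on_family_apply[where A = "\<lambda>x. frechet_derivative ?\<psi> (at (snd c (s x)))",
          OF op 2 1 smooth_on_subset[OF sm]]) (auto simp: T'_def)
  \<comment> \<open>The transformation law of tangent vectors is the coordinate formula for the
    tangent map of the identity.\<close>
  moreover have "tangent_map M vector_manifold (snd c') (s x) (\<zeta> x) = frechet_derivative ?\<psi> (at (snd c (s x)))
      (tangent_map M vector_manifold (snd c) (s x) (\<zeta> x))" if "x \<in> T'" for x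
    using that sT c c' tangent_map_in_charts[OF assms(1,1) open_UNIV smooth_map_on_id[OF assms(1) open_UNIV]
        UNIV_I c _ c', of "s x" "\<zeta> x"]
    by (auto simp: T'_def tangent_map_id[OF assms(1)])
  ultimately have "smooth_on T' (\<lambda>x. tangent_map M vector_manifold (snd c') (s x) (\<zeta> x))"
    by (subst smooth_on_cong[OF op])
  then show "\<exists>T. open T \<and> x \<in> T \<and> smooth_on T (\<lambda>x. tangent_map M vector_manifold (snd c') (s x) (\<zeta> x))"
    using op x T by (auto simp: T'_def)
qed

lemma smooth_along_map: "smooth_along M A s \<zeta> \<Longrightarrow> smooth_map_on vector_manifold M A s"
  by (simp add: smooth_along_def)

lemma smooth_alongD:
  "smooth_along M A s \<zeta> \<Longrightarrow> c \<in> charts M \<Longrightarrow>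
    smooth_on (A \<inter> s -` fst c) (\<lambda>x. tangent_map M vector_manifold (snd c) (s x) (\<zeta> x))"
  by (simp add: smooth_along_def)

lemma smooth_map_on_preimage_chart:
  assumes "smooth_atlas M" "smooth_map_on N M A s" "open A" "c \<in> charts M"
  shows "open (A \<inter> s -` fst c)"
proof -
  interpret M: atlas M by standard (rule assms)
  show ?thesis
    using assms by (intro continuous_open_preimage smooth_map_on_continuous M.chart_open(1))
qed

lemma smooth_on_chart_compose:
  assumes "smooth_atlas M" "smooth_map_on vector_manifold M A s" "open A" "c \<in> charts M"
  shows "smooth_on (A \<inter> s -` fst c) (\<lambda>x. snd c (s x))"
  using smooth_map_onD[OF assms(2), of "(UNIV, id)" c] assms(4)
  by (simp add: inv_id Int_def)

lemma smooth_along_vector_manifold: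
  assumes "open A"
  shows "smooth_along vector_manifold A s \<zeta> \<longleftrightarrow> smooth_on A s \<and> smooth_on A \<zeta>"
  using assms by (simp add: smooth_along_def smooth_map_on_vector_manifold tangent_map_vector_manifold)

lemma smooth_along_field:
  assumes "smooth_atlas M" "open A" "open W" and X: "smooth_vector_field_on M W X"
    and s: "smooth_map_on vector_manifold M A s" and sub: "s ` A \<subseteq> W"
  shows "smooth_along M A s (\<lambda>x. X (s x))"
  unfolding smooth_along_def
proof (intro conjI s ballI)
  interpret M: atlas M by standard (rule assms)
  fix c assume c: "c \<in> charts M"
  let ?A = "A \<inter> s -` fst c"
  have op: "open ?A"
    by (rule smooth_map_on_preimage_chart[OF assms(1) s assms(2) c])
  have Xc: "smooth_on (snd c ` (fst c \<inter> W)) (chart_rep M c X)"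
    using X c by (auto simp: smooth_vector_field_on_def)
  have "smooth_on ?A (\<lambda>x. chart_rep M c X (snd c (s x)))"
    by (rule smooth_on_compose[OF op M.chart_image_open[OF c open_Int[OF M.chart_open(1)[OF c] assms(3)]]
          _ smooth_on_chart_compose[OF assms(1) s assms(2) c] Xc])
      (use sub in auto)
  then show "smooth_on ?A (\<lambda>x. tangent_map M vector_manifold (snd c) (s x) (X (s x)))"
    by (subst smooth_on_cong[OF op, of _ "\<lambda>x. chart_rep M c X (snd c (s x))"])
      (auto simp: chart_rep_def M.chart_inv_chart[OF c])
qed

text \<open>Reduces smoothness of a field to smoothness along inverse charts, where it can be
  assembled from pushforwards.\<close>

lemma smooth_vector_field_onI:
  assumes "smooth_atlas M" "open W"
    and X: "\<And>c. c \<in> charts M \<Longrightarrow>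
      smooth_along M (snd c ` (fst c \<inter> W)) (chart_inv c) (\<lambda>x. X (chart_inv c x))"
  shows "smooth_vector_field_on M W X"
proof -
  interpret M: atlas M by standard (rule assms)
  have "smooth_on (snd c ` (fst c \<inter> W)) (chart_rep M c X)" if c: "c \<in> charts M" for c
  proof -
    have "snd c ` (fst c \<inter> W) \<inter> chart_inv c -` fst c = snd c ` (fst c \<inter> W)"
      by (auto simp: M.chart_inv_chart[OF c])
    then show ?thesis
      using smooth_alongD[OF X[OF c] c] by (simp add: chart_rep_def[abs_def])
  qed
  then show ?thesis
    by (auto simp: smooth_vector_field_on_def)
qed

text \<open>In charts the pushforward applies the derivative of the coordinate expression of
  \<open>f\<close>, a smooth family of linear maps, to a smooth family of vectors.\<close>

lemma smooth_along_tangent_map: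
  assumes "smooth_atlas M" "smooth_atlas N" "open A" "open S"
    and f: "smooth_map_on M N S f" and \<zeta>: "smooth_along M A s \<zeta>" and sub: "s ` A \<subseteq> S"
  shows "smooth_along N A (\<lambda>x. f (s x)) (\<lambda>x. tangent_map M N f (s x) (\<zeta> x))"
proof (rule smooth_alongI[OF assms(2,3)])
  interpret M: atlas M by standard (rule assms)
  interpret N: atlas N by standard (rule assms)
  note vm = smooth_atlas_vector_manifold
  have s: "smooth_map_on vector_manifold M A s"
    by (rule smooth_along_map[OF \<zeta>])
  show "smooth_map_on vector_manifold N A (\<lambda>x. f (s x))"
    by (rule smooth_map_on_compose[OF vm assms(1-4) s f sub])
  fix x assume x: "x \<in> A"
  define c where "c = chart_at M (s x)"
  define d where "d = chart_at N (f (s x))"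
  have c: "c \<in> charts M" "s x \<in> fst c" and d: "d \<in> charts N" "f (s x) \<in> fst d"
    by (simp_all add: c_def d_def M.chart_at N.chart_at)
  have sx: "s x \<in> S"
    using x sub by auto
  obtain B where B: "open B" "s x \<in> B" "B \<subseteq> S" "B \<subseteq> fst c" "f ` B \<subseteq> fst d" "open (snd c ` B)"
    "smooth_on (snd c ` B) (\<lambda>x. snd d (f (chart_inv c x)))"
    by (rule smooth_map_on_charts[OF assms(1,2,4) f sx c d])
  let ?\<psi> = "\<lambda>y. snd d (f (chart_inv c y))"
  define T where "T = A \<inter> s -` B"
  have op: "open T"
    unfolding T_def by (rule continuous_open_preimage[OF smooth_map_on_continuous[OF s] assms(3) B(1)])
  have sub': "T \<subseteq> A \<inter> s -` fst c"
    using B by (auto simp: T_def)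
  have 1: "smooth_on T (\<lambda>x. frechet_derivative ?\<psi> (at (snd c (s x))) v)" for v
    by (rule smooth_on_compose[OF op B(6) _ smooth_on_subset[OF smooth_on_chart_compose[OF assms(1) s assms(3) c(1)] sub']
          smooth_on_frechet_derivative[OF B(7)]])
      (auto simp: T_def)
  have 2: "linear (frechet_derivative ?\<psi> (at (snd c (s y))))" if "y \<in> T" for y
    by (rule linear_frechet_derivative[OF smooth_on_differentiable[OF B(7)]])
      (use that in \<open>auto simp: T_def\<close>)
  have "smooth_on T (\<lambda>x. frechet_derivative ?\<psi> (at (snd c (s x)))
      (tangent_map M vector_manifold (snd c) (s x) (\<zeta> x)))"
    by (rule smooth_on_family_apply[where A = "\<lambda>x. frechet_derivative ?\<psi> (at (snd c (s x)))",
          OF op 2 1 smooth_on_subset[OF smooth_alongD[OF \<zeta> c(1)] sub']])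
  moreover have "tangent_map N vector_manifold (snd d) (f (s y)) (tangent_map M N f (s y) (\<zeta> y)) =
      frechet_derivative ?\<psi> (at (snd c (s y))) (tangent_map M vector_manifold (snd c) (s y) (\<zeta> y))"
    if "y \<in> T" for y
    by (rule tangent_map_in_charts[OF assms(1,2,4) f _ c(1) _ d(1)]) (use that B in \<open>auto simp: T_def\<close>)
  ultimately have "smooth_on T (\<lambda>x. tangent_map N vector_manifold (snd d) (f (s x)) (tangent_map M N f (s x) (\<zeta> x)))"
    by (subst smooth_on_cong[OF op])
  then show "\<exists>T c. open T \<and> x \<in> T \<and> T \<subseteq> A \<and> c \<in> charts N \<and> (\<lambda>x. f (s x)) ` T \<subseteq> fst c \<and>
      smooth_on T (\<lambda>x. tangent_map N vector_manifold (snd c) (f (s x)) (tangent_map M N f (s x) (\<zeta> x)))"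
    using op x B d by (intro exI[of _ T] exI[of _ d]) (auto simp: T_def)
qed

lemma smooth_along_zero:
  assumes "smooth_atlas M" "open A" and s: "smooth_map_on vector_manifold M A s"
  shows "smooth_along M A s (\<lambda>_. 0)"
  unfolding smooth_along_def
proof (intro conjI s ballI)
  interpret M: atlas M by standard (rule assms)
  fix c assume c: "c \<in> charts M"
  have "tangent_map M vector_manifold (snd c) (s x) 0 = 0" if "x \<in> A \<inter> s -` fst c" for x
    using that by (intro linear_0 linear_tangent_map[OF assms(1) smooth_atlas_vector_manifold
          M.chart_open(1)[OF c] smooth_map_on_chart[OF assms(1) c]]) auto
  then show "smooth_on (A \<inter> s -` fst c) (\<lambda>x. tangent_map M vector_manifold (snd c) (s x) 0)"
    by (subst smooth_on_cong[OF smooth_map_on_preimage_chart[OF assms(1) s assms(2) c]])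
      (auto intro: smooth_on_const)
qed

lemma smooth_along_const:
  assumes "smooth_atlas M" "open A"
  shows "smooth_along M A (\<lambda>_. p) (\<lambda>_. v)"
  unfolding smooth_along_def
  by (intro conjI ballI smooth_on_const smooth_map_on_const smooth_atlas_vector_manifold assms)

lemma smooth_along_Pair:
  assumes "smooth_atlas M" "smooth_atlas N" "open A"
    and s: "smooth_along M A s \<zeta>" and t: "smooth_along N A t \<eta>"
  shows "smooth_along (prod_manifold M N) A (\<lambda>x. (s x, t x)) (\<lambda>x. (\<zeta> x, \<eta> x))"
  unfolding smooth_along_def
proof (intro conjI ballI)
  note pr = smooth_atlas_prod[OF assms(1,2)]
  show st: "smooth_map_on vector_manifold (prod_manifold M N) A (\<lambda>x. (s x, t x))"
    by (rule smooth_map_on_Pair[OF smooth_atlas_vector_manifold assms(1-3)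
          smooth_along_map[OF s] smooth_along_map[OF t]])
  fix e assume e: "e \<in> charts (prod_manifold M N)"
  then obtain c d where c: "c \<in> charts M" and d: "d \<in> charts N" and [simp]: "e = prod_chart c d"
    by (auto simp: prod_manifold_def)
  let ?A = "A \<inter> (\<lambda>x. (s x, t x)) -` fst e"
  have op: "open ?A"
    by (rule smooth_map_on_preimage_chart[OF pr st assms(3) e])
  have "smooth_on ?A (\<lambda>x. (tangent_map M vector_manifold (snd c) (s x) (\<zeta> x),
      tangent_map N vector_manifold (snd d) (t x) (\<eta> x)))"
    by (rule smooth_on_Pair[OF op smooth_on_subset[OF smooth_alongD[OF s c]] smooth_on_subset[OF smooth_alongD[OF t d]]])
      auto
  then show "smooth_on ?A (\<lambda>x. tangent_map (prod_manifold M N) vector_manifold (snd e) (s x, t x) (\<zeta> x, \<eta> x))"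
    by (subst smooth_on_cong[OF op]) (auto simp: tangent_map_prod_chart[OF assms(1,2) c _ d] simp del: prod_chart_simps(2))
qed

lemma linear_pullback_chart_inv:
  assumes "smooth_atlas M" "c \<in> charts M" "x \<in> snd c ` fst c" "smooth_one_form M \<theta>"
  shows "linear (pullback vector_manifold M (chart_inv c) \<theta> x)"
proof -
  interpret M: atlas M by standard (rule assms)
  have "linear (tangent_map vector_manifold M (chart_inv c) x)"
    by (rule linear_tangent_map[OF smooth_atlas_vector_manifold assms(1) M.chart_open(2)[OF assms(2)]
          smooth_map_on_chart_inv[OF assms(1,2)] assms(3)])
  moreover have "linear (\<theta> q)" for q
    using assms(4) by (simp add: smooth_one_form_def)
  ultimately show ?thesis
    unfolding pullback_def by (rule linear_compose[unfolded o_def])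
qed

text \<open>In a chart \<open>\<theta>\<close> becomes a smooth family of linear maps. The tangent
  maps of the chart and of its inverse are inserted to pass to coordinates; they cancel.\<close>

lemma smooth_along_one_form:
  assumes "smooth_atlas M" "open A" "smooth_one_form M \<theta>" and \<zeta>: "smooth_along M A s \<zeta>"
  shows "smooth_on A (\<lambda>x. \<theta> (s x) (\<zeta> x))"
proof (rule smooth_on_local)
  interpret M: atlas M by standard (rule assms)
  note vm = smooth_atlas_vector_manifold
  fix x assume x: "x \<in> A"
  define c where "c = chart_at M (s x)"
  have c: "c \<in> charts M" "s x \<in> fst c"
    by (simp_all add: c_def M.chart_at)
  note s = smooth_along_map[OF \<zeta>]
  let ?A = "A \<inter> s -` fst c"
  let ?p = "pullback vector_manifold M (chart_inv c) \<theta>"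
  have op: "open ?A"
    by (rule smooth_map_on_preimage_chart[OF assms(1) s assms(2) c(1)])
  have \<theta>c: "smooth_on (snd c ` fst c) (\<lambda>x. ?p x v)" for v
    using assms(3) c by (auto simp: smooth_one_form_def)
  have 1: "smooth_on ?A (\<lambda>x. ?p (snd c (s x)) v)" for v
    by (rule smooth_on_compose[OF op M.chart_open(2)[OF c(1)] _ smooth_on_chart_compose[OF assms(1) s assms(2) c(1)]
        \<theta>c]) auto
  have 2: "linear (?p (snd c (s x)))" if "x \<in> ?A" for x
    by (rule linear_pullback_chart_inv[OF assms(1) c(1) _ assms(3)]) (use that in auto)
  have "smooth_on ?A (\<lambda>x. ?p (snd c (s x)) (tangent_map M vector_manifold (snd c) (s x) (\<zeta> x)))"
    by (rule smooth_on_family_apply[where A = "\<lambda>x. ?p (snd c (s x))",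
          OF op 2 1 smooth_alongD[OF \<zeta> c(1)]])
  then have "smooth_on ?A (\<lambda>x. \<theta> (s x) (\<zeta> x))"
    by (subst smooth_on_cong[OF op])
      (auto simp: pullback_def tangent_map_chart[OF assms(1) c(1)] M.chart_inv_chart[OF c(1)])
  then show "\<exists>T. open T \<and> x \<in> T \<and> smooth_on T (\<lambda>x. \<theta> (s x) (\<zeta> x))"
    using op x c by blast
qed

text \<open>The relation is required along the image of \<open>f\<close> only, and the fields on
  \<open>N\<close> near \<open>f p\<close> only. Hence \<open>f\<close> may be an orbit map, whose
  image need not be open.\<close>

lemma lie_bracket_related:
  assumes "smooth_atlas M" "smooth_atlas N" "open S" "open B"
    and f: "smooth_map_on M N S f" and p: "p \<in> S" "f p \<in> B"
    and X: "smooth_vector_field_on M S X" "smooth_vector_field_on M S X'"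
    and Y: "smooth_vector_field_on N B Y" "smooth_vector_field_on N B Y'"
    and rel: "\<And>q. q \<in> S \<Longrightarrow> Y (f q) = tangent_map M N f q (X q)"
      "\<And>q. q \<in> S \<Longrightarrow> Y' (f q) = tangent_map M N f q (X' q)"
  shows "lie_bracket N Y Y' (f p) = tangent_map M N f p (lie_bracket M X X' p)"
proof -
  interpret M: atlas M by standard (rule assms)
  interpret N: atlas N by standard (rule assms)
  define c where "c = chart_at M p"
  define d where "d = chart_at N (f p)"
  have c: "c \<in> charts M" "p \<in> fst c" and d: "d \<in> charts N" "f p \<in> fst d"
    by (simp_all add: c_def d_def M.chart_at N.chart_at)
  obtain T where T: "open T" "p \<in> T" "T \<subseteq> S" "T \<subseteq> fst c" "f ` T \<subseteq> fst d" "open (snd c ` T)"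
    "smooth_on (snd c ` T) (\<lambda>x. snd d (f (chart_inv c x)))"
    by (rule smooth_map_on_charts[OF assms(1-3) f p(1) c d])
  let ?\<psi> = "\<lambda>x. snd d (f (chart_inv c x))"
  have \<psi>: "?\<psi> (snd c q) = snd d (f q)" if "q \<in> T" for q
    using that T(4) by (auto simp: M.chart_inv_chart[OF c(1)] subset_eq)
  have rel': "chart_rep N d Z (?\<psi> y) = frechet_derivative ?\<psi> (at y) (chart_rep M c Z' y)"
    if "\<And>q. q \<in> S \<Longrightarrow> Z (f q) = tangent_map M N f q (Z' q)" "y \<in> snd c ` T" for Z Z' y
  proof -
    obtain q where q: "q \<in> T" "y = snd c q"
      using \<open>y \<in> snd c ` T\<close> by auto
    have q': "q \<in> S" "q \<in> fst c" "f q \<in> fst d"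
      using q T by auto
    show ?thesis
      using tangent_map_in_charts[OF assms(1-3) f q'(1) c(1) q'(2) d(1) q'(3), of "Z' q"] that(1)[OF q'(1)] q q'
      by (simp add: \<psi> chart_rep_def M.chart_inv_chart[OF c(1)] N.chart_inv_chart[OF d(1)])
  qed
  have "chart_rep M c Z differentiable (at (snd c p))" if "smooth_vector_field_on M S Z" for Z
    using that c p
    by (intro smooth_on_differentiable[of "snd c ` (fst c \<inter> S)"]) (auto simp: smooth_vector_field_on_def)
  note dX = this[OF X(1)] this[OF X(2)]
  have "chart_rep N d Z differentiable (at (snd d (f p)))" if "smooth_vector_field_on N B Z" for Z
    using that d p
    by (intro smooth_on_differentiable[of "snd d ` (fst d \<inter> B)"]) (auto simp: smooth_vector_field_on_def)
  note dY = this[OF Y(1), folded \<psi>[OF T(2)]] this[OF Y(2), folded \<psi>[OF T(2)]]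
  \<comment> \<open>The preferred charts at \<open>p\<close> and \<open>f p\<close> are used, so the
    field values in the bracket formula are the coordinate expressions at the centre.\<close>
  have at: "chart_rep M c Z (snd c p) = Z p" for Z
    using tangent_map_chart_at[OF assms(1), of p] by (simp add: chart_rep_def M.chart_inv_chart[OF c(1)] c flip: c_def)
  have at': "chart_rep N d Z (snd d (f p)) = Z (f p)" for Z
    using tangent_map_chart_at[OF assms(2), of "f p"] by (simp add: chart_rep_def N.chart_inv_chart[OF d(1)] d flip: d_def)
  have tm: "tangent_map M N f p = frechet_derivative ?\<psi> (at (snd c p))"
    by (simp add: tangent_map_def o_def c_def d_def)
  show ?thesis
    using bracket_of_related_fields[OF T(6) imageI[OF T(2)] T(7) dX dY rel'[OF rel(1)] rel'[OF rel(2)]]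
    by (simp add: lie_bracket_def Let_def tm at at' \<psi>[OF T(2)] flip: c_def d_def)
qed

section \<open>Local sections of a surjective one-form\<close>

text \<open>Dual fields are built by elimination, one basis vector at a time, so that only real-valued functions have
  to be inverted.\<close>

lemma smooth_right_inverse:
  fixes A :: "'a::fin_dim_vector \<Rightarrow> 'e::fin_dim_vector \<Rightarrow> 'v::fin_dim_vector"
  assumes "open S" "x \<in> S" and lin: "\<And>y. y \<in> S \<Longrightarrow> linear (A y)" and sm: "\<And>v. smooth_on S (\<lambda>y. A y v)"
    and "surj (A x)"
  shows "\<exists>T Y. open T \<and> x \<in> T \<and> T \<subseteq> S \<and>
    (\<forall>b\<in>model_basis. smooth_on T (Y b) \<and> (\<forall>y\<in>T. A y (Y b y) = b))"
proof -
  have "\<exists>T Y. open T \<and> x \<in> T \<and> T \<subseteq> S \<and> (\<forall>b\<in>B. smooth_on T (Y b)) \<and>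
      (\<forall>y\<in>T. \<forall>b\<in>B. \<forall>c\<in>B. coord c (A y (Y b y)) = (if c = b then 1 else 0))"
    if "B \<subseteq> model_basis" for B
    using finite_subset[OF that model_basis(1)] that
  proof (induction rule: finite_induct)
    case empty
    then show ?case
      using assms(1,2) by auto
  next
    case (insert b0 B)
    then obtain T Y where T: "open T" "x \<in> T" "T \<subseteq> S" and Y: "\<And>b. b \<in> B \<Longrightarrow> smooth_on T (Y b)"
      and dual: "\<And>y b c. y \<in> T \<Longrightarrow> b \<in> B \<Longrightarrow> c \<in> B \<Longrightarrow> coord c (A y (Y b y)) = (if c = b then 1 else 0)"
      by (metis insert_subset)
    have B: "finite B" "b0 \<notin> B" "b0 \<in> model_basis" "\<And>b. b \<in> B \<Longrightarrow> b \<in> model_basis"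
      using insert.hyps insert.prems by auto
    have linA: "linear (A y)" if "y \<in> T" for y
      using that lin T by auto
    have smA: "smooth_on T (\<lambda>y. A y (\<zeta> y))" if "smooth_on T \<zeta>" for \<zeta>
      by (rule smooth_on_family_apply[OF T(1) linA smooth_on_subset[OF sm T(3)] that])
    have smc: "smooth_on T (\<lambda>y. coord b (A y (\<zeta> y)))" if "smooth_on T \<zeta>" for \<zeta> b
      by (rule smooth_on_linear_compose[OF T(1) linear_coord smA[OF that]])
    obtain v where v: "A x v = b0"
      using \<open>surj (A x)\<close> by (metis surjD)
    \<comment> \<open>Removing the components in \<open>B\<close> makes all
      \<open>B\<close>-coordinates of \<open>A y (Z y)\<close> vanish. At \<open>x\<close> nothing
      is removed, because \<open>A x v = b0\<close> has no such components; so the remaining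
      coordinate \<open>a\<close> is 1 at \<open>x\<close> and stays nonzero nearby.\<close>
    define Z where "Z y = v - (\<Sum>b\<in>B. coord b (A y v) *\<^sub>R Y b y)" for y
    define a where "a y = coord b0 (A y (Z y))" for y
    have Z: "smooth_on T Z"
      unfolding Z_def
      by (intro smooth_on_diff smooth_on_sum smooth_on_scaleR smooth_on_const smc Y T(1))
    have a: "smooth_on T a"
      unfolding a_def by (rule smc[OF Z])
    have AZ: "coord c (A y (Z y)) = 0" if "y \<in> T" "c \<in> B" for y c
    proof -
      have "coord c (A y (Z y)) = coord c (A y v) - (\<Sum>b\<in>B. coord b (A y v) * coord c (A y (Y b y)))"
        unfolding Z_def
        by (simp add: linear_diff[OF linA[OF that(1)]] linear_sum[OF linA[OF that(1)]] linear_scale[OF linA[OF that(1)]]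
            linear_diff[OF linear_coord] linear_sum[OF linear_coord] linear_scale[OF linear_coord])
      also have "\<dots> = 0"
        using that B(1) by (simp add: dual if_distrib[of "(*) _"] cong: if_cong)
      finally show ?thesis .
    qed
    have "Z x = v"
      unfolding Z_def v by (simp add: sum.neutral coord_basis B(2-4))
    then have "a x = 1"
      by (simp add: a_def v coord_basis B(3))
    define T' where "T' = T \<inter> a -` (- {0})"
    have T': "open T'" "x \<in> T'" "T' \<subseteq> T" "\<And>y. y \<in> T' \<Longrightarrow> a y \<noteq> 0"
      unfolding T'_def using T \<open>a x = 1\<close> smooth_on_continuous[OF a]
      by (auto intro!: continuous_open_preimage)
    \<comment> \<open>\<open>Z\<close> is normalised to the dual field of \<open>b0\<close>, and the
      earlier fields lose their \<open>b0\<close>-coordinate without a change in the others.\<close>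
    define Y0 where "Y0 y = inverse (a y) *\<^sub>R Z y" for y
    define Y' where "Y' b y = (if b = b0 then Y0 y else Y b y - coord b0 (A y (Y b y)) *\<^sub>R Y0 y)" for b y
    have Y0: "smooth_on T' Y0"
      unfolding Y0_def
      by (intro smooth_on_scaleR smooth_on_inverse T' smooth_on_subset[OF a] smooth_on_subset[OF Z])
    have "smooth_on T' (Y' b)" if "b \<in> insert b0 B" for b
    proof (cases "b = b0")
      case True
      then show ?thesis
        using Y0 by (simp add: Y'_def[abs_def])
    next
      case False
      then have b: "smooth_on T (Y b)"
        using that Y by auto
      have "smooth_on T' (\<lambda>y. Y b y - coord b0 (A y (Y b y)) *\<^sub>R Y0 y)"
        by (intro smooth_on_diff smooth_on_scaleR T'(1) Y0 smooth_on_subset[OF b T'(3)]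
            smooth_on_subset[OF smc[OF b] T'(3)])
      then show ?thesis
        using False by (simp add: Y'_def[abs_def])
    qed
    moreover have "coord c (A y (Y' b y)) = (if c = b then 1 else 0)"
      if "y \<in> T'" "b \<in> insert b0 B" "c \<in> insert b0 B" for y b c
    proof -
      have y: "y \<in> T"
        using that T' by auto
      note lins = linear_diff[OF linA[OF y]] linear_scale[OF linA[OF y]]
        linear_diff[OF linear_coord] linear_scale[OF linear_coord]
      have A0: "coord c (A y (Y0 y)) = (if c = b0 then 1 else 0)"
        using that(3) T'(4)[OF that(1)] AZ[OF y] by (auto simp: Y0_def lins a_def)
      show ?thesis
        using that(2,3) B(2) dual[OF y] A0 by (auto simp: Y'_def lins)
    qed
    ultimately show ?case
      using T' T by (intro exI[of _ T'] exI[of _ Y']) auto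
  qed
  from this[OF order_refl] obtain T Y where T: "open T" "x \<in> T" "T \<subseteq> S"
    and Y: "\<forall>b\<in>model_basis. smooth_on T (Y b)"
    and dual: "\<forall>y\<in>T. \<forall>b\<in>model_basis. \<forall>c\<in>model_basis. coord c (A y (Y b y)) = (if c = b then 1 else 0)"
    by blast
  have "A y (Y b y) = b" if "y \<in> T" "b \<in> model_basis" for y b
    by (rule coord_eqI) (use that in \<open>auto simp: dual coord_basis\<close>)
  with T Y show ?thesis
    by blast
qed

lemma smooth_along_cong:
  assumes "smooth_atlas M" "open A" "smooth_along M A s \<zeta>"
    and eq: "\<And>x. x \<in> A \<Longrightarrow> s' x = s x" "\<And>x. x \<in> A \<Longrightarrow> \<zeta>' x = \<zeta> x"
  shows "smooth_along M A s' \<zeta>'"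
  unfolding smooth_along_def
proof (intro conjI ballI)
  note s = smooth_along_map[OF assms(3)]
  show "smooth_map_on vector_manifold M A s'"
    by (rule smooth_map_on_cong[OF smooth_atlas_vector_manifold assms(1,2) s eq(1)])
  fix c assume c: "c \<in> charts M"
  have "A \<inter> s' -` fst c = A \<inter> s -` fst c"
    using eq by auto
  moreover have "smooth_on (A \<inter> s -` fst c) (\<lambda>x. tangent_map M vector_manifold (snd c) (s' x) (\<zeta>' x))"
    using smooth_alongD[OF assms(3) c]
    by (subst smooth_on_cong[OF smooth_map_on_preimage_chart[OF assms(1) s assms(2) c],
          of _ "\<lambda>x. tangent_map M vector_manifold (snd c) (s x) (\<zeta> x)"]) (auto simp: eq)
  ultimately show "smooth_on (A \<inter> s' -` fst c) (\<lambda>x. tangent_map M vector_manifold (snd c) (s' x) (\<zeta>' x))"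
    by simp
qed

lemma smooth_field_from_chart:
  assumes "smooth_atlas M" "c \<in> charts M" "open W" "W \<subseteq> fst c" "open T" "snd c ` W \<subseteq> T" "smooth_on T \<xi>"
    and T: "T \<subseteq> snd c ` fst c"
  shows "smooth_vector_field_on M W (\<lambda>q. tangent_map vector_manifold M (chart_inv c) (snd c q) (\<xi> (snd c q)))"
proof (rule smooth_vector_field_onI[OF assms(1,3)])
  interpret M: atlas M by standard (rule assms)
  note vm = smooth_atlas_vector_manifold
  fix c' assume c': "c' \<in> charts M"
  let ?A = "snd c' ` (fst c' \<inter> W)"
  let ?s = "\<lambda>x. snd c (chart_inv c' x)"
  have op: "open ?A"
    by (intro M.chart_image_open c' open_Int M.chart_open(1) assms(3) Int_lower1)
  have s: "smooth_on ?A ?s"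
    by (rule smooth_on_subset[OF M.chart_transition[OF c' assms(2)]]) (use assms(4) in auto)
  have sub: "?s ` ?A \<subseteq> T"
    using assms(6) by (auto simp: M.chart_inv_chart[OF c'])
  have "smooth_along vector_manifold ?A ?s (\<lambda>x. \<xi> (?s x))"
    unfolding smooth_along_vector_manifold[OF op]
    by (intro conjI s smooth_on_compose[OF op assms(5) sub s assms(7)])
  then have "smooth_along M ?A (\<lambda>x. chart_inv c (?s x)) (\<lambda>x. tangent_map vector_manifold M (chart_inv c) (?s x) (\<xi> (?s x)))"
    by (rule smooth_along_tangent_map[OF vm assms(1) op M.chart_open(2)[OF assms(2)] smooth_map_on_chart_inv[OF assms(1,2)]])
      (use sub T in auto)
  then show "smooth_along M ?A (chart_inv c') (\<lambda>x. tangent_map vector_manifold M (chart_inv c) (?s x) (\<xi> (?s x)))"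
    by (rule smooth_along_cong[OF assms(1) op])
      (use assms(4) in \<open>auto simp: M.chart_inv_chart[OF c'] M.chart_inv_chart[OF assms(2)] subset_eq\<close>)
qed

text \<open>In a chart, the dual fields \<open>Y b\<close> are combined with the coordinates of
  \<open>f\<close> as coefficients. The resulting field is carried back to the manifold.\<close>

lemma one_form_local_section:
  assumes "smooth_atlas M" "smooth_one_form M \<theta>" "surj (\<theta> p)"
    and W: "open W" "p \<in> W" and f: "smooth_map_on M vector_manifold W f"
  shows "\<exists>W' X. open W' \<and> p \<in> W' \<and> W' \<subseteq> W \<and> smooth_vector_field_on M W' X \<and> (\<forall>q\<in>W'. \<theta> q (X q) = f q)"
proof -
  interpret M: atlas M by standard (rule assms)
  note vm = smooth_atlas_vector_manifold
  define c where "c = chart_at M p"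
  have c: "c \<in> charts M" "p \<in> fst c"
    by (simp_all add: c_def M.chart_at)
  let ?A = "pullback vector_manifold M (chart_inv c) \<theta>"
  let ?S = "snd c ` (fst c \<inter> W)"
  have op: "open ?S"
    by (intro M.chart_image_open c open_Int M.chart_open(1) W(1) Int_lower1)
  have x: "snd c p \<in> ?S"
    using c W by auto
  have lin: "linear (?A y)" if "y \<in> ?S" for y
    by (rule linear_pullback_chart_inv[OF assms(1) c(1) _ assms(2)]) (use that in auto)
  have "smooth_on (snd c ` fst c) (\<lambda>y. ?A y v)" for v
    using assms(2) c by (auto simp: smooth_one_form_def)
  then have sm: "smooth_on ?S (\<lambda>y. ?A y v)" for v
    by (rule smooth_on_subset) auto
  have A: "?A (snd c q) (tangent_map M vector_manifold (snd c) q v) = \<theta> q v" if "q \<in> fst c" for q v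
    using that by (simp add: pullback_def tangent_map_chart[OF assms(1) c(1)] M.chart_inv_chart[OF c(1)])
  have "surj (?A (snd c p))"
    unfolding surj_def
  proof
    fix w
    obtain v where "w = \<theta> p v"
      using assms(3) by (rule surjE)
    then show "\<exists>u. w = ?A (snd c p) u"
      by (metis A[OF c(2)])
  qed
  from smooth_right_inverse[OF op x lin sm this] obtain T Y where T: "open T" "snd c p \<in> T" "T \<subseteq> ?S"
    and Y: "\<And>b. b \<in> model_basis \<Longrightarrow> smooth_on T (Y b)"
      "\<And>b y. b \<in> model_basis \<Longrightarrow> y \<in> T \<Longrightarrow> ?A y (Y b y) = b"
    by blast
  have "smooth_on ?S (\<lambda>x. f (chart_inv c x))"
    using smooth_map_onD[OF f c(1), of "(UNIV, id)"] by simp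
  then have f': "smooth_on T (\<lambda>x. f (chart_inv c x))"
    by (rule smooth_on_subset[OF _ T(3)])
  define \<xi> where "\<xi> x = (\<Sum>b\<in>model_basis. coord b (f (chart_inv c x)) *\<^sub>R Y b x)" for x
  have \<xi>: "smooth_on T \<xi>"
    unfolding \<xi>_def
    by (intro smooth_on_sum smooth_on_scaleR T(1) Y smooth_on_linear_compose[OF T(1) linear_coord f'])
  have A\<xi>: "?A y (\<xi> y) = f (chart_inv c y)" if "y \<in> T" for y
  proof -
    have ly: "linear (?A y)"
      using that T(3) lin by auto
    show ?thesis
      unfolding \<xi>_def linear_sum[OF ly] linear_scale[OF ly] using that by (simp add: Y(2) sum_coord)
  qed
  define W' where "W' = fst c \<inter> snd c -` T"
  have W': "open W'" "p \<in> W'" "W' \<subseteq> W" "W' \<subseteq> fst c" "snd c ` W' \<subseteq> T"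
  proof -
    show "open W'"
      unfolding W'_def by (rule continuous_open_preimage[OF M.chart_continuous(1)[OF c(1)] M.chart_open(1)[OF c(1)] T(1)])
    show "W' \<subseteq> W"
    proof
      fix q assume q: "q \<in> W'"
      then have "snd c q \<in> ?S" using T(3) by (auto simp: W'_def)
      then obtain q' where "q' \<in> fst c" "q' \<in> W" "snd c q = snd c q'" by auto
      then show "q \<in> W"
        using q M.chart_inv_chart[OF c(1)] by (metis IntD1 W'_def)
    qed
  qed (use c T in \<open>auto simp: W'_def\<close>)
  let ?X = "\<lambda>q. tangent_map vector_manifold M (chart_inv c) (snd c q) (\<xi> (snd c q))"
  have "smooth_vector_field_on M W' ?X"
    by (rule smooth_field_from_chart[OF assms(1) c(1) W'(1,4) T(1) W'(5) \<xi>]) (use T(3) in auto)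
  moreover have "\<theta> q (?X q) = f q" if "q \<in> W'" for q
    using A\<xi>[of "snd c q"] that W' by (auto simp: pullback_def M.chart_inv_chart[OF c(1)] subset_eq)
  ultimately show ?thesis
    using W' by blast
qed

section \<open>Actions of Lie groups\<close>

text \<open>Instantiated twice: by the action on \<open>P\<close> and by the multiplication of
  \<open>G\<close>. For the latter the orbit maps \<open>\<lambda>g. act g p\<close> are the right
  translations.\<close>

locale smooth_action =
  fixes G :: "('g::topological_space, 'l::fin_dim_vector) manifold"
    and P :: "('p::topological_space, 'e::fin_dim_vector) manifold"
    and act :: "'g \<Rightarrow> 'p \<Rightarrow> 'p"
  assumes atlas_G: "smooth_atlas G" and atlas_P: "smooth_atlas P"
    and smooth_act: "smooth_map (prod_manifold G P) P (\<lambda>(g, p). act g p)"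
begin

lemma smooth_orbit_Pair: "smooth_map G (prod_manifold G P) (\<lambda>g. (g, p))"
  by (intro smooth_map_on_Pair smooth_map_on_id smooth_map_on_const atlas_G atlas_P open_UNIV)

lemma smooth_translation_Pair: "smooth_map P (prod_manifold G P) (\<lambda>p. (g, p))"
  by (intro smooth_map_on_Pair smooth_map_on_id smooth_map_on_const atlas_G atlas_P open_UNIV)

lemma smooth_orbit: "smooth_map G P (\<lambda>g. act g p)"
  using smooth_map_on_compose[OF atlas_G smooth_atlas_prod[OF atlas_G atlas_P] atlas_P open_UNIV open_UNIV
      smooth_orbit_Pair smooth_act] by simp

lemma smooth_translation: "smooth_map P P (act g)"
  using smooth_map_on_compose[OF atlas_P smooth_atlas_prod[OF atlas_G atlas_P] atlas_P open_UNIV open_UNIV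
      smooth_translation_Pair smooth_act] by simp

lemma tangent_act_left:
  "tangent_map (prod_manifold G P) P (\<lambda>(g, p). act g p) (g, p) (\<alpha>, 0) = tangent_map G P (\<lambda>g. act g p) g \<alpha>"
  using tangent_map_compose[OF atlas_G smooth_atlas_prod[OF atlas_G atlas_P] atlas_P open_UNIV open_UNIV
      smooth_orbit_Pair smooth_act, of g p \<alpha>]
    tangent_map_Pair[OF atlas_G atlas_G atlas_P open_UNIV smooth_map_on_id[OF atlas_G open_UNIV]
      smooth_map_on_const[OF atlas_G atlas_P open_UNIV], of g p \<alpha>]
  by (simp add: tangent_map_id[OF atlas_G] tangent_map_const[OF atlas_G])

lemma tangent_act_right:
  "tangent_map (prod_manifold G P) P (\<lambda>(g, p). act g p) (g, p) (0, v) = tangent_map P P (act g) p v"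
  using tangent_map_compose[OF atlas_P smooth_atlas_prod[OF atlas_G atlas_P] atlas_P open_UNIV open_UNIV
      smooth_translation_Pair smooth_act, of p g v]
    tangent_map_Pair[OF atlas_P atlas_G atlas_P open_UNIV smooth_map_on_const[OF atlas_P atlas_G open_UNIV]
      smooth_map_on_id[OF atlas_P open_UNIV], of p g v]
  by (simp add: tangent_map_id[OF atlas_P] tangent_map_const[OF atlas_P])

lemma tangent_act:
  "tangent_map (prod_manifold G P) P (\<lambda>(g, p). act g p) (g, p) (\<alpha>, v) =
    tangent_map G P (\<lambda>g. act g p) g \<alpha> + tangent_map P P (act g) p v"
  using linear_add[OF linear_tangent_map[OF smooth_atlas_prod[OF atlas_G atlas_P] atlas_P open_UNIV smooth_act UNIV_I],
      of "(g, p)" "(\<alpha>, 0)" "(0, v)"]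
  by (simp add: tangent_act_left tangent_act_right)

lemma linear_tangent_orbit: "linear (tangent_map G P (\<lambda>g. act g p) g)"
  by (rule linear_tangent_map[OF atlas_G atlas_P open_UNIV smooth_orbit UNIV_I])

lemma linear_tangent_translation: "linear (tangent_map P P (act g) p)"
  by (rule linear_tangent_map[OF atlas_P atlas_P open_UNIV smooth_translation UNIV_I])

lemma inf_action_eq: "inf_action G one P act \<alpha> p = tangent_map G P (\<lambda>g. act g p) one \<alpha>"
  by (simp add: inf_action_def tangent_act_left)

text \<open>The vectors \<open>(\<alpha>, 0)\<close> and \<open>(0, v)\<close> isolate the two
  conditions, and linearity recombines them. For the multiplication of \<open>G\<close> and
  \<open>\<theta> = \<omega>\<close>, the first condition is invariance of \<open>\<omega>\<close>
  under right translations.\<close>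

lemma multiplicative_over_iff:
  assumes "\<And>g. linear (\<omega> g)" "\<And>p. linear (\<theta> p)" "\<And>g. linear (\<rho> g)"
  shows "multiplicative_over G \<rho> \<omega> P act \<theta> \<longleftrightarrow>
    (\<forall>g p \<alpha>. \<theta> (act g p) (tangent_map G P (\<lambda>g. act g p) g \<alpha>) = \<omega> g \<alpha>) \<and> equivariant_form P act \<rho> \<theta>"
    (is "_ \<longleftrightarrow> ?orb \<and> _")
proof -
  have "multiplicative_over G \<rho> \<omega> P act \<theta> \<longleftrightarrow>
      (\<forall>g p \<alpha> v. \<theta> (act g p) (tangent_map G P (\<lambda>g. act g p) g \<alpha>) + \<theta> (act g p) (tangent_map P P (act g) p v) =
        \<omega> g \<alpha> + \<rho> g (\<theta> p v))" (is "_ \<longleftrightarrow> ?sum")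
    by (simp add: multiplicative_over_def pullback_def split_paired_all tangent_act linear_add[OF assms(2)]
        tangent_map_fst[OF atlas_G atlas_P] tangent_map_snd[OF atlas_G atlas_P])
  also have "?sum \<longleftrightarrow> ?orb \<and> equivariant_form P act \<rho> \<theta>"
  proof
    assume sum: ?sum
    have ?orb
    proof (intro allI)
      show "\<theta> (act g p) (tangent_map G P (\<lambda>g. act g p) g \<alpha>) = \<omega> g \<alpha>" for g p \<alpha>
        using sum[rule_format, of g p \<alpha> 0]
        by (simp add: linear_0[OF linear_tangent_translation] linear_0[OF assms(2)] linear_0[OF assms(3)])
    qed
    moreover have "equivariant_form P act \<rho> \<theta>"
      unfolding equivariant_form_def
    proof (intro allI)
      show "\<theta> (act g p) (tangent_map P P (act g) p v) = \<rho> g (\<theta> p v)" for g p v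
        using sum[rule_format, of g p 0 v]
        by (simp add: linear_0[OF linear_tangent_orbit] linear_0[OF assms(1)] linear_0[OF assms(2)])
    qed
    ultimately show "?orb \<and> equivariant_form P act \<rho> \<theta>" ..
  qed (simp add: equivariant_form_def)
  finally show ?thesis .
qed

text \<open>The field is the pushforward by the action map of the constant pair
  \<open>(\<alpha>, 0)\<close> along \<open>p \<mapsto> (one, p)\<close>.\<close>

lemma smooth_field_inf_action:
  assumes "\<And>p. act one p = p"
  shows "smooth_vector_field_on P UNIV (inf_action G one P act \<alpha>)"
proof (rule smooth_vector_field_onI[OF atlas_P open_UNIV])
  interpret P: atlas P by standard (rule atlas_P)
  note vm = smooth_atlas_vector_manifold and pr = smooth_atlas_prod[OF atlas_G atlas_P]
  fix c assume c: "c \<in> charts P"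
  let ?A = "snd c ` (fst c \<inter> UNIV)"
  have op: "open ?A"
    using P.chart_open[OF c] by simp
  have "smooth_along (prod_manifold G P) ?A (\<lambda>x. (one, chart_inv c x)) (\<lambda>x. (\<alpha>, 0))"
    using smooth_map_on_chart_inv[OF atlas_P c]
    by (intro smooth_along_Pair[OF atlas_G atlas_P op smooth_along_const[OF atlas_G op] smooth_along_zero[OF atlas_P op]]) simp
  then have "smooth_along P ?A (\<lambda>x. case (one, chart_inv c x) of (g, p) \<Rightarrow> act g p)
      (\<lambda>x. tangent_map (prod_manifold G P) P (\<lambda>(g, p). act g p) (one, chart_inv c x) (\<alpha>, 0))"
    by (rule smooth_along_tangent_map[OF pr atlas_P op open_UNIV smooth_act]) simp
  then show "smooth_along P ?A (chart_inv c) (\<lambda>x. inf_action G one P act \<alpha> (chart_inv c x))"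
    by (simp add: assms inf_action_def)
qed

end

section \<open>Principal bundles\<close>

locale principal_lie_bundle =
  fixes G :: "('g::{t2_space, second_countable_topology}, 'l::fin_dim_vector) manifold"
    and mul :: "'g \<Rightarrow> 'g \<Rightarrow> 'g" and one :: 'g and ginv :: "'g \<Rightarrow> 'g"
    and P :: "('p::{t2_space, second_countable_topology}, 'e::fin_dim_vector) manifold"
    and act :: "'g \<Rightarrow> 'p \<Rightarrow> 'p"
    and M :: "('m::{t2_space, second_countable_topology}, 'f::fin_dim_vector) manifold"
    and \<pi> :: "'p \<Rightarrow> 'm"
  assumes lie: "lie_group G mul one ginv" and principal: "principal_bundle G mul one P act M \<pi>"
begin

sublocale smooth_action G P act
  using lie principal
  by unfold_locales (auto simp: lie_group_def principal_bundle_def intro: smooth_manifold_imp_atlas)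

sublocale mult: smooth_action G G mul
  using lie by unfold_locales (auto simp: lie_group_def intro: smooth_manifold_imp_atlas)

sublocale grp: group mul one ginv
  using lie by (simp add: lie_group_def)

lemma atlas_M: "smooth_atlas M"
  using principal by (auto simp: principal_bundle_def intro: smooth_manifold_imp_atlas)

lemma smooth_pi: "smooth_map P M \<pi>"
  using principal by (simp add: principal_bundle_def)

lemma act_one: "act one p = p" and act_mul: "act (mul g h) p = act g (act h p)" and pi_act: "\<pi> (act g p) = \<pi> p"
  using principal by (auto simp: principal_bundle_def)

section \<open>Translations and orbit maps\<close>

lemma tangent_translation_inverse:
  "tangent_map P P (act g) (act (ginv g) p) (tangent_map P P (act (ginv g)) p v) = v"
proof -
  have "act g (act (ginv g) q) = q" for q
    by (metis act_mul act_one grp.right_inverse)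
  then show ?thesis
    using tangent_map_compose[OF atlas_P atlas_P atlas_P open_UNIV open_UNIV smooth_translation[of "ginv g"] smooth_translation[of g],
        of p v]
    by (simp add: tangent_map_id[OF atlas_P])
qed

lemma tangent_right_translation_inverse:
  "tangent_map G G (\<lambda>h. mul h g) (mul h (ginv g)) (tangent_map G G (\<lambda>h. mul h (ginv g)) h \<alpha>) = \<alpha>"
proof -
  have "mul (mul h (ginv g)) g = h" for h
    by (simp add: grp.assoc)
  then show ?thesis
    using tangent_map_compose[OF atlas_G atlas_G atlas_G open_UNIV open_UNIV mult.smooth_orbit[of "ginv g"] mult.smooth_orbit[of g],
        of h \<alpha>]
    by (simp add: tangent_map_id[OF atlas_G])
qed

text \<open>The orbit map of \<open>g \<cdot> p\<close> is the orbit map of \<open>p\<close> after the right translation by \<open>g\<close>.\<close>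

lemma tangent_orbit_act:
  "tangent_map G P (\<lambda>h. act h (act g p)) h \<alpha> =
    tangent_map G P (\<lambda>h. act h p) (mul h g) (tangent_map G G (\<lambda>h. mul h g) h \<alpha>)"
  using tangent_map_compose[OF atlas_G atlas_G atlas_P open_UNIV open_UNIV mult.smooth_orbit[of g] smooth_orbit[of p],
      of h \<alpha>]
  by (simp add: act_mul)

text \<open>Moving the base point from \<open>p\<close> to \<open>act g p\<close> moves the foot
  point \<open>g\<close> to the unit by right translation, so every velocity of an orbit map is an
  infinitesimal action at its end point.\<close>

lemma tangent_orbit_eq_inf_action:
  "tangent_map G P (\<lambda>h. act h p) g \<alpha> =
    inf_action G one P act (tangent_map G G (\<lambda>h. mul h (ginv g)) g \<alpha>) (act g p)"
  using tangent_orbit_act[of "ginv g" "act g p" g \<alpha>]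
  by (simp add: inf_action_eq grp.right_inverse act_one flip: act_mul)

text \<open>A local trivialisation over \<open>U\<close>, split into its group component \<open>F\<close> and the section \<open>s\<close> of \<open>\<pi>\<close>
  on which \<open>F\<close> is the unit. The last clause is the derivative of \<open>q = F q \<cdot> s (\<pi> q)\<close> on vertical vectors; it is
  stated separately because \<open>s\<close> is not recorded to be smooth.\<close>

definition trivialised_over :: "'m set \<Rightarrow> ('p \<Rightarrow> 'g) \<Rightarrow> ('m \<Rightarrow> 'p) \<Rightarrow> bool" where
  "trivialised_over U F s \<longleftrightarrow> open U \<and> smooth_map_on P G (\<pi> -` U) F \<and>
     (\<forall>y\<in>U. \<pi> (s y) = y \<and> (\<forall>g. F (act g (s y)) = g)) \<and>
     (\<forall>q. \<pi> q \<in> U \<longrightarrow> act (F q) (s (\<pi> q)) = q \<and>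
        (\<forall>w. tangent_map P M \<pi> q w = 0 \<longrightarrow>
           tangent_map G P (\<lambda>g. act g (s (\<pi> q))) (F q) (tangent_map P G F q w) = w))"

lemma open_pi_vimage: "open U \<Longrightarrow> open (\<pi> -` U)"
  using continuous_open_preimage[OF smooth_map_on_continuous[OF smooth_pi] open_UNIV] by simp

lemma trivialised_overD:
  assumes "trivialised_over U F s"
  shows "open (\<pi> -` U)" "smooth_map_on P G (\<pi> -` U) F"
    "\<And>y. y \<in> U \<Longrightarrow> \<pi> (s y) = y" "\<And>q. \<pi> q \<in> U \<Longrightarrow> act (F q) (s (\<pi> q)) = q"
    "\<And>g y. y \<in> U \<Longrightarrow> F (act g (s y)) = g"
    "\<And>q w. \<pi> q \<in> U \<Longrightarrow> tangent_map P M \<pi> q w = 0 \<Longrightarrow>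
      tangent_map G P (\<lambda>g. act g (s (\<pi> q))) (F q) (tangent_map P G F q w) = w"
  using assms by (simp_all add: trivialised_over_def open_pi_vimage)

text \<open>With \<open>\<tau>\<close> and \<open>\<sigma>\<close> the two directions of a
  trivialisation, \<open>F\<close> is the first component of \<open>\<tau>\<close> and
  \<open>s\<close> is \<open>\<sigma>\<close> on the unit slice.\<close>

lemma local_trivialisation:
  obtains U F s where "x \<in> U" "trivialised_over U F s"
proof -
  obtain U \<tau> \<sigma> where U: "open U" "x \<in> U"
    and \<tau>: "smooth_map_on P (prod_manifold G M) (\<pi> -` U) \<tau>"
    and \<sigma>: "smooth_map_on (prod_manifold G M) P (UNIV \<times> U) \<sigma>"
    and inv: "\<forall>p \<in> \<pi> -` U. \<tau> p \<in> UNIV \<times> U \<and> \<sigma> (\<tau> p) = p"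
      "\<forall>z \<in> UNIV \<times> U. \<sigma> z \<in> \<pi> -` U \<and> \<tau> (\<sigma> z) = z"
      "\<forall>p \<in> \<pi> -` U. snd (\<tau> p) = \<pi> p \<and> (\<forall>g. \<tau> (act g p) = (mul g (fst (\<tau> p)), \<pi> p))"
    using principal[unfolded principal_bundle_def, THEN conjunct2, THEN conjunct2, THEN conjunct2,
        THEN conjunct2, THEN conjunct2, THEN conjunct2, THEN conjunct2, THEN spec, of x]
    by (elim exE conjE)
  note \<sigma>\<tau> = bspec[OF inv(1)] and \<tau>\<sigma> = bspec[OF inv(2)] and equiv = bspec[OF inv(3)]
  define F where "F p = fst (\<tau> p)" for p
  define s where "s y = \<sigma> (one, y)" for y
  note pr = smooth_atlas_prod[OF atlas_G atlas_M]
  have opS: "open (\<pi> -` U)"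
    by (rule open_pi_vimage[OF U(1)])
  have opU: "open (UNIV \<times> U :: ('g \<times> 'm) set)"
    by (rule open_Times[OF open_UNIV U(1)])
  have F: "smooth_map_on P G (\<pi> -` U) F"
    unfolding F_def
    by (rule smooth_map_on_compose[OF atlas_P pr atlas_G opS open_UNIV \<tau> smooth_map_on_fst[OF atlas_G atlas_M open_UNIV]]) simp
  have \<tau>_eq: "\<tau> q = (F q, \<pi> q)" if "\<pi> q \<in> U" for q
    using equiv[of q] that by (simp add: F_def prod_eq_iff)
  have pi_s: "\<pi> (s y) = y" if "y \<in> U" for y
    using \<tau>\<sigma>[of "(one, y)"] equiv[of "s y"] that by (auto simp: s_def)
  have F_act: "F (act g (s y)) = g" if "y \<in> U" for g y
  proof -
    have "\<tau> (s y) = (one, y)" "s y \<in> \<pi> -` U"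
      using \<tau>\<sigma>[of "(one, y)"] that by (auto simp: s_def)
    then show ?thesis
      using equiv[of "s y"] by (simp add: F_def grp.right_neutral)
  qed
  \<comment> \<open>Equivariance is given for \<open>\<tau>\<close>; applying
    \<open>\<sigma>\<close> to the value of \<open>\<tau>\<close> at \<open>act g (s y)\<close>
    transfers it.\<close>
  have act_s: "act g (s y) = \<sigma> (g, y)" if "y \<in> U" for g y
    using \<sigma>\<tau>[of "act g (s y)"] that by (simp add: \<tau>_eq pi_act pi_s F_act)
  have act_F: "act (F q) (s (\<pi> q)) = q" if "\<pi> q \<in> U" for q
    using act_s[OF that] \<sigma>\<tau>[of q] that by (simp add: \<tau>_eq)
  have \<tau>_in: "\<tau> ` (\<pi> -` U) \<subseteq> UNIV \<times> U"
    using \<sigma>\<tau> by blast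
  \<comment> \<open>The identity \<open>\<sigma> (\<tau> q) = q\<close> is differentiated. On a
    vertical vector the second component of the derivative of \<open>\<tau>\<close> vanishes,
    leaving a velocity of the slice \<open>g \<mapsto> (g, \<pi> q)\<close>, which
    \<open>\<sigma>\<close> maps to the orbit of \<open>s (\<pi> q)\<close>.\<close>
  have "tangent_map G P (\<lambda>g. act g (s (\<pi> q))) (F q) (tangent_map P G F q w) = w"
    if q: "\<pi> q \<in> U" and w: "tangent_map P M \<pi> q w = 0" for q w
  proof -
    have "w = tangent_map P P (\<lambda>q. q) q w"
      by (simp add: tangent_map_id[OF atlas_P])
    also have "tangent_map P P (\<lambda>q. q) q = tangent_map P P (\<lambda>q. \<sigma> (\<tau> q)) q"
      by (rule tangent_map_cong[OF atlas_P atlas_P opS])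
        (use q \<sigma>\<tau> \<tau>_eq in \<open>auto intro!: smooth_map_on_compose[OF atlas_P pr atlas_P opS opU \<tau> \<sigma> \<tau>_in]\<close>)
    also have "\<dots> w = tangent_map (prod_manifold G M) P \<sigma> (\<tau> q) (tangent_map P (prod_manifold G M) \<tau> q w)"
      by (rule tangent_map_compose[OF atlas_P pr atlas_P opS opU \<tau> \<sigma>]) (use q \<tau>_eq in auto)
    also have "tangent_map P (prod_manifold G M) \<tau> q = tangent_map P (prod_manifold G M) (\<lambda>q. (F q, \<pi> q)) q"
      by (rule tangent_map_cong[OF atlas_P pr opS])
        (use q \<tau>_eq in \<open>auto intro!: smooth_map_on_Pair[OF atlas_P atlas_G atlas_M opS F]
          smooth_map_on_subset[OF smooth_pi]\<close>)
    also have "\<dots> w = (tangent_map P G F q w, 0)"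
      using tangent_map_Pair[OF atlas_P atlas_G atlas_M opS F smooth_map_on_subset[OF smooth_pi], of q w] q w by simp
    also have "\<dots> = tangent_map G (prod_manifold G M) (\<lambda>g. (g, \<pi> q)) (F q) (tangent_map P G F q w)"
      using tangent_map_Pair[OF atlas_G atlas_G atlas_M open_UNIV smooth_map_on_id[OF atlas_G open_UNIV]
          smooth_map_on_const[OF atlas_G atlas_M open_UNIV]]
      by (simp add: tangent_map_id[OF atlas_G] tangent_map_const[OF atlas_G])
    also have "tangent_map (prod_manifold G M) P \<sigma> (\<tau> q) \<dots> =
        tangent_map G P (\<lambda>g. \<sigma> (g, \<pi> q)) (F q) (tangent_map P G F q w)"
      using tangent_map_compose[OF atlas_G pr atlas_P open_UNIV opU _ \<sigma>, of "\<lambda>g. (g, \<pi> q)" "F q"] q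
        smooth_map_on_Pair[OF atlas_G atlas_G atlas_M open_UNIV smooth_map_on_id[OF atlas_G open_UNIV]
          smooth_map_on_const[OF atlas_G atlas_M open_UNIV]]
      by (simp add: \<tau>_eq)
    finally show ?thesis
      by (simp add: act_s[OF q])
  qed
  then have "trivialised_over U F s"
    using U(1) F pi_s act_F F_act by (simp add: trivialised_over_def)
  with U(2) show ?thesis
    by (rule that)
qed

section \<open>Vertical vectors, involutivity and constant rank\<close>

text \<open>By the last clause of \<open>trivialised_over\<close>, \<open>w\<close> is a velocity of
  the orbit map of \<open>s (\<pi> q)\<close>; right translation to the unit produces
  \<open>\<alpha>\<close>.\<close>

lemma vertical_imp_inf_action:
  assumes "tangent_map P M \<pi> q w = 0"
  obtains \<alpha> where "inf_action G one P act \<alpha> q = w"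
proof -
  obtain U F s where U: "\<pi> q \<in> U" and triv: "trivialised_over U F s"
    by (rule local_trivialisation)
  note U' = trivialised_overD(1)[OF triv] and F = trivialised_overD(2)[OF triv]
    and s = trivialised_overD(3-5)[OF triv] and vF = trivialised_overD(6)[OF triv]
  have "inf_action G one P act (tangent_map G G (\<lambda>h. mul h (ginv (F q))) (F q) (tangent_map P G F q w)) q = w"
    using tangent_orbit_eq_inf_action[of "s (\<pi> q)" "F q" "tangent_map P G F q w"] vF[OF U assms]
    by (simp add: s(2)[OF U])
  then show ?thesis
    by (rule that)
qed

text \<open>Infinitesimal freeness: \<open>F\<close> is equivariant, so \<open>F\<close> after the
  orbit map of \<open>q\<close> is the right translation by \<open>F q\<close>, whose tangent map is
  invertible.\<close>

lemma inf_action_injective: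
  assumes "inf_action G one P act \<alpha> q = 0"
  shows "\<alpha> = 0"
proof -
  obtain U F s where U: "\<pi> q \<in> U" and triv: "trivialised_over U F s"
    by (rule local_trivialisation)
  note U' = trivialised_overD(1)[OF triv] and F = trivialised_overD(2)[OF triv]
    and s = trivialised_overD(3-5)[OF triv] and vF = trivialised_overD(6)[OF triv]
  have Fh: "F (act h q) = mul h (F q)" for h
    using s(2)[OF U] s(3)[OF U] by (metis act_mul)
  have "tangent_map G G (\<lambda>h. F (act h q)) one \<alpha> = tangent_map P G F (act one q) (tangent_map G P (\<lambda>h. act h q) one \<alpha>)"
    by (rule tangent_map_compose[OF atlas_G atlas_P atlas_G open_UNIV U' smooth_orbit F])
      (simp_all add: pi_act U)
  also have "\<dots> = 0"
    using assms linear_tangent_map[OF atlas_P atlas_G U' F, of "act one q"] U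
    by (simp add: inf_action_eq linear_0 pi_act)
  finally have "tangent_map G G (\<lambda>h. mul h (F q)) one \<alpha> = 0"
    by (simp add: Fh)
  moreover have "tangent_map G G (\<lambda>h. mul h (ginv (F q))) (mul one (F q)) (tangent_map G G (\<lambda>h. mul h (F q)) one \<alpha>) = \<alpha>"
    using tangent_right_translation_inverse[of "ginv (F q)" one \<alpha>] by simp
  ultimately show ?thesis
    using linear_0[OF mult.linear_tangent_orbit] by metis
qed

lemma linear_inf_action: "linear (\<lambda>\<alpha>. inf_action G one P act \<alpha> p)"
  unfolding inf_action_eq by (rule linear_tangent_orbit)

text \<open>Fields in \<open>ker \<theta>\<close> are vertical, hence related along each orbit map to fields in \<open>ker \<omega>\<close>.\<close>

lemma involutive_ker_form:
  assumes "involutive G (ker_form \<omega>)" and vert: "vertical P M \<pi> (ker_form \<theta>)"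
    and orb: "\<And>g p \<alpha>. \<theta> (act g p) (tangent_map G P (\<lambda>g. act g p) g \<alpha>) = \<omega> g \<alpha>"
  shows "involutive P (ker_form \<theta>)"
  unfolding involutive_def
proof (intro allI impI ballI)
  fix W X Y q
  assume "open W \<and> smooth_vector_field_on P W X \<and> smooth_vector_field_on P W Y \<and>
    (\<forall>p\<in>W. X p \<in> ker_form \<theta> p \<and> Y p \<in> ker_form \<theta> p)" and q: "q \<in> W"
  then have W: "open W" and X: "smooth_vector_field_on P W X" and Y: "smooth_vector_field_on P W Y"
    and kX: "\<And>p. p \<in> W \<Longrightarrow> \<theta> p (X p) = 0" and kY: "\<And>p. p \<in> W \<Longrightarrow> \<theta> p (Y p) = 0"
    by (auto simp: ker_form_def)
  obtain U F s where U: "\<pi> q \<in> U" and triv: "trivialised_over U F s"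
    by (rule local_trivialisation)
  note U' = trivialised_overD(1)[OF triv] and F = trivialised_overD(2)[OF triv]
    and s = trivialised_overD(3-5)[OF triv] and vF = trivialised_overD(6)[OF triv]
  \<comment> \<open>With this base point in the fibre of \<open>q\<close>, \<open>F\<close> is the
    inverse of the orbit map.\<close>
  define p where "p = s (\<pi> q)"
  define A where "A = (\<lambda>g. act g p) -` W"
  have pi_p: "\<pi> (act g p) = \<pi> q" for g
    by (simp add: pi_act p_def s(1) U)
  have F_p: "F (act g p) = g" for g
    by (simp add: p_def s(3) U)
  have q_eq: "act (F q) p = q"
    by (simp add: p_def s(2) U)
  have opA: "open A"
    unfolding A_def using continuous_open_preimage[OF smooth_map_on_continuous[OF smooth_orbit] open_UNIV W] by simp
  have orbit_A: "act g p \<in> W" if "g \<in> A" for g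
    using that by (simp add: A_def)
  \<comment> \<open>The inverse \<open>F\<close> pushes the values of a field along the orbit back
    to \<open>G\<close>. For vertical values, the orbit map pushes the result forward to the
    original field.\<close>
  define pull where "pull X g = tangent_map P G F (act g p) (X (act g p))" for X :: "'p \<Rightarrow> 'e" and g
  have smooth: "smooth_vector_field_on G A (pull Z)" if Z: "smooth_vector_field_on P W Z" for Z
  proof (rule smooth_vector_field_onI[OF atlas_G opA])
    interpret G: atlas G by standard (rule atlas_G)
    note vm = smooth_atlas_vector_manifold
    fix c assume c: "c \<in> charts G"
    let ?A = "snd c ` (fst c \<inter> A)"
    have op: "open ?A"
      by (intro G.chart_image_open c open_Int G.chart_open(1) opA Int_lower1)
    have s: "smooth_map_on vector_manifold P ?A (\<lambda>x. act (chart_inv c x) p)"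
      by (rule smooth_map_on_compose[OF vm atlas_G atlas_P op open_UNIV
            smooth_map_on_subset[OF smooth_map_on_chart_inv[OF atlas_G c]] smooth_orbit]) auto
    have "smooth_along P ?A (\<lambda>x. act (chart_inv c x) p) (\<lambda>x. Z (act (chart_inv c x) p))"
      by (rule smooth_along_field[OF atlas_P op W Z s]) (auto simp: G.chart_inv_chart[OF c] orbit_A)
    then have "smooth_along G ?A (\<lambda>x. F (act (chart_inv c x) p))
        (\<lambda>x. tangent_map P G F (act (chart_inv c x) p) (Z (act (chart_inv c x) p)))"
      by (rule smooth_along_tangent_map[OF atlas_P atlas_G op U' F]) (auto simp: pi_p U)
    then show "smooth_along G ?A (chart_inv c) (\<lambda>x. pull Z (chart_inv c x))"
      by (simp add: F_p pull_def)
  qed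
  have related: "Z (act g p) = tangent_map G P (\<lambda>g. act g p) g (pull Z g)"
    if "g \<in> A" "\<And>p. p \<in> W \<Longrightarrow> \<theta> p (Z p) = 0" for g Z
  proof -
    have "tangent_map P M \<pi> (act g p) (Z (act g p)) = 0"
      using vert that orbit_A by (auto simp: vertical_def ker_form_def)
    then show ?thesis
      using vF[of "act g p"] U by (simp add: pi_p F_p pull_def flip: p_def)
  qed
  have ker: "pull Z g \<in> ker_form \<omega> g" if "g \<in> A" "\<And>p. p \<in> W \<Longrightarrow> \<theta> p (Z p) = 0" for g Z
    using orb[of g p "pull Z g"] that(2)[OF orbit_A[OF that(1)]] by (simp add: ker_form_def flip: related[OF that])
  have g: "F q \<in> A"
    using q by (simp add: A_def q_eq)
  have "lie_bracket G (pull X) (pull Y) (F q) \<in> ker_form \<omega> (F q)"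
    using assms(1) opA smooth[OF X] smooth[OF Y] ker[OF _ kX] ker[OF _ kY] g
    unfolding involutive_def by blast
  moreover have "lie_bracket P X Y (act (F q) p) =
      tangent_map G P (\<lambda>g. act g p) (F q) (lie_bracket G (pull X) (pull Y) (F q))"
    by (rule lie_bracket_related[OF atlas_G atlas_P opA W smooth_map_on_subset[OF smooth_orbit] g orbit_A[OF g]
          smooth[OF X] smooth[OF Y] X Y related[OF _ kX] related[OF _ kY]]) auto
  ultimately show "lie_bracket P X Y q \<in> ker_form \<theta> q"
    using orb[of "F q" p] by (simp add: ker_form_def q_eq)
qed

text \<open>The fields \<open>\<alpha>\<^sup>\<dagger>\<close> with \<open>\<alpha>\<close> in a basis of \<open>ker l\<close> form a global frame of \<open>ker \<theta>\<close>.\<close>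

lemma smooth_distribution_ker_form:
  assumes "linear l" "\<And>p. linear (\<theta> p)" and vert: "vertical P M \<pi> (ker_form \<theta>)"
    and l: "\<And>\<alpha> p. \<theta> p (inf_action G one P act \<alpha> p) = l \<alpha>"
  shows "smooth_distribution P (ker_form \<theta>)"
proof -
  let ?\<iota> = "\<lambda>p \<alpha>. inf_action G one P act \<alpha> p"
  let ?K = "{\<alpha>. l \<alpha> = 0}"
  obtain B where B: "B \<subseteq> ?K" "independent B" "?K \<subseteq> span B"
    by (rule maximal_independent_subset)
  have K: "span B = ?K"
    using B span_minimal[OF B(1)] linear_subspace_kernel[OF assms(1)] by auto
  have fin: "finite B"
  proof -
    have "B \<subseteq> span (model_basis :: 'l set)"
      by (simp add: model_basis)
    then show ?thesis
      using independent_span_bound[OF model_basis(1) B(2)] by blast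
  qed
  obtain e where e: "bij_betw e {..<card B} B"
    using ex_bij_betw_nat_finite[OF fin] by (auto simp: atLeast0LessThan)
  have ker: "ker_form \<theta> p = ?\<iota> p ` ?K" for p
  proof
    show "ker_form \<theta> p \<subseteq> ?\<iota> p ` ?K"
    proof
      fix w assume w: "w \<in> ker_form \<theta> p"
      then have "tangent_map P M \<pi> p w = 0"
        using vert by (auto simp: vertical_def ker_form_def)
      then obtain \<alpha> where "?\<iota> p \<alpha> = w"
        by (rule vertical_imp_inf_action)
      then show "w \<in> ?\<iota> p ` ?K"
        using w l[of p \<alpha>] by (auto simp: ker_form_def)
    qed
  qed (auto simp: ker_form_def l)
  have frame: "span (?\<iota> p ` B) = ker_form \<theta> p" for p
    by (simp add: linear_span_image[OF linear_inf_action] K ker)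
  \<comment> \<open>Injectivity of the infinitesimal action makes the rank equal to
    \<open>card B\<close> at every point.\<close>
  have "independent (?\<iota> p ` B)" "card (?\<iota> p ` B) = card B" for p
  proof -
    have inj: "inj (?\<iota> p)"
      using linear_injective_0[OF linear_inf_action] inf_action_injective by blast
    then show "independent (?\<iota> p ` B)"
      by (rule linear_independent_injective_image[OF linear_inf_action B(2) inj_on_subset]) simp
    show "card (?\<iota> p ` B) = card B"
      by (rule card_image[OF inj_on_subset[OF inj]]) simp
  qed
  then have "dim (ker_form \<theta> p) = card B" for p
    using dim_eq_card[of "?\<iota> p ` B" "ker_form \<theta> p"] frame[of p]
    by (metis span_span)
  moreover have "subspace (ker_form \<theta> p)" for p
    using frame[of p] subspace_span by metis
  moreover have "span ((\<lambda>i. ?\<iota> p (e i)) ` {..<card B}) = ker_form \<theta> p" for p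
  proof -
    have "(\<lambda>i. ?\<iota> p (e i)) ` {..<card B} = ?\<iota> p ` e ` {..<card B}"
      by (simp add: image_image)
    also have "e ` {..<card B} = B"
      using e by (simp add: bij_betw_def)
    finally show ?thesis
      by (simp add: frame)
  qed
  moreover have "smooth_vector_field_on P UNIV (\<lambda>p. ?\<iota> p \<alpha>)" for \<alpha>
    by (rule smooth_field_inf_action) (rule act_one)
  ultimately show ?thesis
    unfolding smooth_distribution_def
    by (intro conjI allI exI[of _ "card B"] exI[of _ UNIV] exI[of _ "\<lambda>i p. ?\<iota> p (e i)"]) auto
qed

end

section \<open>The normal bundle of the kernel of a one-form\<close>

lemma normal_class_ker_form:
  assumes "linear (\<theta> p)"
  shows "normal_class (ker_form \<theta>) p v = {u. \<theta> p u = \<theta> p v}"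
proof -
  have "u \<in> (+) v ` {w. \<theta> p w = 0}" if "\<theta> p u = \<theta> p v" for u
    using that by (intro image_eqI[of _ _ "u - v"]) (auto simp: linear_diff[OF assms])
  then show ?thesis
    by (auto simp: normal_class_def ker_form_def linear_add[OF assms])
qed

lemma induced_normal_map_class:
  assumes "linear (\<theta> p)"
  shows "induced_normal_map \<theta> (p, normal_class (ker_form \<theta>) p v) = (p, \<theta> p v)"
proof -
  have "(THE y. \<forall>u\<in>normal_class (ker_form \<theta>) p v. \<theta> p u = y) = \<theta> p v"
    unfolding normal_class_ker_form[of \<theta> p, OF assms] by (rule the_equality) auto
  moreover have "(p, normal_class (ker_form \<theta>) p v) \<in> normal_bundle (ker_form \<theta>)"
    by (auto simp: normal_bundle_def)
  ultimately show ?thesis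
    by (simp add: induced_normal_map_def)
qed

lemma smooth_map_on_one_form_field:
  assumes "smooth_atlas M" "smooth_one_form M \<theta>" "open W" "smooth_vector_field_on M W X"
  shows "smooth_map_on M vector_manifold W (\<lambda>q. \<theta> q (X q))"
proof (rule smooth_map_onI[OF assms(1) smooth_atlas_vector_manifold assms(3)])
  interpret M: atlas M by standard (rule assms)
  note vm = smooth_atlas_vector_manifold
  fix p assume p: "p \<in> W"
  define c where "c = chart_at M p"
  have c: "c \<in> charts M" "p \<in> fst c"
    by (simp_all add: c_def M.chart_at)
  let ?T = "fst c \<inter> W"
  have op: "open ?T" "open (snd c ` ?T)"
    using M.chart_image_open[OF c(1), of ?T] M.chart_open(1)[OF c(1)] assms(3) by auto
  have "smooth_along M (snd c ` ?T) (chart_inv c) (\<lambda>x. X (chart_inv c x))"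
    by (rule smooth_along_field[OF assms(1) op(2) assms(3,4)
          smooth_map_on_subset[OF smooth_map_on_chart_inv[OF assms(1) c(1)]]])
      (auto simp: M.chart_inv_chart[OF c(1)])
  then have "smooth_on (snd c ` ?T) (\<lambda>x. \<theta> (chart_inv c x) (X (chart_inv c x)))"
    by (rule smooth_along_one_form[OF assms(1) op(2) assms(2)])
  then show "\<exists>T c d. open T \<and> p \<in> T \<and> c \<in> charts M \<and> d \<in> charts vector_manifold \<and>
      T \<subseteq> fst c \<and> (\<lambda>q. \<theta> q (X q)) ` T \<subseteq> fst d \<and>
      smooth_on (snd c ` T) (\<lambda>x. snd d (\<theta> (chart_inv c x) (X (chart_inv c x))))"
    using op(1) p c by (intro exI[of _ ?T] exI[of _ c] exI[of _ "(UNIV, id)"]) auto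
qed

text \<open>Classes modulo the kernel are the fibres of \<open>\<theta> p\<close>. Lifting a section
  \<open>s\<close> to a field \<open>X\<close> thus means solving
  \<open>\<theta> q (X q) = snd (\<Phi> (q, s q))\<close>, with \<open>\<Phi>\<close> the induced
  map, which is possible locally and smoothly as \<open>\<theta>\<close> is surjective.\<close>

lemma normal_bundle_iso_induced_normal_map:
  assumes "smooth_atlas P" and \<theta>: "smooth_one_form P \<theta>" and surj: "\<And>p. surj (\<theta> p)"
  shows "normal_bundle_iso P (ker_form \<theta>) (induced_normal_map \<theta>)"
proof -
  let ?\<Phi> = "induced_normal_map \<theta>" and ?cl = "normal_class (ker_form \<theta>)"
  have lin: "linear (\<theta> p)" for p
    using \<theta> by (simp add: smooth_one_form_def)
  note \<Phi> = induced_normal_map_class[of \<theta>, OF lin] and cl = normal_class_ker_form[of \<theta>, OF lin]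
  have "inj_on ?\<Phi> (normal_bundle (ker_form \<theta>))"
  proof (rule inj_onI)
    fix z z' assume "z \<in> normal_bundle (ker_form \<theta>)" "z' \<in> normal_bundle (ker_form \<theta>)" and eq: "?\<Phi> z = ?\<Phi> z'"
    then obtain p v p' v' where z: "z = (p, ?cl p v)" "z' = (p', ?cl p' v')"
      by (auto simp: normal_bundle_def)
    have p: "p' = p"
      using eq by (simp add: z \<Phi>)
    have "\<theta> p v = \<theta> p v'"
      using eq by (simp add: z \<Phi> p)
    then show "z = z'"
      by (simp add: z p cl)
  qed
  moreover have "(p, y) \<in> ?\<Phi> ` normal_bundle (ker_form \<theta>)" for p y
  proof -
    obtain v where "y = \<theta> p v"
      using surj by (rule surjE)
    then have "(p, y) = ?\<Phi> (p, ?cl p v)"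
      by (simp add: \<Phi>)
    then show ?thesis
      by (rule image_eqI) (auto simp: normal_bundle_def)
  qed
  ultimately have bij: "bij_betw ?\<Phi> (normal_bundle (ker_form \<theta>)) UNIV"
    by (auto simp: bij_betw_def)
  have "smooth_normal_section P (ker_form \<theta>) W s \<longleftrightarrow> smooth_map_on P vector_manifold W (\<lambda>p. snd (?\<Phi> (p, s p)))"
    if W: "open W" and s: "\<And>p. p \<in> W \<Longrightarrow> (p, s p) \<in> normal_bundle (ker_form \<theta>)" for W s
  proof
    assume sec: "smooth_normal_section P (ker_form \<theta>) W s"
    show "smooth_map_on P vector_manifold W (\<lambda>p. snd (?\<Phi> (p, s p)))"
    proof (rule smooth_map_on_local[OF assms(1) smooth_atlas_vector_manifold W])
      fix p assume p: "p \<in> W"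
      obtain W' X where W': "open W'" "p \<in> W'" "W' \<subseteq> W" and X: "smooth_vector_field_on P W' X"
        and sX: "\<forall>q\<in>W'. s q = ?cl q (X q)"
        using bspec[OF sec[unfolded smooth_normal_section_def] p] by (elim exE conjE)
      have "smooth_map_on P vector_manifold W' (\<lambda>p. snd (?\<Phi> (p, s p)))"
        by (rule smooth_map_on_cong[OF assms(1) smooth_atlas_vector_manifold W'(1)
              smooth_map_on_one_form_field[OF assms(1) \<theta> W'(1) X]]) (simp add: bspec[OF sX] \<Phi>)
      then show "\<exists>T. open T \<and> p \<in> T \<and> smooth_map_on P vector_manifold T (\<lambda>p. snd (?\<Phi> (p, s p)))"
        using W' by blast
    qed
  next
    assume f: "smooth_map_on P vector_manifold W (\<lambda>p. snd (?\<Phi> (p, s p)))"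
    show "smooth_normal_section P (ker_form \<theta>) W s"
      unfolding smooth_normal_section_def
    proof
      fix p assume p: "p \<in> W"
      obtain W' X where W': "open W'" "p \<in> W'" "W' \<subseteq> W" "smooth_vector_field_on P W' X"
        and X: "\<And>q. q \<in> W' \<Longrightarrow> \<theta> q (X q) = snd (?\<Phi> (q, s q))"
        using one_form_local_section[OF assms(1) \<theta> surj W p f] by blast
      have "s q = ?cl q (X q)" if q: "q \<in> W'" for q
      proof -
        obtain v where v: "s q = ?cl q v"
          using s[of q] q W'(3) by (auto simp: normal_bundle_def)
        have "\<theta> q (X q) = \<theta> q v"
          using X[OF q] by (simp add: v \<Phi>)
        then show ?thesis
          by (simp add: v cl)
      qed
      then show "\<exists>W' X. open W' \<and> p \<in> W' \<and> W' \<subseteq> W \<and> smooth_vector_field_on P W' X \<and>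
          (\<forall>q\<in>W'. s q = ?cl q (X q))"
        using W' by blast
    qed
  qed
  moreover have "?\<Phi> \<in> extensional (normal_bundle (ker_form \<theta>))"
    by (simp add: induced_normal_map_def)
  ultimately show ?thesis
    unfolding normal_bundle_iso_def using bij lin by (auto simp: \<Phi>)
qed

text \<open>Injectivity of \<open>\<Phi>\<close> on each fibre identifies the kernel of
  \<open>\<theta>\<close> with \<open>F\<close>. Smoothness of \<open>\<theta>\<close> comes from
  testing \<open>\<Phi>\<close> on the classes of coordinate fields.\<close>

lemma normal_bundle_iso_imp_one_form:
  assumes "smooth_atlas P" and F: "\<And>p. subspace (F p)" and iso: "normal_bundle_iso P F \<Phi>"
  defines "\<theta> \<equiv> \<lambda>p v. snd (\<Phi> (p, normal_class F p v))"
  shows "smooth_one_form P \<theta>" "\<And>p. surj (\<theta> p)" "ker_form \<theta> = F" "induced_normal_map \<theta> = \<Phi>"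
    "\<And>p v. \<Phi> (p, normal_class F p v) = (p, \<theta> p v)"
proof -
  interpret P: atlas P by standard (rule assms)
  note vm = smooth_atlas_vector_manifold
  have ext: "\<Phi> \<in> extensional (normal_bundle F)" and bij: "bij_betw \<Phi> (normal_bundle F) UNIV"
    and fst: "\<And>p v. fst (\<Phi> (p, normal_class F p v)) = p" and lin: "\<And>p. linear (\<theta> p)"
    and smooth: "\<And>W s. open W \<Longrightarrow> (\<And>p. p \<in> W \<Longrightarrow> (p, s p) \<in> normal_bundle F) \<Longrightarrow>
      smooth_normal_section P F W s \<Longrightarrow> smooth_map_on P vector_manifold W (\<lambda>p. snd (\<Phi> (p, s p)))"
    using iso unfolding normal_bundle_iso_def \<theta>_def by auto
  show \<Phi>_eq: "\<Phi> (p, normal_class F p v) = (p, \<theta> p v)" for p v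
    by (simp add: prod_eq_iff fst \<theta>_def)
  have in_bundle: "(p, normal_class F p v) \<in> normal_bundle F" for p v
    by (auto simp: normal_bundle_def)
  show surj: "surj (\<theta> p)" for p
    unfolding surj_def
  proof
    fix y
    have "(p, y) \<in> \<Phi> ` normal_bundle F"
      using bij by (simp add: bij_betw_def)
    then show "\<exists>v. y = \<theta> p v"
      by (auto simp: normal_bundle_def \<Phi>_eq)
  qed
  have "v \<in> F p \<longleftrightarrow> \<theta> p v = 0" for p v
  proof
    assume "v \<in> F p"
    have "normal_class F p v = normal_class F p 0"
    proof -
      have "u \<in> (+) v ` F p" if "u \<in> F p" for u
        using that \<open>v \<in> F p\<close> by (intro image_eqI[of _ _ "u - v"]) (auto simp: subspace_diff[OF F])
      then show ?thesis
        using \<open>v \<in> F p\<close> by (auto simp: normal_class_def subspace_add[OF F])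
    qed
    then have "\<theta> p v = \<theta> p 0"
      by (simp add: \<theta>_def)
    then show "\<theta> p v = 0"
      by (simp add: linear_0[OF lin])
  next
    assume "\<theta> p v = 0"
    then have "\<Phi> (p, normal_class F p v) = \<Phi> (p, normal_class F p 0)"
      by (simp add: \<Phi>_eq linear_0[OF lin])
    then have "(p, normal_class F p v) = (p, normal_class F p 0)"
      by (rule inj_onD[OF bij_betw_imp_inj_on[OF bij] _ in_bundle in_bundle])
    then have "normal_class F p v = F p"
      by (simp add: normal_class_def)
    moreover have "v \<in> normal_class F p v"
      using subspace_0[OF F] by (auto simp: normal_class_def intro!: image_eqI[of _ _ 0])
    ultimately show "v \<in> F p"
      by simp
  qed
  then show ker: "ker_form \<theta> = F"
    by (auto simp: ker_form_def fun_eq_iff)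
  show "induced_normal_map \<theta> = \<Phi>"
  proof
    fix z
    show "induced_normal_map \<theta> z = \<Phi> z"
    proof (cases "z \<in> normal_bundle F")
      case True
      then obtain p v where "z = (p, normal_class F p v)"
        by (auto simp: normal_bundle_def)
      then show ?thesis
        using induced_normal_map_class[of \<theta> p v, OF lin] by (simp add: \<Phi>_eq ker)
    next
      \<comment> \<open>Outside the normal bundle both maps take the default value, by
        extensionality.\<close>
      case False
      then show ?thesis
        using extensional_arb[OF ext False] by (simp add: induced_normal_map_def ker)
    qed
  qed
  have "smooth_on (snd c ` fst c) (\<lambda>x. pullback vector_manifold P (chart_inv c) \<theta> x v)"
    if c: "c \<in> charts P" for c v
  proof -
    \<comment> \<open>The field with constant coordinates \<open>v\<close> in the chart
      \<open>c\<close>; on it, \<open>\<theta>\<close> is the coordinate expression of the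
      form.\<close>
    let ?X = "\<lambda>q. tangent_map vector_manifold P (chart_inv c) (snd c q) v"
    have X: "smooth_vector_field_on P (fst c) ?X"
      using smooth_field_from_chart[OF assms(1) c P.chart_open(1)[OF c] order_refl P.chart_open(2)[OF c] order_refl
          smooth_on_const order_refl] .
    have "smooth_normal_section P F (fst c) (\<lambda>q. normal_class F q (?X q))"
      unfolding smooth_normal_section_def using X P.chart_open(1)[OF c] by blast
    then have "smooth_map_on P vector_manifold (fst c) (\<lambda>q. \<theta> q (?X q))"
      using smooth[OF P.chart_open(1)[OF c] in_bundle] by (simp add: \<theta>_def)
    from smooth_map_onD[OF this c, of "(UNIV, id)"]
    have "smooth_on (snd c ` fst c) (\<lambda>x. \<theta> (chart_inv c x) (?X (chart_inv c x)))"
      by simp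
    then show ?thesis
      by (subst smooth_on_cong[OF P.chart_open(2)[OF c]]) (auto simp: pullback_def P.chart_inv_chart[OF c])
  qed
  then show "smooth_one_form P \<theta>"
    using lin by (auto simp: smooth_one_form_def)
qed

section \<open>The equivalence\<close>

context principal_lie_bundle
begin

lemma principal_pfaffian_bundle_iff_form_datum:
  assumes pf: "pfaffian_group G mul one ginv \<rho> \<omega>"
  shows "principal_pfaffian_bundle G mul one \<rho> \<omega> P act M \<pi> \<theta> \<longleftrightarrow> form_datum G mul one \<rho> (\<omega> one) P act M \<pi> \<theta>"
    (is "?pfaff \<longleftrightarrow> ?datum")
proof (cases "smooth_one_form P \<theta>")
  case True
  then have lin: "\<And>p. linear (\<theta> p)"
    by (simp add: smooth_one_form_def)
  have lin': "\<And>g. linear (\<omega> g)" "\<And>g. linear (\<rho> g)" and mult: "multiplicative_over G \<rho> \<omega> G mul \<omega>"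
    and inv: "involutive G (ker_form \<omega>)"
    using pf by (auto simp: pfaffian_group_def smooth_one_form_def representation_def)
  note iff = multiplicative_over_iff[of \<omega> \<theta> \<rho>, OF lin'(1) lin lin'(2)]
  have right: "\<omega> (mul g h) (tangent_map G G (\<lambda>g. mul g h) g \<alpha>) = \<omega> g \<alpha>" for g h \<alpha>
    using mult by (simp add: mult.multiplicative_over_iff[of \<omega> \<omega> \<rho>, OF lin'(1) lin'(1) lin'(2)])
  show ?thesis
  proof
    assume ?pfaff
    then have p: "vertical P M \<pi> (ker_form \<theta>)" "\<forall>p. surj (\<theta> p)" "equivariant_form P act \<rho> \<theta>"
      and orb: "\<And>g p \<alpha>. \<theta> (act g p) (tangent_map G P (\<lambda>g. act g p) g \<alpha>) = \<omega> g \<alpha>"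
      by (auto simp: principal_pfaffian_bundle_def iff)
    have "\<theta> p (inf_action G one P act \<alpha> p) = \<omega> one \<alpha>" for \<alpha> p
      using orb[of one p \<alpha>] by (simp add: inf_action_eq act_one)
    then show ?datum
      using True principal p involutive_ker_form[OF inv p(1) orb] by (simp add: form_datum_def)
  next
    assume datum: ?datum
    \<comment> \<open>The velocity is the infinitesimal action of the right translate of
      \<open>\<alpha>\<close> to the unit, so \<open>\<theta>\<close> gives
      \<open>\<omega> one\<close> of that translate. Right invariance of \<open>\<omega>\<close>
      identifies this with \<open>\<omega> g \<alpha>\<close>.\<close>
    have "\<theta> (act g p) (tangent_map G P (\<lambda>g. act g p) g \<alpha>) = \<omega> g \<alpha>" for g p \<alpha>
      using datum right[of g "ginv g" \<alpha>]
      by (simp add: form_datum_def tangent_orbit_eq_inf_action grp.right_inverse)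
    then show ?pfaff
      using datum by (simp add: principal_pfaffian_bundle_def form_datum_def iff)
  qed
qed (simp add: principal_pfaffian_bundle_def form_datum_def)

lemma form_datum_imp_foliation_datum:
  assumes "linear l" and datum: "form_datum G mul one \<rho> l P act M \<pi> \<theta>"
  shows "foliation_datum G mul one \<rho> l P act M \<pi> (ker_form \<theta>) (induced_normal_map \<theta>)"
proof -
  have \<theta>: "smooth_one_form P \<theta>" "equivariant_form P act \<rho> \<theta>" "\<And>p. surj (\<theta> p)" "involutive P (ker_form \<theta>)"
      "vertical P M \<pi> (ker_form \<theta>)" "\<And>\<alpha> p. \<theta> p (inf_action G one P act \<alpha> p) = l \<alpha>"
    using datum by (auto simp: form_datum_def)
  have lin: "linear (\<theta> p)" for p
    using \<theta>(1) by (simp add: smooth_one_form_def)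
  have equiv: "\<theta> (act g p) (tangent_map P P (act g) p v) = \<rho> g (\<theta> p v)" for g p v
    using \<theta>(2) by (simp add: equivariant_form_def)
  \<comment> \<open>Linearity of \<open>\<rho> g\<close> is not at hand here; equivariance at a zero
    vector supplies this value.\<close>
  have \<rho>0: "\<rho> g 0 = 0" for g
    using equiv[of g _ 0] by (simp add: linear_0[OF lin] linear_0[OF linear_tangent_translation])
  have sub: "tangent_map P P (act g) p ` ker_form \<theta> p \<subseteq> ker_form \<theta> (act g p)" for g p
    by (auto simp: ker_form_def equiv \<rho>0)
  \<comment> \<open>The reverse inclusion is \<open>sub\<close> for \<open>ginv g\<close>, whose
    translation inverts that of \<open>g\<close>.\<close>
  have "ker_form \<theta> (act g p) \<subseteq> tangent_map P P (act g) p ` ker_form \<theta> p" for g p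
  proof
    fix w assume w: "w \<in> ker_form \<theta> (act g p)"
    let ?w = "tangent_map P P (act (ginv g)) (act g p) w"
    have p: "act (ginv g) (act g p) = p"
      by (simp add: grp.left_inverse act_one flip: act_mul)
    have "?w \<in> ker_form \<theta> p"
      using sub[of "ginv g" "act g p"] w by (auto simp: p)
    then show "w \<in> tangent_map P P (act g) p ` ker_form \<theta> p"
      using tangent_translation_inverse[of g "act g p" w] by (auto simp: p intro!: image_eqI[of _ _ ?w])
  qed
  with sub have "equivariant_distribution P act (ker_form \<theta>)"
    by (simp add: equivariant_distribution_def subset_antisym)
  moreover have "foliation P (ker_form \<theta>)"
    using smooth_distribution_ker_form[OF assms(1) lin \<theta>(5,6)] \<theta>(4) by (simp add: foliation_def)
  moreover have "equivariant_normal_map P act \<rho> (ker_form \<theta>) (induced_normal_map \<theta>)"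
    by (simp add: equivariant_normal_map_def induced_normal_map_class[of \<theta>, OF lin] equiv)
  ultimately show ?thesis
    using principal \<theta>(5,6) normal_bundle_iso_induced_normal_map[OF atlas_P \<theta>(1,3)]
    by (simp add: foliation_datum_def induced_normal_map_class[of \<theta>, OF lin])
qed

lemma foliation_datum_imp_form_datum:
  assumes datum: "foliation_datum G mul one \<rho> l P act M \<pi> F \<Phi>"
  shows "\<exists>\<theta>. form_datum G mul one \<rho> l P act M \<pi> \<theta> \<and> ker_form \<theta> = F \<and> induced_normal_map \<theta> = \<Phi>"
proof -
  have F: "subspace (F p)" for p
    using datum by (simp add: foliation_datum_def foliation_def smooth_distribution_def)
  have iso: "normal_bundle_iso P F \<Phi>"
    using datum by (simp add: foliation_datum_def)
  define \<theta> where "\<theta> p v = snd (\<Phi> (p, normal_class F p v))" for p v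
  note \<theta> = normal_bundle_iso_imp_one_form[OF atlas_P F iso, folded \<theta>_def]
  have "equivariant_form P act \<rho> \<theta>"
    using datum unfolding foliation_datum_def equivariant_normal_map_def equivariant_form_def
    by (simp add: \<theta>(5))
  then have "form_datum G mul one \<rho> l P act M \<pi> \<theta>"
    using datum \<theta> by (simp add: foliation_datum_def form_datum_def foliation_def)
  with \<theta>(3,4) show ?thesis
    by blast
qed

end

theorem proposition2p30:
  fixes G :: "('g::{t2_space, second_countable_topology}, 'l::fin_dim_vector) manifold"
    and mul :: "'g \<Rightarrow> 'g \<Rightarrow> 'g" and one :: 'g and ginv :: "'g \<Rightarrow> 'g"
    and \<rho> :: "'g \<Rightarrow> 'v::fin_dim_vector \<Rightarrow> 'v"
    and \<omega> :: "'g \<Rightarrow> 'l \<Rightarrow> 'v"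
    and l :: "'l \<Rightarrow> 'v"
    and M :: "('m::{t2_space, second_countable_topology}, 'f::fin_dim_vector) manifold"
    and P :: "('p::{t2_space, second_countable_topology}, 'e::fin_dim_vector) manifold"
    and act :: "'g \<Rightarrow> 'p \<Rightarrow> 'p" and \<pi> :: "'p \<Rightarrow> 'm"
  assumes pfaffian: "pfaffian_group G mul one ginv \<rho> \<omega>"
    and l: "l = \<omega> one"
    and M: "smooth_manifold M"
  shows "bij_betw (\<lambda>\<theta>. (ker_form \<theta>, induced_normal_map \<theta>))
           {\<theta>. principal_pfaffian_bundle G mul one \<rho> \<omega> P act M \<pi> \<theta>}
           {(F, \<Phi>). foliation_datum G mul one \<rho> l P act M \<pi> F \<Phi>} \<and>
         {\<theta>. principal_pfaffian_bundle G mul one \<rho> \<omega> P act M \<pi> \<theta>} =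
           {\<theta>. form_datum G mul one \<rho> l P act M \<pi> \<theta>}"
proof (cases "principal_bundle G mul one P act M \<pi>")
  case True
  have lie: "lie_group G mul one ginv" and lin: "linear l"
    using pfaffian by (auto simp: pfaffian_group_def smooth_one_form_def l)
  interpret principal_lie_bundle G mul one ginv P act M \<pi>
    by standard (rule lie, rule True)
  let ?f = "\<lambda>\<theta>. (ker_form \<theta>, induced_normal_map \<theta>)"
  let ?D = "{\<theta>. form_datum G mul one \<rho> l P act M \<pi> \<theta>}"
  have eq: "{\<theta>. principal_pfaffian_bundle G mul one \<rho> \<omega> P act M \<pi> \<theta>} = ?D"
    by (simp add: principal_pfaffian_bundle_iff_form_datum[OF pfaffian] l)
  have linear: "linear (\<theta> p)" if "\<theta> \<in> ?D" for \<theta> p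
    using that by (simp add: form_datum_def smooth_one_form_def)
  have "inj_on ?f ?D"
  proof (rule inj_onI)
    fix \<theta> \<theta>' assume \<theta>: "\<theta> \<in> ?D" "\<theta>' \<in> ?D" and eq: "?f \<theta> = ?f \<theta>'"
    show "\<theta> = \<theta>'"
    proof (intro ext)
      fix p v
      \<comment> \<open>Equal kernels make the two classes of \<open>v\<close> equal, and the common
        induced map recovers both forms from this class.\<close>
      have "(p, \<theta> p v) = (p, \<theta>' p v)"
        using induced_normal_map_class[of \<theta> p v, OF linear[OF \<theta>(1)]]
          induced_normal_map_class[of \<theta>' p v, OF linear[OF \<theta>(2)]] eq by simp
      then show "\<theta> p v = \<theta>' p v"
        by simp
    qed
  qed
  moreover have "?f ` ?D = {(F, \<Phi>). foliation_datum G mul one \<rho> l P act M \<pi> F \<Phi>}"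
    using form_datum_imp_foliation_datum[OF lin] foliation_datum_imp_form_datum by force
  ultimately show ?thesis
    unfolding eq by (simp add: bij_betw_def)
next
  \<comment> \<open>Each of the three kinds of data includes the principal bundle, so all the sets
    are empty.\<close>
  case False
  then show ?thesis
    by (simp add: principal_pfaffian_bundle_def foliation_datum_def form_datum_def bij_betw_def)
qed

end
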